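(* Let $c=(c_n)_{n=-\infty}^\infty\subset\mathbb{H}$ be a non-trivial positive definite sequence with $c_0=1$ and with quaternionic Verblunsky coefficients $(\gamma_n)_{n=0}^\infty$. Choose orthogonal $i,j\in\mathbb{S}$ and let $M_i$ be the matrix-valued measure on $\mathbb{T}_i$ with moments $(\chi_i(c_n))_{n=-\infty}^\infty$, with Radon–Nikodym derivative $W_i\in L^1(\mathbb{T}_i;\mathbb{C}_i^{2\times2})$. Then $$\sum_{n=0}^\infty|\gamma_n|^2<\infty\quad\text{if and only if}\quad\int_0^{2\pi}\log\det W_i(e^{i\theta})\,\frac{\mathrm{d}\theta}{2\pi}>-\infty.$$
   Context: $\mathbb{H}$ is the quaternions, $\mathbb{S}$ the sphere of purely imaginary unit quaternions (so $i^2=-1$ for $i\in\mathbb{S}$). For $i\in\mathbb{S}$: $\mathbb{C}_i=\mathbb{R}+\mathbb{R}i$, $\mathbb{T}_i$ is its unit circle. If $i,j\in\mathbb{S}$ are orthogonal (as vectors in $\mathbb{R}^3$), every quaternion is uniquely $p=p^{(1)}+p^{(2)}j$ with $p^{(1)},p^{(2)}\in\mathbb{C}_i$, and $\chi_i(p)=\begin{bmatrix}p^{(1)}&p^{(2)}\\-\overline{p^{(2)}}&\overline{p^{(1)}}\end{bmatrix}\in\mathbb{C}_i^{2\times2}$. A bi-infinite sequence $c=(c_n)_{n\in\mathbb{Z}}$ in $\mathbb{H}$ is positive definite if for every $n\ge0$ the Toeplitz matrix $T_n(c)=[c_{\ell-k}]_{k,\ell=0}^n$ (row $k$, column $\ell$)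 is positive semidefinite ($\xi^*T_n(c)\xi\ge0$ for all $\xi\in\mathbb{H}^{n+1}$), and is non-trivial if moreover every $T_n(c)$ is positive definite ($\xi^*T_n(c)\xi>0$ for all nonzero $\xi$). $M_i$ is the unique positive semidefinite matrix-valued measure on $\mathbb{T}_i$ with $\int_0^{2\pi}e^{in\theta}\mathrm{d}M_i(\theta)=\chi_i(c_n)$ for all $n\in\mathbb{Z}$. Its Radon–Nikodym derivative $W_i$ is the density of its absolutely continuous part: $\mathrm{d}M_i=W_i\frac{\mathrm{d}\theta}{2\pi}+\mathrm{d}M_{i,\mathrm{s}}$ (Lebesgue decomposition). The integral of $\log\det W_i$ takes values in $[-\infty,\infty)$, with $\log0=-\infty$. Verblunsky coefficients. For power series with right coefficients the $\star$-product is $(\sum p^ka_k)\star(\sum p^kb_k)=\sum_np^n\sum_{k=0}^na_kb_{n-k}$, and $g^{-\star}$ is the $\star$-inverse. Let $F(p)=1+2\sum_{n\ge1}p^nc_{-n}$ for $|p|<1$, and let $f$ be the quaternionic Schur function with $F=(1+pf)\star(1-pf)^{-\star}$. The Verblunsky coefficients of $c$ are given by the quaternionic Schur algorithm: $f_0=f$, $\gamma_n=f_n(0)$, $p\,f_{n+1}(p)=(f_n-\gamma_n)\star(1-\overline{\gamma_n}\star f_n)^{-\star}(p)$; they satisfy $|\gamma_n|<1$. *)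

theory Defs
  imports "HOL-Analysis.Analysis"
begin

section \<open>Quaternions\<close>

datatype quat = Quat (qRe: real) (qI: real) (qJ: real) (qK: real)

lemma quat_eq_iff: "p = q \<longleftrightarrow> qRe p = qRe q \<and> qI p = qI q \<and> qJ p = qJ q \<and> qK p = qK q"
  by (cases p; cases q) auto

definition qcnj :: "quat \<Rightarrow> quat" where
  "qcnj p = Quat (qRe p) (- qI p) (- qJ p) (- qK p)"

instantiation quat :: real_div_algebra
begin

definition "0 = Quat 0 0 0 0"
definition "1 = Quat 1 0 0 0"
definition "p + q = Quat (qRe p + qRe q) (qI p + qI q) (qJ p + qJ q) (qK p + qK q)"
definition "- p = Quat (- qRe p) (- qI p) (- qJ p) (- qK p)"
definition "p - q = Quat (qRe p - qRe q) (qI p - qI q) (qJ p - qJ q) (qK p - qK q)"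
definition "r *\<^sub>R p = Quat (r * qRe p) (r * qI p) (r * qJ p) (r * qK p)"
definition "p * q = Quat
  (qRe p * qRe q - qI p * qI q - qJ p * qJ q - qK p * qK q)
  (qRe p * qI q + qI p * qRe q + qJ p * qK q - qK p * qJ q)
  (qRe p * qJ q - qI p * qK q + qJ p * qRe q + qK p * qI q)
  (qRe p * qK q + qI p * qJ q - qJ p * qI q + qK p * qRe q)"
definition "inverse p = inverse ((qRe p)\<^sup>2 + (qI p)\<^sup>2 + (qJ p)\<^sup>2 + (qK p)\<^sup>2) *\<^sub>R qcnj p" for p :: quat
definition "p div q = p * inverse q" for p q :: quat

lemmas quat_ops = zero_quat_def one_quat_def plus_quat_def uminus_quat_def minus_quat_def
  scaleR_quat_def times_quat_def

lemma quat_sum_squares_eq_0: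
  "(qRe p)\<^sup>2 + (qI p)\<^sup>2 + (qJ p)\<^sup>2 + (qK p)\<^sup>2 = 0 \<longleftrightarrow> p = 0"
proof
  assume *: "(qRe p)\<^sup>2 + (qI p)\<^sup>2 + (qJ p)\<^sup>2 + (qK p)\<^sup>2 = 0"
  have "(qRe p)\<^sup>2 = 0" "(qI p)\<^sup>2 = 0" "(qJ p)\<^sup>2 = 0" "(qK p)\<^sup>2 = 0"
    using * zero_le_power2[of "qRe p"] zero_le_power2[of "qI p"]
      zero_le_power2[of "qJ p"] zero_le_power2[of "qK p"] by linarith+
  then show "p = 0" by (simp add: quat_eq_iff zero_quat_def)
qed (simp add: zero_quat_def)

lemma quat_mult_qcnj:
  "p * qcnj p = ((qRe p)\<^sup>2 + (qI p)\<^sup>2 + (qJ p)\<^sup>2 + (qK p)\<^sup>2) *\<^sub>R 1"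
  "qcnj p * p = ((qRe p)\<^sup>2 + (qI p)\<^sup>2 + (qJ p)\<^sup>2 + (qK p)\<^sup>2) *\<^sub>R 1"
  by (simp_all add: quat_eq_iff quat_ops qcnj_def power2_eq_square)

instance
proof
  fix p q r :: quat and a b :: real
  show "p * q * r = p * (q * r)"
    by (simp add: quat_eq_iff quat_ops algebra_simps)
  show "inverse p * p = 1" "p * inverse p = 1" if "p \<noteq> 0"
  proof -
    have sc: "(a *\<^sub>R x) * y = a *\<^sub>R (x * y)" "x * (a *\<^sub>R y) = a *\<^sub>R (x * y)"
      for a and x y :: quat
      by (simp_all add: quat_eq_iff quat_ops algebra_simps)
    have sc': "inverse a *\<^sub>R a *\<^sub>R x = x" if "a \<noteq> 0" for a and x :: quat
      using that by (simp add: quat_eq_iff quat_ops)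
    have "(qRe p)\<^sup>2 + (qI p)\<^sup>2 + (qJ p)\<^sup>2 + (qK p)\<^sup>2 \<noteq> 0"
      using that by (simp only: quat_sum_squares_eq_0 not_False_eq_True)
    from sc'[OF this, of 1] show "inverse p * p = 1" "p * inverse p = 1"
      by (simp_all only: inverse_quat_def sc quat_mult_qcnj)
  qed
  show "inverse (0 :: quat) = 0"
    by (simp add: inverse_quat_def quat_eq_iff quat_ops qcnj_def)
qed (simp_all add: quat_eq_iff quat_ops divide_quat_def algebra_simps)

end

instantiation quat :: real_inner
begin

definition "inner p q = qRe p * qRe q + qI p * qI q + qJ p * qJ q + qK p * qK q"
definition "norm p = sqrt (inner p p)" for p :: quat
definition "sgn p = p /\<^sub>R norm p" for p :: quat
definition "dist p q = norm (p - q)" for p q :: quat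
definition [code del]: "(uniformity :: (quat \<times> quat) filter)
  = (INF e\<in>{0 <..}. principal {(x, y). dist x y < e})"
definition [code del]: "open (U :: quat set)
  \<longleftrightarrow> (\<forall>x\<in>U. eventually (\<lambda>(x', y). x' = x \<longrightarrow> y \<in> U) uniformity)"

instance
proof
  fix p q r :: quat and a :: real
  show "inner p p = 0 \<longleftrightarrow> p = 0"
    using quat_sum_squares_eq_0[of p] by (simp add: inner_quat_def power2_eq_square)
qed (simp_all add: inner_quat_def norm_quat_def sgn_quat_def dist_quat_def
      uniformity_quat_def open_quat_def quat_ops algebra_simps)

end

instance quat :: real_normed_div_algebra
proof
  fix p q :: quat
  have "inner (p * q) (p * q) = inner p p * inner q q"
    by (simp add: inner_quat_def quat_ops) algebra
  then show "norm (p * q) = norm p * norm q"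
    by (simp add: norm_quat_def real_sqrt_mult)
qed

lemma qcnj_simps [simp]:
  "qRe (qcnj p) = qRe p" "qI (qcnj p) = - qI p" "qJ (qcnj p) = - qJ p" "qK (qcnj p) = - qK p"
  by (simp_all add: qcnj_def)

definition imag_units :: "quat set" (\<open>\<S>\<close>) where
  "\<S> = {i. qRe i = 0 \<and> norm i = 1}"

lemma imag_units_square: "i * i = - 1" if "i \<in> \<S>"
proof -
  have "norm i = 1" using that by (simp add: imag_units_def)
  then have "inner i i = 1" by (simp add: norm_quat_def)
  then have "qI i * qI i + qJ i * qJ i + qK i * qK i = 1"
    using that by (simp add: inner_quat_def imag_units_def)
  then show ?thesis
    using that by (simp add: imag_units_def quat_eq_iff quat_ops)
qed

text \<open>
  For \<open>i \<in> \<S>\<close> the subfield \<open>\<real> + \<real> i\<close> of the quaternions is identified with the type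
  \<^typ>\<open>complex\<close> along \<open>slice_of i\<close>.  Matrices over \<open>\<real> + \<real> i\<close> and the unit circle of
  \<open>\<real> + \<real> i\<close> are transported to \<open>complex^2^2\<close> and to the unit circle of \<^typ>\<open>complex\<close>.
\<close>

definition slice_of :: "quat \<Rightarrow> complex \<Rightarrow> quat" where
  "slice_of i z = of_real (Re z) + of_real (Im z) * i"

lemma of_real_quat: "of_real r = Quat r 0 0 0"
  by (simp add: of_real_def quat_ops)

lemma slice_of_sel:
  "qRe (slice_of i z) = Re z + Im z * qRe i" "qI (slice_of i z) = Im z * qI i"
  "qJ (slice_of i z) = Im z * qJ i" "qK (slice_of i z) = Im z * qK i"
  by (simp_all add: slice_of_def of_real_quat quat_ops)

lemma imag_units_coords:
  assumes "i \<in> \<S>"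
  shows "qRe i = 0" "qI i * qI i + qJ i * qJ i + qK i * qK i = 1"
proof -
  show "qRe i = 0" using assms by (simp add: imag_units_def)
  moreover have "sqrt (inner i i) = 1" using assms by (simp add: imag_units_def norm_quat_def)
  ultimately show "qI i * qI i + qJ i * qJ i + qK i * qK i = 1"
    by (simp add: inner_quat_def)
qed

lemma slice_of_ring_iso:
  assumes "i \<in> \<S>"
  shows "slice_of i (z + w) = slice_of i z + slice_of i w"
    and "slice_of i (z * w) = slice_of i z * slice_of i w"
    and "slice_of i 1 = 1"
    and "slice_of i (cnj z) = qcnj (slice_of i z)"
    and "norm (slice_of i z) = norm z"
    and "range (slice_of i) = {of_real x + of_real y * i | x y. True}"
    and "inj (slice_of i)"
proof -
  note re = imag_units_coords(1)[OF assms] and ii = imag_units_coords(2)[OF assms]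
  have ii': "a * b = a * qI i * (b * qI i) + a * qJ i * (b * qJ i) + a * qK i * (b * qK i)" for a b
    using arg_cong[OF ii, of "\<lambda>t. a * b * t"] by (simp add: ring_distribs mult_ac)
  show "slice_of i (z + w) = slice_of i z + slice_of i w"
    by (simp add: quat_eq_iff slice_of_sel plus_quat_def re ring_distribs)
  show "slice_of i (z * w) = slice_of i z * slice_of i w"
    using ii'[of "Im z" "Im w"]
    by (simp add: quat_eq_iff slice_of_sel times_quat_def re ring_distribs)
  show "slice_of i 1 = 1"
    by (simp add: slice_of_def)
  show "slice_of i (cnj z) = qcnj (slice_of i z)"
    by (simp add: quat_eq_iff slice_of_sel re)
  have n: "norm (slice_of i z) = norm z" for z
    using ii'[of "Im z" "Im z"]
    by (simp add: norm_quat_def inner_quat_def slice_of_sel re cmod_def power2_eq_square)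
  then show "norm (slice_of i z) = norm z" .
  show "range (slice_of i) = {of_real x + of_real y * i | x y. True}"
    by (auto simp: slice_of_def image_iff) (metis complex.sel)
  show "inj (slice_of i)"
  proof (rule injI)
    fix z w assume "slice_of i z = slice_of i w"
    then have "slice_of i (z - w) = 0"
      by (simp add: quat_eq_iff slice_of_sel zero_quat_def re ring_distribs)
    then show "z = w" using n[of "z - w"] by simp
  qed
qed

definition slice_parts :: "quat \<Rightarrow> quat \<Rightarrow> quat \<Rightarrow> complex \<times> complex" where
  "slice_parts i j p = (THE (z, w). p = slice_of i z + slice_of i w * j)"

definition chi :: "quat \<Rightarrow> quat \<Rightarrow> quat \<Rightarrow> complex^2^2" where
  "chi i j p = (case slice_parts i j p of (z, w) \<Rightarrow>
     vector [vector [z, w], vector [- cnj w, cnj z]])"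

lemma slice_of_commute: "i * slice_of i z = slice_of i z * i"
  by (simp add: quat_eq_iff slice_of_sel times_quat_def algebra_simps)

lemma commute_imp_slice:
  assumes i: "i \<in> \<S>" and c: "i * q = q * i"
  shows "q \<in> range (slice_of i)"
proof -
  note re = imag_units_coords(1)[OF i] and ii = imag_units_coords(2)[OF i]
  have c: "qJ i * qK q = qK i * qJ q" "qK i * qI q = qI i * qK q" "qI i * qJ q = qJ i * qI q"
    using c by (simp_all add: quat_eq_iff times_quat_def re) (auto simp: algebra_simps)
  let ?t = "qI q * qI i + qJ q * qJ i + qK q * qK i"
  have "qI q = ?t * qI i" "qJ q = ?t * qJ i" "qK q = ?t * qK i"
    using c ii by algebra+
  then have "q = slice_of i (Complex (qRe q) ?t)"
    by (simp add: quat_eq_iff slice_of_sel re)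
  then show ?thesis by (rule range_eqI)
qed

lemma imag_units_anticommute:
  assumes "i \<in> \<S>" "j \<in> \<S>" "inner i j = 0"
  shows "j * i = - (i * j)"
  using assms(3) imag_units_coords(1)[OF assms(1)] imag_units_coords(1)[OF assms(2)]
  by (simp add: quat_eq_iff times_quat_def uminus_quat_def inner_quat_def mult.commute)

lemma slice_parts_ex1:
  assumes i: "i \<in> \<S>" and j: "j \<in> \<S>" and ij: "inner i j = 0"
  shows "\<exists>!(z, w). p = slice_of i z + slice_of i w * j"
proof -
  note ii = imag_units_square[OF i] and jj = imag_units_square[OF j]
  note ji = imag_units_anticommute[OF i j ij]
  have iix: "i * (i * x) = - x" and jjx: "j * (j * x) = - x" and jix: "j * (i * x) = - (i * (j * x))"
    for x
    using arg_cong[OF ii, of "\<lambda>t. t * x"] arg_cong[OF jj, of "\<lambda>t. t * x"]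
      arg_cong[OF ji, of "\<lambda>t. t * x"] by (simp_all add: mult.assoc)
  have "p - i * p * i \<in> range (slice_of i)"
    by (rule commute_imp_slice[OF i]) (simp add: ring_distribs mult.assoc iix ii)
  then obtain z where z: "p - i * p * i = slice_of i z" by blast
  have "- ((p + i * p * i) * j) \<in> range (slice_of i)"
    by (rule commute_imp_slice[OF i]) (simp add: ring_distribs mult.assoc iix ii ji jix)
  then obtain w where w: "- ((p + i * p * i) * j) = slice_of i w" by blast
  have half: "slice_of i (z / 2) = slice_of i z /\<^sub>R 2" for z
    by (simp add: quat_eq_iff slice_of_sel scaleR_quat_def imag_units_coords(1)[OF i])
  have "slice_of i w * j = p + i * p * i"
    unfolding w[symmetric] by (simp add: ring_distribs mult.assoc jj)
  then have "slice_of i z + slice_of i w * j = 2 *\<^sub>R p"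
    unfolding z[symmetric] by (simp add: scaleR_2)
  then have "slice_of i (z / 2) + slice_of i (w / 2) * j = p"
    unfolding half by (simp flip: scaleR_add_right)
  moreover have "z = z' \<and> w = w'"
    if eq: "slice_of i z + slice_of i w * j = slice_of i z' + slice_of i w' * j" for z w z' w'
  proof -
    have diff: "slice_of i (u - v) = slice_of i u - slice_of i v" for u v
      by (simp add: quat_eq_iff slice_of_sel minus_quat_def imag_units_coords(1)[OF i]
          ring_distribs)
    define a b where "a = slice_of i (z - z')" and "b = slice_of i (w - w')"
    have ab: "a = - (b * j)"
      using eq by (simp add: a_def b_def diff algebra_simps)
    have "i * a = a * i" "i * b = b * i"
      by (simp_all add: a_def b_def slice_of_commute)
    moreover have "i * a = - (a * i)"
    proof -
      have "i * a = - (i * b * j)" by (simp add: ab mult.assoc)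
      also have "\<dots> = - (b * (i * j))" by (simp add: \<open>i * b = b * i\<close> mult.assoc)
      also have "\<dots> = b * (j * i)" by (simp add: ji)
      also have "\<dots> = - (a * i)" by (simp add: ab mult.assoc)
      finally show ?thesis .
    qed
    ultimately have "a * i + a * i = 0" by (metis add.right_inverse)
    then have "2 *\<^sub>R (a * i) = 0" by (simp only: scaleR_2)
    moreover have "i \<noteq> 0" "j \<noteq> 0" using ii jj by auto
    ultimately have "a = 0" "b = 0" using ab by auto
    then have "norm (z - z') = 0" "norm (w - w') = 0"
      unfolding a_def b_def using slice_of_ring_iso(5)[OF i] by (metis norm_zero)+
    then show ?thesis by simp
  qed
  ultimately show ?thesis
    by (intro ex1I[of _ "(z / 2, w / 2)"]) auto
qed


section \<open>Positive definite sequences\<close>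

definition toeplitz_form :: "(int \<Rightarrow> quat) \<Rightarrow> nat \<Rightarrow> (nat \<Rightarrow> quat) \<Rightarrow> quat" where
  "toeplitz_form c n \<xi> = (\<Sum>k\<le>n. \<Sum>l\<le>n. qcnj (\<xi> k) * c (int l - int k) * \<xi> l)"

definition positive_definite_seq :: "(int \<Rightarrow> quat) \<Rightarrow> bool" where
  "positive_definite_seq c \<longleftrightarrow> (\<forall>n \<xi>. toeplitz_form c n \<xi> \<in> \<real>\<^sub>\<ge>\<^sub>0)"

definition nontrivial_positive_definite_seq :: "(int \<Rightarrow> quat) \<Rightarrow> bool" where
  "nontrivial_positive_definite_seq c \<longleftrightarrow> positive_definite_seq c \<and>
     (\<forall>n \<xi>. (\<exists>k\<le>n. \<xi> k \<noteq> 0) \<longrightarrow> toeplitz_form c n \<xi> \<in> \<real>\<^sub>\<ge>\<^sub>0 - {0})"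


section \<open>Verblunsky coefficients\<close>

text \<open>
  A power series \<open>\<Sum>n. p ^ n * a n\<close> with right coefficients is represented by the formal power
  series with coefficients \<open>a\<close>.  The library product of formal power series over the
  noncommutative ring \<^typ>\<open>quat\<close> is the \<open>\<star>\<close>-product, and for a series with nonzero constant
  coefficient the library \<^const>\<open>inverse\<close> is the two-sided \<open>\<star>\<close>-inverse.
\<close>

definition schur_function :: "quat fps \<Rightarrow> bool" where
  "schur_function f \<longleftrightarrow> (\<forall>p. norm p < 1 \<longrightarrow>
     summable (\<lambda>n. p ^ n * fps_nth f n) \<and> norm (\<Sum>n. p ^ n * fps_nth f n) \<le> 1)"

definition caratheodory_fps :: "(int \<Rightarrow> quat) \<Rightarrow> quat fps" where
  "caratheodory_fps c = Abs_fps (\<lambda>n. if n = 0 then 1 else 2 * c (- int n))"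

definition schur_fps_of :: "(int \<Rightarrow> quat) \<Rightarrow> quat fps \<Rightarrow> bool" where
  "schur_fps_of c f \<longleftrightarrow> schur_function f \<and>
     caratheodory_fps c = (1 + fps_X * f) * inverse (1 - fps_X * f)"

definition schur_algorithm :: "quat fps \<Rightarrow> (nat \<Rightarrow> quat fps) \<Rightarrow> (nat \<Rightarrow> quat) \<Rightarrow> bool" where
  "schur_algorithm f fs \<gamma> \<longleftrightarrow> fs 0 = f \<and>
     (\<forall>n. \<gamma> n = fps_nth (fs n) 0 \<and>
       fps_X * fs (Suc n) = (fs n - fps_const (\<gamma> n)) *
         inverse (1 - fps_const (qcnj (\<gamma> n)) * fs n))"

definition verblunsky_coefficients :: "(int \<Rightarrow> quat) \<Rightarrow> (nat \<Rightarrow> quat) \<Rightarrow> bool" where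
  "verblunsky_coefficients c \<gamma> \<longleftrightarrow> (\<exists>f fs. schur_fps_of c f \<and> schur_algorithm f fs \<gamma>)"

lemma fps_X_mult_cancel: "fps_X * f = fps_X * g \<longleftrightarrow> f = g" for f g :: "quat fps"
proof
  assume "fps_X * f = fps_X * g"
  then have "fps_nth (fps_X * f) (Suc n) = fps_nth (fps_X * g) (Suc n)" for n by simp
  then show "f = g" by (simp add: fps_eq_iff)
qed simp

lemma schur_fps_of_unique:
  assumes "schur_fps_of c f" "schur_fps_of c g"
  shows "f = g"
proof -
  define F where "F = caratheodory_fps c"
  have inv: "inverse (F + 1) * (F + 1) = 1"
    by (rule inverse_mult_eq_1)
      (simp add: F_def caratheodory_fps_def one_quat_def zero_quat_def plus_quat_def)
  have "fps_X * h = inverse (F + 1) * (F - 1)" if "schur_fps_of c h" for h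
  proof -
    define u where "u = fps_X * h"
    have "F = (1 + u) * inverse (1 - u)"
      using that by (simp add: schur_fps_of_def F_def u_def)
    then have "F * (1 - u) = (1 + u) * (inverse (1 - u) * (1 - u))"
      by (simp only: mult.assoc)
    also have "inverse (1 - u) * (1 - u) = 1"
      by (rule inverse_mult_eq_1) (simp add: u_def)
    finally have "F - F * u = 1 + u" by (simp add: right_diff_distrib)
    then have "F * u + u = F - 1" by (simp add: algebra_simps)
    then have "(F + 1) * u = F - 1" by (simp add: distrib_right)
    then have "inverse (F + 1) * (F + 1) * u = inverse (F + 1) * (F - 1)"
      by (simp only: mult.assoc)
    then show ?thesis by (simp only: inv mult_1_left u_def)
  qed
  then have "fps_X * f = fps_X * g" using assms by simp
  then show ?thesis by (simp only: fps_X_mult_cancel)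
qed

lemma verblunsky_coefficients_unique:
  assumes "verblunsky_coefficients c \<gamma>" "verblunsky_coefficients c \<gamma>'"
  shows "\<gamma> = \<gamma>'"
proof -
  obtain f fs f' fs' where f: "schur_fps_of c f" "schur_fps_of c f'"
    and a: "schur_algorithm f fs \<gamma>" "schur_algorithm f' fs' \<gamma>'"
    using assms unfolding verblunsky_coefficients_def by blast
  have step: "fs 0 = f" "fs' 0 = f'"
    "\<gamma> n = fps_nth (fs n) 0" "\<gamma>' n = fps_nth (fs' n) 0"
    "fps_X * fs (Suc n) = (fs n - fps_const (\<gamma> n)) * inverse (1 - fps_const (qcnj (\<gamma> n)) * fs n)"
    "fps_X * fs' (Suc n) = (fs' n - fps_const (\<gamma>' n)) * inverse (1 - fps_const (qcnj (\<gamma>' n)) * fs' n)"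
    for n
    using a unfolding schur_algorithm_def by blast+
  have "fs n = fs' n" for n
  proof (induction n)
    case 0
    show ?case by (simp only: step(1,2) schur_fps_of_unique[OF f])
  next
    case (Suc n)
    then have "\<gamma> n = \<gamma>' n" by (simp only: step(3,4))
    with Suc have "fps_X * fs (Suc n) = fps_X * fs' (Suc n)"
      by (simp only: step(5,6))
    then show ?case by (simp only: fps_X_mult_cancel)
  qed
  then show ?thesis
    by (intro ext) (simp only: step(3,4))
qed


section \<open>Matrix-valued measures on the unit circle\<close>

definition herm_form :: "complex^2 \<Rightarrow> complex^2^2 \<Rightarrow> complex" where
  "herm_form \<xi> B = (\<Sum>a\<in>UNIV. cnj (\<xi> $ a) * (B *v \<xi>) $ a)"

definition psd_matrix :: "complex^2^2 \<Rightarrow> bool" where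
  "psd_matrix B \<longleftrightarrow> (\<forall>\<xi>. herm_form \<xi> B \<in> \<real>\<^sub>\<ge>\<^sub>0)"

definition circle_sets :: "complex set set" where
  "circle_sets = sets (restrict_space borel (sphere 0 1))"

definition psd_matrix_measure :: "(complex set \<Rightarrow> complex^2^2) \<Rightarrow> bool" where
  "psd_matrix_measure M \<longleftrightarrow> (\<forall>A\<in>circle_sets. psd_matrix (M A)) \<and>
     (\<forall>A::nat \<Rightarrow> complex set. range A \<subseteq> circle_sets \<longrightarrow> disjoint_family A \<longrightarrow>
        (\<lambda>n. M (A n)) sums M (\<Union>n. A n))"

text \<open>The finite positive scalar measure \<open>A \<mapsto> \<xi>\<^sup>* M(A) \<xi>\<close>.\<close>

definition form_measure :: "(complex set \<Rightarrow> complex^2^2) \<Rightarrow> complex^2 \<Rightarrow> complex measure" where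
  "form_measure M \<xi> =
     measure_of (sphere 0 1) circle_sets (\<lambda>A. ennreal (Re (herm_form \<xi> (M A))))"

text \<open>
  \<open>\<integral> g dM = B\<close>, in the weak sense \<open>\<xi>\<^sup>* B \<xi> = \<integral> g d(\<xi>\<^sup>* M \<xi>)\<close> for all vectors \<open>\<xi>\<close>; by
  polarization (lemma \<open>herm_form_eqI\<close>) this determines every entry of \<open>B\<close>.
\<close>

definition has_matrix_integral ::
  "(complex set \<Rightarrow> complex^2^2) \<Rightarrow> (complex \<Rightarrow> complex) \<Rightarrow> complex^2^2 \<Rightarrow> bool" where
  "has_matrix_integral M g B \<longleftrightarrow> (\<forall>\<xi>. integrable (form_measure M \<xi>) g \<and>
     herm_form \<xi> B = (\<integral>z. g z \<partial>form_measure M \<xi>))"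

lemma herm_form_eqI:
  assumes "\<And>\<xi>. herm_form \<xi> B = herm_form \<xi> B'"
  shows "B = B'"
proof -
  have 1: "herm_form (vector [x, y]) B = herm_form (vector [x, y]) B'" for x y
    by (rule assms)
  have e: "cnj x * (B $ 1 $ 1 * x + B $ 1 $ 2 * y) + cnj y * (B $ 2 $ 1 * x + B $ 2 $ 2 * y) =
      cnj x * (B' $ 1 $ 1 * x + B' $ 1 $ 2 * y) + cnj y * (B' $ 2 $ 1 * x + B' $ 2 $ 2 * y)" for x y
    using 1[of x y] by (simp add: herm_form_def matrix_vector_mult_def sum_2)
  have d: "B $ 1 $ 1 = B' $ 1 $ 1" "B $ 2 $ 2 = B' $ 2 $ 2"
    using e[of 1 0] e[of 0 1] by simp_all
  have s: "B $ 1 $ 2 + B $ 2 $ 1 = B' $ 1 $ 2 + B' $ 2 $ 1"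
    using e[of 1 1] d by simp
  have "\<i> * (B $ 1 $ 2) - \<i> * (B $ 2 $ 1) = \<i> * (B' $ 1 $ 2) - \<i> * (B' $ 2 $ 1)"
    using e[of 1 "\<i>"] d by (simp add: ring_distribs mult_ac)
  then have t: "B $ 1 $ 2 - B $ 2 $ 1 = B' $ 1 $ 2 - B' $ 2 $ 1"
    by (simp flip: right_diff_distrib)
  have "B $ 1 $ 2 = B' $ 1 $ 2" "B $ 2 $ 1 = B' $ 2 $ 1"
    using arg_cong2[OF s t, of "(+)"] arg_cong2[OF s t, of "(-)"] by simp_all
  then show ?thesis using d by (simp add: vec_eq_iff forall_2)
qed

text \<open>The probability measure \<open>d\<theta> / (2\<pi>)\<close> on \<open>[0, 2\<pi>]\<close>.\<close>

definition angle_measure :: "real measure" where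
  "angle_measure = uniform_measure lborel {0..2*pi}"

definition singular_matrix_measure :: "(complex set \<Rightarrow> complex^2^2) \<Rightarrow> bool" where
  "singular_matrix_measure M \<longleftrightarrow> (\<exists>N\<in>circle_sets. (AE \<theta> in angle_measure. cis \<theta> \<notin> N) \<and>
     (\<forall>A\<in>circle_sets. A \<inter> N = {} \<longrightarrow> M A = 0))"

text \<open>
  The Lebesgue decomposition \<open>dM = W d\<theta>/(2\<pi>) + dM\<^sub>s\<close> with integrable density \<open>W\<close>, which is
  thereby determined almost everywhere.
\<close>

definition radon_nikodym_derivative ::
  "(complex set \<Rightarrow> complex^2^2) \<Rightarrow> (complex \<Rightarrow> complex^2^2) \<Rightarrow> bool" where
  "radon_nikodym_derivative M W \<longleftrightarrow> integrable angle_measure (\<lambda>\<theta>. W (cis \<theta>)) \<and>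
     (\<exists>Ms. psd_matrix_measure Ms \<and> singular_matrix_measure Ms \<and>
       (\<forall>A\<in>circle_sets.
          M A = (\<integral>\<theta>. indicator A (cis \<theta>) *\<^sub>R W (cis \<theta>) \<partial>angle_measure) + Ms A))"


section \<open>Extended-valued logarithm and integral\<close>

definition elog :: "real \<Rightarrow> ereal" where
  "elog x = (if x \<le> 0 then -\<infinity> else ereal (ln x))"

text \<open>
  Integral of the positive part minus integral of the negative part.  It is meaningful when one
  of the two is finite; for \<open>log det W\<close> with \<open>W\<close> integrable and positive semidefinite, the
  integral of the positive part is finite.  (In \<^typ>\<open>ereal\<close> one has \<open>\<infinity> - \<infinity> = \<infinity>\<close>.)
\<close>

definition extended_integral :: "'a measure \<Rightarrow> ('a \<Rightarrow> ereal) \<Rightarrow> ereal" where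
  "extended_integral \<mu> g =
     enn2ereal (\<integral>\<^sup>+x. e2ennreal (g x) \<partial>\<mu>) - enn2ereal (\<integral>\<^sup>+x. e2ennreal (- g x) \<partial>\<mu>)"

end

(*
  The quaternionic Schur algorithm is a statement about formal power series, and the ring
  homomorphism chi carries it to 2x2 matrix functions of an ordinary complex variable z.
  Inverting n steps and replacing the tail by 0 gives polynomials E = D - z N and E' = D + z N with
  E F = E' modulo z^(n+1) and D D* - N N* = kappa_n on the unit circle, where
  kappa_n = prod_{k<n} (1 - |gamma_k|^2) is a scalar because quaternionic moduli are real.
  E is invertible on the closed disc, so w_n = Re (E^-1 E') = kappa_n E^-1 E^-* has the moments
  c_k for |k| <= n, and log det w_n has mean 2 log kappa_n.

  If log det W is integrable, integrating tr (E W E* ) <= tr (E dM E* ) = 2 kappa_n together with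
  tr (A B) >= 2 sqrt (det A det B) and ln x <= x - 1 gives 2 ln kappa_n >= mean of log det W.
  Conversely, if kappa_n >= kappa > 0, the same inequality applied to w_n bounds
  tr (G dM) - log det G from below for positive trigonometric polynomials G.
  By density G may be any bounded measurable function, and G = (W + delta)^-1 off the
  singular set gives a lower bound for the mean of log det (W + delta), uniform in delta.
*)
theory Submission
  imports Defs "HOL-Complex_Analysis.Complex_Analysis"
begin

section \<open>Quaternion conjugation\<close>

text \<open>M enters only through the scalar measures of \<open>form_measure\<close>. A matrix test
  function G is therefore never integrated as such: it is written as \<xi>1 \<xi>1^* + \<xi>2
  \<xi>2^* (plus 1) with bounded vector functions, and \<open>polar\<close> reduces each summand to
  four scalar measures. Approximating the vectors instead of G keeps every approximant positive, so
  no positive factorization of matrix trigonometric polynomials has to be found. The summand 1 makes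
  ln det G nonnegative, which permits dominated convergence; it costs the mean 2 of tr w_n, and this
  cancels the 2 coming from ln x \<le> x - 1. No convergence of w_n to M is used, only equality of
  moments up to order n. This suffices for the rows of E because products z^k cnj (z^l) with k, l
  \<le> n have order at most n on the circle. Matrix statements about D and N reduce to norms of
  single quaternions, because the 2x2 matrix of q acts on rows as right multiplication by q. The
  bound |\<gamma>_n| < 1 is derived: the Toeplitz form at the reversed coefficients of E has the
  value kappa_n.\<close>

lemma qcnj_add [simp]: "qcnj (p + q) = qcnj p + qcnj q"
  and qcnj_mult [simp]: "qcnj (p * q) = qcnj q * qcnj p"
  and qcnj_qcnj [simp]: "qcnj (qcnj p) = p"
  and qcnj_0 [simp]: "qcnj 0 = 0"
  and qcnj_1 [simp]: "qcnj 1 = 1"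
  by (simp_all add: quat_eq_iff quat_ops of_real_quat algebra_simps)

lemma norm_quat_sq: "(norm p)\<^sup>2 = (qRe p)\<^sup>2 + (qI p)\<^sup>2 + (qJ p)\<^sup>2 + (qK p)\<^sup>2" for p :: quat
  by (simp add: norm_quat_def inner_quat_def power2_eq_square)

lemma norm_qcnj [simp]: "norm (qcnj p) = norm p"
  by (simp add: norm_quat_def inner_quat_def)

lemma mult_qcnj_eq_norm: "p * qcnj p = of_real ((norm p)\<^sup>2)" "qcnj p * p = of_real ((norm p)\<^sup>2)"
  by (simp_all add: quat_mult_qcnj norm_quat_sq of_real_def)

lemma inner_quat_eq_qRe: "inner p q = qRe (p * qcnj q)" for p q :: quat
  by (simp add: inner_quat_def quat_ops)

lemma qRe_sum [simp]: "qRe (sum f A) = (\<Sum>x\<in>A. qRe (f x))"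
  by (induction A rule: infinite_finite_induct) (auto simp: quat_ops)

lemma quat_Nonneg_Reals: "p \<in> \<real>\<^sub>\<ge>\<^sub>0 \<longleftrightarrow> p = of_real (qRe p) \<and> 0 \<le> qRe p" for p :: quat
proof
  assume "p \<in> \<real>\<^sub>\<ge>\<^sub>0"
  then obtain r where "p = of_real r" "0 \<le> r" by (auto simp: nonneg_Reals_def)
  then show "p = of_real (qRe p) \<and> 0 \<le> qRe p" by (simp add: of_real_quat)
next
  assume "p = of_real (qRe p) \<and> 0 \<le> qRe p"
  then show "p \<in> \<real>\<^sub>\<ge>\<^sub>0" by (metis nonneg_Reals_of_real_iff)
qed

text \<open>A Schur step acts on \<open>(a, b)\<close> as a scaled hyperbolic rotation.\<close>

lemma norm_schur_step:
  fixes a b g :: quat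
  shows "(norm (a + b * qcnj g))\<^sup>2 - (norm (a * g + b))\<^sup>2
    = (1 - (norm g)\<^sup>2) * ((norm a)\<^sup>2 - (norm b)\<^sup>2)"
proof -
  \<comment> \<open>The cross terms of the two squares agree and cancel:
    \<open>qcnj (b * qcnj g) = g * qcnj b\<close>, so associativity is enough and nothing has to
    commute.\<close>
  have 1: "inner a (b * qcnj g) = inner (a * g) b"
    by (simp add: inner_quat_eq_qRe mult.assoc)
  show ?thesis
    using 1 by (simp add: power2_norm_eq_inner[symmetric] dot_norm norm_mult power_mult_distrib
       field_simps)
qed

section \<open>The Schur algorithm on formal power series\<close>

text \<open>
  Inverting a step of the Schur algorithm gives \<open>f\<^sub>k = (1 + p f\<^sub>k\<^sub>+\<^sub>1 cnj \<gamma>\<^sub>k)\<^sup>-\<^sup>1 (\<gamma>\<^sub>k + p f\<^sub>k\<^sub>+\<^sub>1)\<close>.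
  Iterating this on left fractions, with the tail \<open>f\<^sub>n\<close> replaced by \<open>0\<close>, gives the
  approximant \<open>schur_den\<^sup>-\<^sup>1 schur_num\<close> of \<open>f\<^sub>0\<close>.
\<close>

primrec schur_pair :: "nat \<Rightarrow> (nat \<Rightarrow> quat) \<Rightarrow> quat fps \<times> quat fps" where
  "schur_pair 0 \<gamma> = (1, 0)"
| "schur_pair (Suc n) \<gamma> = (case schur_pair n (\<lambda>k. \<gamma> (Suc k)) of (D, N) \<Rightarrow>
     (D + fps_X * N * fps_const (qcnj (\<gamma> 0)), D * fps_const (\<gamma> 0) + fps_X * N))"

definition schur_den :: "nat \<Rightarrow> (nat \<Rightarrow> quat) \<Rightarrow> quat fps" where
  "schur_den n \<gamma> = fst (schur_pair n \<gamma>)"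

definition schur_num :: "nat \<Rightarrow> (nat \<Rightarrow> quat) \<Rightarrow> quat fps" where
  "schur_num n \<gamma> = snd (schur_pair n \<gamma>)"

lemma schur_den_num_0 [simp]: "schur_den 0 \<gamma> = 1" "schur_num 0 \<gamma> = 0"
  by (simp_all add: schur_den_def schur_num_def)

lemma schur_den_num_Suc:
  "schur_den (Suc n) \<gamma> = schur_den n (\<lambda>k. \<gamma> (Suc k))
     + fps_X * schur_num n (\<lambda>k. \<gamma> (Suc k)) * fps_const (qcnj (\<gamma> 0))"
  "schur_num (Suc n) \<gamma> = schur_den n (\<lambda>k. \<gamma> (Suc k)) * fps_const (\<gamma> 0)
     + fps_X * schur_num n (\<lambda>k. \<gamma> (Suc k))"
  by (simp_all add: schur_den_def schur_num_def split: prod.splits)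

definition schur_coeff_prod :: "nat \<Rightarrow> (nat \<Rightarrow> quat) \<Rightarrow> real" where
  "schur_coeff_prod n \<gamma> = (\<Prod>k<n. 1 - (norm (\<gamma> k))\<^sup>2)"

lemma schur_coeff_prod_0 [simp]: "schur_coeff_prod 0 \<gamma> = 1"
  by (simp add: schur_coeff_prod_def)

lemma schur_coeff_prod_Suc:
  "schur_coeff_prod (Suc n) \<gamma> = (1 - (norm (\<gamma> 0))\<^sup>2) * schur_coeff_prod n (\<lambda>k. \<gamma> (Suc k))"
  unfolding schur_coeff_prod_def by (subst prod.lessThan_Suc_shift) simp

lemma schur_coeff_prod_pos: "(\<And>k. k < n \<Longrightarrow> norm (\<gamma> k) < 1) \<Longrightarrow> schur_coeff_prod n \<gamma> > 0"
  unfolding schur_coeff_prod_def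
  by (intro prod_pos) (auto simp: power_less_one_iff abs_square_less_1)

lemma schur_den_num_nth:
  "fps_nth (schur_den (Suc n) \<gamma>) l = fps_nth (schur_den n (\<lambda>k. \<gamma> (Suc k))) l
     + (if l = 0 then 0 else fps_nth (schur_num n (\<lambda>k. \<gamma> (Suc k))) (l - 1)) * qcnj (\<gamma> 0)"
  "fps_nth (schur_num (Suc n) \<gamma>) l = fps_nth (schur_den n (\<lambda>k. \<gamma> (Suc k))) l * \<gamma> 0
     + (if l = 0 then 0 else fps_nth (schur_num n (\<lambda>k. \<gamma> (Suc k))) (l - 1))"
  by (simp_all add: schur_den_num_Suc)

text \<open>A step raises degrees only through \<open>fps_X * schur_num\<close>, so they stay below
  n; the constant 1 at n = 0 is the reason for \<open>l \<noteq> 0\<close>. Hence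
  \<open>szego_poly n \<gamma>\<close> has degree at most n, and the vanishing n-th coefficient of
  \<open>schur_num\<close> allows shifted sums to be cut at the same bound.\<close>

lemma schur_num_nth_ge: "n \<le> l \<Longrightarrow> fps_nth (schur_num n \<gamma>) l = 0"
  and schur_den_nth_ge: "n \<le> l \<Longrightarrow> l \<noteq> 0 \<Longrightarrow> fps_nth (schur_den n \<gamma>) l = 0"
proof (induction n arbitrary: \<gamma> l)
  case (Suc n)
  { case 1 with Suc show ?case by (simp add: schur_den_num_nth) }
  { case 2 with Suc show ?case by (simp add: schur_den_num_nth) }
qed auto

lemma schur_den_nth_0 [simp]: "fps_nth (schur_den n \<gamma>) 0 = 1"
  by (induction n arbitrary: \<gamma>) (simp_all add: schur_den_num_nth)

text \<open>\<open>norm_schur_step\<close> holds for each pair of coefficients, the second one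
  shifted by \<open>fps_X\<close>; the shift keeps the sum of squares because the top coefficient is
  zero. This is the coefficient form of the identity D D* - N N* = kappa_n on the circle, and it
  holds for arbitrary \<gamma>, before any bound on it is known.\<close>

lemma schur_den_num_gram:
  assumes "n \<le> m"
  shows "(\<Sum>l\<le>m. (norm (fps_nth (schur_den n \<gamma>) l))\<^sup>2 - (norm (fps_nth (schur_num n \<gamma>) l))\<^sup>2)
    = schur_coeff_prod n \<gamma>"
  using assms
proof (induction n arbitrary: \<gamma> m)
  case 0
  have "(\<Sum>l\<le>m. (norm (fps_nth (1::quat fps) l))\<^sup>2) = (\<Sum>l\<in>{0::nat}. 1)"
    by (rule sum.mono_neutral_cong_right) auto
  then show ?case by simp
next
  case (Suc n)
  define D N where "D = schur_den n (\<lambda>k. \<gamma> (Suc k))" and "N = schur_num n (\<lambda>k. \<gamma> (Suc k))"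
  define N' where "N' l = (if l = 0 then 0 else fps_nth N (l - 1))" for l
  obtain m' where m: "m = Suc m'" using Suc.prems by (cases m) auto
  have "fps_nth N m = 0" unfolding N_def using Suc.prems by (intro schur_num_nth_ge) simp
  then have N': "(\<Sum>l\<le>m. (norm (N' l))\<^sup>2) = (\<Sum>l\<le>m. (norm (fps_nth N l))\<^sup>2)"
    unfolding m N'_def by (subst sum.atMost_Suc_shift) (simp add: m)
  have "(\<Sum>l\<le>m. (norm (fps_nth (schur_den (Suc n) \<gamma>) l))\<^sup>2 - (norm (fps_nth (schur_num (Suc n) \<gamma>) l))\<^sup>2)
    = (\<Sum>l\<le>m. (1 - (norm (\<gamma> 0))\<^sup>2) * ((norm (fps_nth D l))\<^sup>2 - (norm (N' l))\<^sup>2))"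
    unfolding schur_den_num_nth D_def[symmetric] N_def[symmetric] N'_def[symmetric] norm_schur_step ..
  also have "\<dots> = (1 - (norm (\<gamma> 0))\<^sup>2) * schur_coeff_prod n (\<lambda>k. \<gamma> (Suc k))"
    using Suc.IH[of m "\<lambda>k. \<gamma> (Suc k)"] Suc.prems
    unfolding sum_distrib_left[symmetric] D_def[symmetric] N_def[symmetric]
    by (simp add: sum_subtractf N')
  finally show ?case by (simp add: schur_coeff_prod_Suc)
qed


lemma fps_mult_nth_eq_0_upto:
  fixes A B :: "quat fps"
  assumes "\<And>l. l \<le> n \<Longrightarrow> fps_nth A l = 0" "l \<le> n"
  shows "fps_nth (A * B) l = 0"
  using assms by (simp add: fps_mult_nth)

lemma schur_algorithm_shift:
  assumes "schur_algorithm f fs \<gamma>"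
  shows "schur_algorithm (fs 1) (\<lambda>k. fs (Suc k)) (\<lambda>k. \<gamma> (Suc k))"
  using assms by (simp add: schur_algorithm_def)

text \<open>Peeling off the first step gives
  \<open>D' f - N' = X (D f_1 - N) (1 - qcnj \<gamma>_0 f)\<close>, so every step gains one order.
  The innermost coefficient only has to equal the constant term of f_n, so n + 1 steps require
  strict bounds for n coefficients; \<open>verblunsky_norm_less_1\<close> relies on this
  difference.\<close>

lemma schur_approx:
  assumes "schur_algorithm f fs \<gamma>" "\<And>k. k < n \<Longrightarrow> norm (\<gamma> k) < 1" "l \<le> n"
  shows "fps_nth (schur_den (Suc n) \<gamma> * f - schur_num (Suc n) \<gamma>) l = 0"
  using assms
proof (induction n arbitrary: f fs \<gamma> l)
  case 0
  then show ?case by (simp add: schur_den_num_Suc schur_algorithm_def)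
next
  case (Suc n)
  define D N where "D = schur_den (Suc n) (\<lambda>k. \<gamma> (Suc k))" and "N = schur_num (Suc n) (\<lambda>k. \<gamma> (Suc k))"
  define g where "g = fps_const (\<gamma> 0)"
  define g' where "g' = fps_const (qcnj (\<gamma> 0))"
  have f0: "fps_nth f 0 = \<gamma> 0" using Suc.prems(1) by (auto simp: schur_algorithm_def)
  have IH: "fps_nth (D * fs 1 - N) l = 0" if "l \<le> n" for l
    unfolding D_def N_def using that Suc.prems(2)
    by (intro Suc.IH[OF schur_algorithm_shift[OF Suc.prems(1)]]) auto
  have "(norm (\<gamma> 0))\<^sup>2 < 1" using Suc.prems(2)[of 0] by (simp add: abs_square_less_1)
  then have "fps_nth (1 - g' * f) 0 \<noteq> 0"
    using of_real_eq_iff[of "(norm (\<gamma> 0))\<^sup>2" 1, where 'a=quat]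
    by (auto simp: f0 g'_def mult_qcnj_eq_norm(2))
  then have "inverse (1 - g' * f) * (1 - g' * f) = 1" by (rule inverse_mult_eq_1)
  moreover have "fps_X * fs 1 = (f - g) * inverse (1 - g' * f)"
    using Suc.prems(1) by (auto simp: schur_algorithm_def g_def g'_def)
  ultimately have step: "fps_X * fs 1 * (1 - g' * f) = f - g"
    by (simp add: mult.assoc)
  have X: "D * (fps_X * h) = fps_X * (D * h)" for h :: "quat fps"
    by (metis fps_mult_fps_X_commute mult.assoc)
  have "schur_den (Suc (Suc n)) \<gamma> * f - schur_num (Suc (Suc n)) \<gamma>
    = D * (f - g) - fps_X * N * (1 - g' * f)"
    unfolding schur_den_num_Suc(1)[of "Suc n"] schur_den_num_Suc(2)[of "Suc n"]
      D_def[symmetric] N_def[symmetric] g_def[symmetric] g'_def[symmetric]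
    by (simp add: algebra_simps)
  also have "\<dots> = fps_X * ((D * fs 1 - N) * (1 - g' * f))"
    by (simp only: step[symmetric] mult.assoc X) (simp add: algebra_simps)
  finally have eq: "schur_den (Suc (Suc n)) \<gamma> * f - schur_num (Suc (Suc n)) \<gamma>
    = fps_X * ((D * fs 1 - N) * (1 - g' * f))" .
  have "fps_nth ((D * fs 1 - N) * (1 - g' * f)) k = 0" if "k \<le> n" for k
    by (rule fps_mult_nth_eq_0_upto[OF IH that])
  then show ?case using Suc.prems(3) unfolding eq by (auto simp: fps_X_mult_nth)
qed

text \<open>Up to normalization, the reversed orthogonal polynomials of the first and second kind.\<close>

definition szego_poly :: "nat \<Rightarrow> (nat \<Rightarrow> quat) \<Rightarrow> quat fps" where
  "szego_poly n \<gamma> = schur_den n \<gamma> - fps_X * schur_num n \<gamma>"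

definition szego_poly2 :: "nat \<Rightarrow> (nat \<Rightarrow> quat) \<Rightarrow> quat fps" where
  "szego_poly2 n \<gamma> = schur_den n \<gamma> + fps_X * schur_num n \<gamma>"

lemma szego_poly_nth_0 [simp]:
  "fps_nth (szego_poly n \<gamma>) 0 = 1" "fps_nth (szego_poly2 n \<gamma>) 0 = 1"
  by (simp_all add: szego_poly_def szego_poly2_def)

text \<open>With u = X f one has (1 - u) F = 1 + u and E = D (1 - u) + X G, where G = D f - N
  vanishes up to order n - 1. The additional factor X yields agreement up to order n, with strict
  bounds only for the first n - 1 coefficients.\<close>

lemma szego_poly_caratheodory:
  assumes "schur_algorithm f fs \<gamma>" "\<And>k. Suc k < n \<Longrightarrow> norm (\<gamma> k) < 1"
    and "schur_fps_of c f" "l \<le> n"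
  shows "fps_nth (szego_poly n \<gamma> * caratheodory_fps c) l = fps_nth (szego_poly2 n \<gamma>) l"
proof (cases n)
  case 0
  then show ?thesis using assms(4) by (simp add: caratheodory_fps_def)
next
  case (Suc m)
  define D N u F where "D = schur_den n \<gamma>" and "N = schur_num n \<gamma>" and "u = fps_X * f"
    and "F = caratheodory_fps c"
  define G where "G = D * f - N"
  have G: "fps_nth G l = 0" if "l \<le> m" for l
    unfolding G_def D_def N_def Suc using that assms(2) Suc
    by (intro schur_approx[OF assms(1)]) auto
  have "fps_nth (1 - u) 0 \<noteq> 0" by (simp add: u_def)
  then have "(1 - u) * inverse (1 - u) = 1" by (rule inverse_mult_eq_1')
  then have "(1 + u) * ((1 - u) * inverse (1 - u)) = 1 + u" by simp
  moreover have "(1 - u) * (1 + u) = (1 + u) * (1 - u)" by (simp add: algebra_simps)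
  moreover have "F = (1 + u) * inverse (1 - u)"
    using assms(3) by (simp add: schur_fps_of_def F_def u_def)
  ultimately have F: "(1 - u) * F = 1 + u" by (simp only: mult.assoc[symmetric])
  have X: "D * (fps_X * h) = fps_X * (D * h)" for h :: "quat fps"
    by (metis fps_mult_fps_X_commute mult.assoc)
  have E: "szego_poly n \<gamma> = D * (1 - u) + fps_X * G"
    by (simp add: szego_poly_def D_def[symmetric] N_def[symmetric] G_def u_def X algebra_simps)
  have "szego_poly n \<gamma> * F = D * (1 + u) + fps_X * (G * F)"
    unfolding E by (simp add: distrib_right mult.assoc F)
  also have "\<dots> = szego_poly2 n \<gamma> + fps_X * (G * (1 + F))"
    by (simp add: szego_poly2_def D_def[symmetric] N_def[symmetric] G_def u_def X algebra_simps)
  finally have "szego_poly n \<gamma> * F = szego_poly2 n \<gamma> + fps_X * (G * (1 + F))" .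
  moreover have "fps_nth (G * (1 + F)) k = 0" if "k \<le> m" for k
    by (rule fps_mult_nth_eq_0_upto[OF G that])
  ultimately show ?thesis using assms(4) Suc unfolding F_def by (auto simp: fps_X_mult_nth)
qed

section \<open>Toeplitz forms and the bound on the Verblunsky coefficients\<close>

lemma sum_atMost_two:
  fixes g :: "nat \<Rightarrow> 'a::comm_monoid_add"
  assumes "n > 0" "\<And>k. k \<noteq> 0 \<Longrightarrow> k \<noteq> n \<Longrightarrow> g k = 0"
  shows "(\<Sum>k\<le>n. g k) = g 0 + g n"
proof -
  have "(\<Sum>k\<le>n. g k) = (\<Sum>k\<in>{0,n}. g k)"
    by (rule sum.mono_neutral_right) (use assms in auto)
  then show ?thesis using assms(1) by simp
qed

lemma positive_definite_seq_hermitian: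
  assumes pd: "positive_definite_seq c" and c0: "c 0 = 1"
  shows "c (- n) = qcnj (c n)"
proof -
  have *: "c (- int m) = qcnj (c (int m))" for m
  proof (cases "m = 0")
    case False
    have form: "toeplitz_form c m (\<lambda>k. if k = 0 then 1 else if k = m then q else 0)
      = (1 + c (int m) * q) + (qcnj q * c (- int m) + qcnj q * q)" for q
      unfolding toeplitz_form_def
      by (subst sum_atMost_two, use False in simp, simp,
          (subst sum_atMost_two, use False in simp, simp)+) (use False c0 in simp)
    have real: "(1 + c (int m) * q) + (qcnj q * c (- int m) + qcnj q * q) \<in> \<real>\<^sub>\<ge>\<^sub>0" for q
      using pd unfolding positive_definite_seq_def form[symmetric] by blast
    show ?thesis
      \<comment> \<open>Reality at q = 1 makes the imaginary parts of \<open>c m\<close> and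
        \<open>c (- m)\<close> opposite; at the first imaginary unit it makes the real parts
        equal.\<close>
      using real[of 1] real[of "Quat 0 1 0 0"]
      unfolding quat_Nonneg_Reals by (simp add: quat_eq_iff quat_ops of_real_quat)
  qed (simp add: c0)
  show ?thesis
  proof (cases "n \<ge> 0")
    case True
    then show ?thesis using *[of "nat n"] by simp
  next
    case False
    then show ?thesis using *[of "nat (- n)"] by (metis add.inverse_inverse nat_0_le linear
          neg_0_le_iff_le qcnj_qcnj)
  qed
qed

text \<open>Reversal replaces \<open>c (l - k)\<close> by \<open>c (k - l)\<close> and orders the
  factors as \<open>e k * c * qcnj (e l)\<close>. In this order the sum over k < l is, up to the
  factor 2, part of a coefficient of the star-product of e with the Caratheodory series.\<close>

lemma toeplitz_form_rev:
  "toeplitz_form c m (\<lambda>k. qcnj (e (m - k)))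
    = (\<Sum>k\<le>m. \<Sum>l\<le>m. e k * c (int k - int l) * qcnj (e l))"
proof -
  have rev: "(\<Sum>k\<le>m. h k) = (\<Sum>k\<le>m. h (m - k))" for h :: "nat \<Rightarrow> quat"
    using sum.nat_diff_reindex[of h "Suc m"] by (simp add: lessThan_Suc_atMost)
  have "(\<Sum>k\<le>m. \<Sum>l\<le>m. e k * c (int k - int l) * qcnj (e l))
    = (\<Sum>k\<le>m. \<Sum>l\<le>m. e (m - k) * c (int (m - k) - int (m - l)) * qcnj (e (m - l)))"
    by (subst rev, rule sum.cong[OF refl], subst rev, rule refl)
  also have "\<dots> = toeplitz_form c m (\<lambda>k. qcnj (e (m - k)))"
    unfolding toeplitz_form_def by (intro sum.cong refl) (simp add: of_nat_diff)
  finally show ?thesis by simp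
qed

lemma sum_triangle_split:
  fixes g :: "nat \<Rightarrow> nat \<Rightarrow> real"
  shows "(\<Sum>k\<le>m. \<Sum>l\<le>m. g k l)
    = (\<Sum>l\<le>m. \<Sum>k<l. g k l) + (\<Sum>l\<le>m. g l l) + (\<Sum>l\<le>m. \<Sum>k<l. g l k)"
proof (induction m)
  case (Suc m)
  show ?case
    by (simp add: Suc sum.distrib lessThan_Suc_atMost)
qed simp

text \<open>The form is Hermitian and the Caratheodory series F carries every off-diagonal c twice,
  so the value is the real part of the sum of \<open>(E F)_l * qcnj (E_l)\<close>. Up to order n, E
  F equals E'; the inner product of D + X N with D - X N then collapses to |D|^2 - |X N|^2, which
  \<open>schur_den_num_gram\<close> evaluates.\<close>

lemma toeplitz_form_szego_poly:
  assumes c: "\<And>n. c (- n) = qcnj (c n)" and c0: "c 0 = 1"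
    and "schur_algorithm f fs \<gamma>" "\<And>k. Suc k < n \<Longrightarrow> norm (\<gamma> k) < 1"
    and "schur_fps_of c f"
  shows "qRe (toeplitz_form c n (\<lambda>k. qcnj (fps_nth (szego_poly n \<gamma>) (n - k))))
    = schur_coeff_prod n \<gamma>"
proof -
  define e where "e = fps_nth (szego_poly n \<gamma>)"
  define F where "F = fps_nth (caratheodory_fps c)"
  define N' where "N' l = (if l = 0 then 0 else fps_nth (schur_num n \<gamma>) (l - 1))" for l
  have F: "F 0 = 1" "F l = 2 * c (- int l)" if "l > 0" for l
    using that by (simp_all add: F_def caratheodory_fps_def)
  define A where "A k l = qRe (e k * c (int k - int l) * qcnj (e l))" for k l
  have sym: "A k l = A l k" for k l
  proof -
    have "qRe (qcnj (e k * c (int k - int l) * qcnj (e l))) = A k l"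
      unfolding A_def by (simp only: qcnj_simps)
    then show ?thesis using c[of "int k - int l"] by (simp add: A_def mult.assoc)
  qed
  have "qRe (toeplitz_form c n (\<lambda>k. qcnj (e (n - k)))) = (\<Sum>k\<le>n. \<Sum>l\<le>n. A k l)"
    unfolding toeplitz_form_rev by (simp add: A_def)
  also have "\<dots> = (\<Sum>l\<le>n. 2 * (\<Sum>k<l. A k l) + A l l)"
    proof -
    have "(\<Sum>l\<le>n. \<Sum>k<l. A l k) = (\<Sum>l\<le>n. \<Sum>k<l. A k l)" by (intro sum.cong refl sym)
    then show ?thesis unfolding sum_triangle_split by (simp add: sum.distrib sum_distrib_left[symmetric])
  qed
  also have "\<dots> = (\<Sum>l\<le>n. qRe ((\<Sum>k\<le>l. e k * F (l - k)) * qcnj (e l)))"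
  proof (intro sum.cong refl)
    fix l
    have *: "qRe (e k * F (l - k) * qcnj (e l)) = 2 * A k l" if "k < l" for k
    proof -
      have "e k * F (l - k) * qcnj (e l) = 2 *\<^sub>R (e k * c (int k - int l) * qcnj (e l))"
        using that by (simp add: F(2) scaleR_2 mult_2 mult_2_right distrib_left distrib_right of_nat_diff)
      then show ?thesis by (simp add: A_def scaleR_quat_def)
    qed
    have "(\<Sum>k\<le>l. e k * F (l - k)) * qcnj (e l)
      = (\<Sum>k<l. e k * F (l - k) * qcnj (e l)) + e l * qcnj (e l)"
      using F(1)[of 1] by (simp add: lessThan_Suc_atMost[symmetric] distrib_right sum_distrib_right)
    then show "2 * (\<Sum>k<l. A k l) + A l l = qRe ((\<Sum>k\<le>l. e k * F (l - k)) * qcnj (e l))"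
      by (simp add: plus_quat_def * sum_distrib_left) (simp add: A_def c0)
  qed
  also have "\<dots> = (\<Sum>l\<le>n. qRe (fps_nth (szego_poly2 n \<gamma>) l * qcnj (e l)))"
    using szego_poly_caratheodory[OF assms(3,4,5)]
    by (intro sum.cong refl) (simp add: fps_mult_nth e_def F_def atMost_atLeast0)
  also have "\<dots> = (\<Sum>l\<le>n. (norm (fps_nth (schur_den n \<gamma>) l))\<^sup>2 - (norm (N' l))\<^sup>2)"
    unfolding inner_quat_eq_qRe[symmetric]
    by (intro sum.cong refl)
      (simp add: e_def szego_poly_def szego_poly2_def N'_def fps_X_mult_nth power2_norm_eq_inner
        inner_simps inner_commute)
  also have "\<dots> = schur_coeff_prod n \<gamma>"
  proof -
    have "(\<Sum>l\<le>n. (norm (N' l))\<^sup>2) = (\<Sum>l\<le>n. (norm (fps_nth (schur_num n \<gamma>) l))\<^sup>2)"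
    proof (cases n)
      case (Suc m)
      then show ?thesis using schur_num_nth_ge[of n n \<gamma>]
        unfolding Suc N'_def by (subst sum.atMost_Suc_shift) (simp add: Suc)
    qed (simp add: N'_def)
    then show ?thesis
      using schur_den_num_gram[of n n \<gamma>] by (simp add: sum_subtractf)
  qed
  finally show ?thesis unfolding e_def .
qed

text \<open>The form of size n + 2 takes the value kappa_(n+1), and this identity uses only the
  bounds below n. Non-triviality makes the value positive; dividing by kappa_n > 0 leaves 1 -
  |\<gamma>_n|^2 > 0.\<close>

lemma verblunsky_norm_less_1:
  assumes "nontrivial_positive_definite_seq c" "c 0 = 1"
    and "schur_algorithm f fs \<gamma>" "schur_fps_of c f"
  shows "norm (\<gamma> n) < 1"
proof (induction n rule: less_induct)
  case (less n)
  have c: "c (- n) = qcnj (c n)" for n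
    using assms(1,2) positive_definite_seq_hermitian by (simp add: nontrivial_positive_definite_seq_def)
  define \<xi> where "\<xi> k = qcnj (fps_nth (szego_poly (Suc n) \<gamma>) (Suc n - k))" for k
  \<comment> \<open>After reversal the last entry is the constant coefficient of the Szego
    polynomial, which is 1.\<close>
  have "\<xi> (Suc n) \<noteq> 0" by (simp add: \<xi>_def)
  then have "\<exists>k\<le>Suc n. \<xi> k \<noteq> 0" by blast
  then have pos: "toeplitz_form c (Suc n) \<xi> \<in> \<real>\<^sub>\<ge>\<^sub>0 - {0}"
    using assms(1) unfolding nontrivial_positive_definite_seq_def by blast
  then have "qRe (toeplitz_form c (Suc n) \<xi>) > 0"
    unfolding quat_Nonneg_Reals Diff_iff by (metis insert_iff of_real_0 order_less_le)
  moreover have "qRe (toeplitz_form c (Suc n) \<xi>) = schur_coeff_prod (Suc n) \<gamma>"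
    unfolding \<xi>_def using less by (intro toeplitz_form_szego_poly[OF c assms(2,3) _ assms(4)]) auto
  moreover have "schur_coeff_prod n \<gamma> > 0" using less by (intro schur_coeff_prod_pos) auto
  ultimately have "(norm (\<gamma> n))\<^sup>2 < 1"
    by (simp add: schur_coeff_prod_def zero_less_mult_iff)
  then show ?case by (simp add: abs_square_less_1)
qed

section \<open>Means over the unit circle\<close>

lemma sets_angle_measure [simp, measurable_cong]: "sets angle_measure = sets borel"
  and space_angle_measure [simp]: "space angle_measure = UNIV"
  by (simp_all add: angle_measure_def)

lemma emeasure_angle_measure_UNIV [simp]: "emeasure angle_measure UNIV = 1"
  by (simp add: angle_measure_def emeasure_lborel_Icc divide_ennreal)

interpretation angle: finite_measure angle_measure
  by (rule finite_measureI) simp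

lemma measure_angle_measure_UNIV [simp]: "measure angle_measure UNIV = 1"
  by (simp add: measure_def)

lemma integrable_angle_bounded:
  fixes f :: "real \<Rightarrow> 'a::{banach,second_countable_topology}"
  assumes "f \<in> borel_measurable borel" "\<And>x. norm (f x) \<le> B"
  shows "integrable angle_measure f"
  by (rule angle.integrable_const_bound[of _ B]) (use assms in auto)

lemma cis_borel_measurable [measurable]: "cis \<in> borel_measurable borel"
  by (intro borel_measurable_continuous_onI) (simp add: continuous_on_cis)

lemma continuous_on_cis_compose:
  assumes "continuous_on (sphere 0 1) f"
  shows "continuous_on UNIV (\<lambda>t. f (cis t))"
  by (rule continuous_on_compose2[OF assms]) (auto intro: continuous_on_cis)

lemma integrable_angle_continuous:
  fixes f :: "complex \<Rightarrow> 'a::{banach,second_countable_topology}"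
  assumes "continuous_on (sphere 0 1) f"
  shows "integrable angle_measure (\<lambda>t. f (cis t))"
proof -
  have "compact (f ` sphere 0 1)" by (intro compact_continuous_image assms) simp
  then obtain B where B: "\<And>z. z \<in> sphere 0 1 \<Longrightarrow> norm (f z) \<le> B"
    by (metis bounded_iff compact_imp_bounded imageI)
  show ?thesis
    by (rule integrable_angle_bounded[where B=B])
      (auto intro: borel_measurable_continuous_onI continuous_on_cis_compose[OF assms] B)
qed

lemma integral_angle_continuous:
  fixes f :: "real \<Rightarrow> complex"
  assumes "continuous_on UNIV f" "(f has_integral I) {0..2*pi}"
  shows "integral\<^sup>L angle_measure f = I / (2 * pi)"
proof -
  have f[measurable]: "f \<in> borel_measurable borel" using assms(1) by (rule borel_measurable_continuous_onI)
  have c: "continuous_on {0..2*pi} f" using assms(1) continuous_on_subset by blast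
  have "set_integrable lborel {0..2*pi} f" unfolding set_integrable_def by (rule borel_integrable_compact) (use c in auto)
  then have I: "(LINT x:{0..2*pi}|lborel. f x) = I"
    using set_borel_integral_eq_integral(2) integral_unique[OF assms(2)] by metis
  have am: "angle_measure = density lborel (\<lambda>x. ennreal (indicator {0..2*pi} x / (2 * pi)))"
    unfolding angle_measure_def uniform_measure_def
    by (intro arg_cong[where f="density lborel"] ext)
      (simp add: emeasure_lborel_Icc divide_ennreal indicator_def zero_ennreal_def[symmetric] one_ennreal_def[symmetric] flip: ennreal_1)
  have "integral\<^sup>L angle_measure f
    = (LINT x|lborel. (indicator {0..2*pi} x / (2 * pi)) *\<^sub>R f x)"
    unfolding am by (rule integral_density) auto
  also have "\<dots> = (1 / (2 * pi)) *\<^sub>R (LINT x:{0..2*pi}|lborel. f x)"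
    unfolding set_lebesgue_integral_def integral_scaleR_right[symmetric]
    by (intro Bochner_Integration.integral_cong refl) simp
  finally show ?thesis unfolding I by (simp add: scaleR_conv_of_real)
qed

lemma mean_value_holomorphic:
  assumes "f holomorphic_on cball 0 1"
  shows "(\<integral>t. f (cis t) \<partial>angle_measure) = f 0"
proof -
  have c: "continuous_on (sphere 0 1) f"
    using holomorphic_on_imp_continuous_on[OF assms] by (rule continuous_on_subset) auto
  have "((\<lambda>u. f u / u) has_contour_integral 2 * complex_of_real pi * \<i> * f 0) (circlepath 0 1)"
    using Cauchy_integral_circlepath_simple[OF assms, of 0] by simp
  then have "((\<lambda>t. f (cis t) / cis t * \<i> * cis t) has_integral
      2 * complex_of_real pi * \<i> * f 0) {0..2*pi}"
    unfolding circlepath_def by (subst (asm) has_contour_integral_part_circlepath_iff) simp_all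
  then have "((\<lambda>t. \<i> * f (cis t)) has_integral \<i> * (2 * complex_of_real pi * f 0)) {0..2*pi}"
    by (simp add: mult_ac)
  from has_integral_mult_right[OF this, of "-\<i>"]
  have "((\<lambda>t. f (cis t)) has_integral (2 * complex_of_real pi * f 0)) {0..2*pi}"
    by (simp add: mult.assoc[symmetric])
  from integral_angle_continuous[OF continuous_on_cis_compose[OF c] this] show ?thesis by simp
qed

text \<open>The closed disc is contractible, so f has a holomorphic logarithm on it;
  \<open>ln (norm f)\<close> is the real part of that logarithm.\<close>

lemma mean_value_ln_norm:
  assumes "f holomorphic_on cball 0 1" "\<And>z. norm z \<le> 1 \<Longrightarrow> f z \<noteq> 0"
  shows "(\<integral>t. ln (norm (f (cis t))) \<partial>angle_measure) = ln (norm (f 0))"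
proof -
  obtain g where g: "g holomorphic_on cball 0 1" "\<And>z. z \<in> cball 0 1 \<Longrightarrow> f z = exp (g z)"
    using contractible_imp_holomorphic_log[OF assms(1)] assms(2)
    by (metis convex_cball convex_imp_contractible mem_cball_0)
  have c: "continuous_on (sphere 0 1) g"
    using holomorphic_on_imp_continuous_on[OF g(1)] by (rule continuous_on_subset) auto
  have "(\<integral>t. ln (norm (f (cis t))) \<partial>angle_measure) = (\<integral>t. Re (g (cis t)) \<partial>angle_measure)"
    by (intro Bochner_Integration.integral_cong refl) (simp add: g(2))
  also have "\<dots> = Re (\<integral>t. g (cis t) \<partial>angle_measure)"
    by (intro integral_Re integrable_angle_continuous c)
  also have "\<dots> = ln (norm (f 0))"
    by (simp add: mean_value_holomorphic[OF g(1)] g(2))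
  finally show ?thesis .
qed

section \<open>The representation of quaternions by matrices\<close>

lemma herm_form_vec:
  "herm_form (vector [x, y]) B = cnj x * (B $ 1 $ 1 * x + B $ 1 $ 2 * y) + cnj y * (B $ 2 $ 1 * x + B $ 2 $ 2 * y)"
  by (simp add: herm_form_def matrix_vector_mult_def sum_2)

lemma slice_of_add [simp]: "slice_of i (z + w) = slice_of i z + slice_of i w"
  and slice_of_minus: "slice_of i (- z) = - slice_of i z"
  and slice_of_0 [simp]: "slice_of i 0 = 0"
  by (simp_all add: slice_of_def quat_eq_iff quat_ops of_real_quat algebra_simps)

locale slice_basis =
  fixes i j :: quat
  assumes i: "i \<in> \<S>" and j: "j \<in> \<S>" and ij: "inner i j = 0"
begin

lemmas slice_mult = slice_of_ring_iso(2)[OF i]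
lemmas slice_1 [simp] = slice_of_ring_iso(3)[OF i]
lemmas slice_cnj = slice_of_ring_iso(4)[OF i]
lemmas slice_norm = slice_of_ring_iso(5)[OF i]

text \<open>Inverse of \<open>slice_parts i j\<close>: with explicit coordinates, \<open>chi\<close>
  can be computed without its definite description.\<close>

definition qpair :: "complex \<Rightarrow> complex \<Rightarrow> quat" where
  "qpair z w = slice_of i z + slice_of i w * j"

lemma slice_parts_qpair [simp]: "slice_parts i j (qpair z w) = (z, w)"
proof -
  have "\<exists>!x. case x of (z', w') \<Rightarrow> qpair z w = slice_of i z' + slice_of i w' * j"
    by (rule slice_parts_ex1[OF i j ij])
  from the1_equality[OF this, of "(z, w)"] show ?thesis
    by (simp add: slice_parts_def qpair_def)
qed

lemma qpair_cases: obtains z w where "p = qpair z w"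
  using slice_parts_ex1[OF i j ij, of p] unfolding qpair_def by auto

lemma chi_qpair: "chi i j (qpair z w) = vector [vector [z, w], vector [- cnj w, cnj z]]"
  by (simp add: chi_def)

lemma chi_qpair_nth [simp]:
  "chi i j (qpair z w) $ 1 $ 1 = z" "chi i j (qpair z w) $ 1 $ 2 = w"
  "chi i j (qpair z w) $ 2 $ 1 = - cnj w" "chi i j (qpair z w) $ 2 $ 2 = cnj z"
  by (simp_all add: chi_qpair)

lemma j_slice: "j * slice_of i z = slice_of i (cnj z) * j"
proof -
  have "j * slice_of i z = of_real (Re z) * j + of_real (Im z) * (j * i)"
    by (simp add: slice_of_def distrib_left mult.assoc[symmetric])
      (simp add: of_real_def)
  then show ?thesis
    by (simp add: slice_of_def imag_units_anticommute[OF i j ij] left_diff_distrib mult.assoc)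
qed

lemma qpair_mult: "qpair z w * qpair z' w' = qpair (z * z' - w * cnj w') (z * w' + w * cnj z')"
proof -
  have jj: "j * (j * x) = - x" for x
    using imag_units_square[OF j] by (metis mult.assoc mult_minus_left mult_1)
  have js: "j * (slice_of i z * x) = slice_of i (cnj z) * (j * x)" for z x
    by (metis j_slice mult.assoc)
  show ?thesis
    by (simp add: qpair_def distrib_left distrib_right mult.assoc j_slice js jj imag_units_square[OF j]
      slice_mult slice_of_minus diff_conv_add_uminus del: add_uminus_conv_diff)
qed

lemma qpair_add: "qpair z w + qpair z' w' = qpair (z + z') (w + w')"
  by (simp add: qpair_def distrib_right)

lemma qpair_0 [simp]: "qpair 0 0 = 0" and qpair_1: "qpair 1 0 = 1"
  by (simp_all add: qpair_def)

lemma qpair_slice: "slice_of i u * qpair z w = qpair (u * z) (u * w)"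
  by (simp add: qpair_def distrib_left mult.assoc slice_mult)

lemma qcnj_qpair: "qcnj (qpair z w) = qpair (cnj z) (- w)"
proof -
  have "qcnj j = - j" using j by (simp add: imag_units_def quat_eq_iff quat_ops)
  then show ?thesis
    by (simp add: qpair_def slice_cnj[symmetric] j_slice slice_of_minus)
qed

lemma norm_qpair: "(norm (qpair z w))\<^sup>2 = (norm z)\<^sup>2 + (norm w)\<^sup>2"
proof -
  have "of_real ((norm (qpair z w))\<^sup>2) = qpair z w * qcnj (qpair z w)" by (simp only: mult_qcnj_eq_norm)
  also have "\<dots> = qpair (of_real ((norm z)\<^sup>2 + (norm w)\<^sup>2)) 0"
    by (simp add: qcnj_qpair qpair_mult complex_norm_square[symmetric])
  also have "\<dots> = of_real ((norm z)\<^sup>2 + (norm w)\<^sup>2)"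
    by (simp add: qpair_def slice_of_def)
  finally show ?thesis by (simp only: of_real_eq_iff)
qed

lemma qpair_eq_0_iff: "qpair z w = 0 \<longleftrightarrow> z = 0 \<and> w = 0"
  by (metis qpair_0 slice_parts_qpair prod.inject)

lemma chi_mult: "chi i j (p * q) = chi i j p ** chi i j q"
proof -
  obtain z w where p: "p = qpair z w" by (rule qpair_cases)
  obtain z' w' where q: "q = qpair z' w'" by (rule qpair_cases)
  show ?thesis unfolding p q qpair_mult
    by (simp add: vec_eq_iff forall_2 matrix_matrix_mult_def sum_2)
qed

lemma chi_add: "chi i j (p + q) = chi i j p + chi i j q"
proof -
  obtain z w where p: "p = qpair z w" by (rule qpair_cases)
  obtain z' w' where q: "q = qpair z' w'" by (rule qpair_cases)
  show ?thesis unfolding p q qpair_add by (simp add: vec_eq_iff forall_2)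
qed

lemma chi_0 [simp]: "chi i j 0 = 0"
  using chi_qpair[of 0 0] by (simp add: vec_eq_iff forall_2)

lemma chi_1: "chi i j 1 = mat 1"
  using chi_qpair[of 1 0] by (simp add: qpair_1 vec_eq_iff forall_2 mat_def)

lemma chi_sum: "chi i j (sum f A) = (\<Sum>x\<in>A. chi i j (f x))"
  by (induction A rule: infinite_finite_induct) (auto simp: chi_add)

lemma chi_qcnj_nth: "chi i j (qcnj p) $ a $ b = cnj (chi i j p $ b $ a)"
proof -
  obtain z w where p: "p = qpair z w" by (rule qpair_cases)
  have "\<forall>a b. chi i j (qcnj p) $ a $ b = cnj (chi i j p $ b $ a)"
    by (simp add: p qcnj_qpair forall_2)
  then show ?thesis by blast
qed

lemma qpair_chi: "qpair x y * p = qpair (x * chi i j p $ 1 $ 1 + y * chi i j p $ 2 $ 1)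
    (x * chi i j p $ 1 $ 2 + y * chi i j p $ 2 $ 2)"
proof -
  obtain z w where p: "p = qpair z w" by (rule qpair_cases)
  show ?thesis unfolding p qpair_mult by simp
qed

end

section \<open>Bernstein--Szego approximation\<close>

definition hadj :: "complex^2^2 \<Rightarrow> complex^2^2" where
  "hadj A = (\<chi> a b. cnj (A $ b $ a))"

lemma hadj_nth [simp]: "hadj A $ a $ b = cnj (A $ b $ a)"
  by (simp add: hadj_def)

lemma hadj_mult: "hadj (A ** B) = hadj B ** hadj A"
  by (simp add: vec_eq_iff forall_2 matrix_matrix_mult_def sum_2 mult.commute)

lemma herm_form_add: "herm_form \<xi> (A + B) = herm_form \<xi> A + herm_form \<xi> B"
  by (simp add: herm_form_def sum_2 matrix_vector_mult_def algebra_simps)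

lemma herm_form_scaleR: "herm_form \<xi> (r *\<^sub>R A) = of_real r * herm_form \<xi> A"
  by (simp add: herm_form_def sum_2 matrix_vector_mult_def) (simp add: scaleR_conv_of_real algebra_simps)

lemma herm_form_hadj: "herm_form \<xi> (hadj A) = cnj (herm_form \<xi> A)"
  by (simp add: herm_form_def sum_2 matrix_vector_mult_def algebra_simps)

lemma herm_form_congruence: "herm_form (hadj E *v \<eta>) w = herm_form \<eta> (E ** w ** hadj E)"
  by (simp add: herm_form_def sum_2 matrix_vector_mult_def matrix_matrix_mult_def algebra_simps)

lemma matrix_scaleR_assoc: "A ** (r *\<^sub>R B) = r *\<^sub>R (A ** B)" "(r *\<^sub>R A) ** B = r *\<^sub>R (A ** B)"
  for A B :: "complex^2^2"
  by (simp_all add: matrix_matrix_mult_def vec_eq_iff scaleR_sum_right)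

lemma matrix_mult_add_rdistrib: "(A + B) ** C = A ** C + B ** C" for A B C :: "complex^2^2"
  by (simp add: vec_eq_iff forall_2 matrix_matrix_mult_def sum_2 distrib_right)

text \<open>The adjugate. Divided by the determinant it is an inverse whose entries are visibly
  holomorphic wherever the determinant does not vanish.\<close>

definition adj2 :: "complex^2^2 \<Rightarrow> complex^2^2" where
  "adj2 A = vector [vector [A $ 2 $ 2, - A $ 1 $ 2], vector [- A $ 2 $ 1, A $ 1 $ 1]]"

lemma adj2_mult: "A ** adj2 A = mat (det A)"
  by (simp add: vec_eq_iff forall_2 matrix_matrix_mult_def sum_2 adj2_def mat_def det_2 algebra_simps)

section \<open>Evaluation of the Schur polynomials on row vectors\<close>

context slice_basis
begin

text \<open>
  A row vector \<open>(x, y)\<close> is encoded by the quaternion \<open>x + y j\<close>.  Multiplying the row by the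
  complex number \<open>z\<close> is then left multiplication by \<open>s = slice_of i z\<close>, and multiplying it by
  \<open>chi q\<close> is right multiplication by \<open>q\<close>, so that \<open>qev m a s v\<close> encodes \<open>v \<Sum>l. z\<^sup>l chi a\<^sub>l\<close>.
\<close>

definition qev :: "nat \<Rightarrow> quat fps \<Rightarrow> quat \<Rightarrow> quat \<Rightarrow> quat" where
  "qev m a s v = (\<Sum>l\<le>m. s ^ l * v * fps_nth a l)"

lemma qev_add: "qev m (a + b) s v = qev m a s v + qev m b s v"
  and qev_diff: "qev m (a - b) s v = qev m a s v - qev m b s v"
  by (simp_all add: qev_def distrib_left right_diff_distrib sum.distrib sum_subtractf)

lemma qev_mult_const: "qev m (a * fps_const q) s v = qev m a s v * q"
  by (simp add: qev_def sum_distrib_right mult.assoc)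

lemma qev_X_mult:
  assumes "fps_nth a m = 0"
  shows "qev m (fps_X * a) s v = s * qev m a s v"
proof (cases m)
  case (Suc m')
  have "qev m (fps_X * a) s v = (\<Sum>l\<le>m'. s * (s ^ l * v * fps_nth a l))"
    unfolding qev_def Suc by (subst sum.atMost_Suc_shift) (simp add: mult.assoc)
  also have "\<dots> = s * qev m a s v"
    using assms by (simp add: qev_def Suc sum_distrib_left[symmetric] )
  finally show ?thesis .
qed (use assms in \<open>simp add: qev_def\<close>)

lemma qev_1: "qev m 1 s v = v"
proof -
  have "qev m 1 s v = (\<Sum>l\<in>{0}. s ^ l * v * fps_nth 1 l)"
    unfolding qev_def by (rule sum.mono_neutral_right) auto
  then show ?thesis by simp
qed

lemma qev_schur_step:
  assumes "n < m"
  shows "qev m (schur_den (Suc n) \<gamma>) s v = qev m (schur_den n (\<lambda>k. \<gamma> (Suc k))) s v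
      + s * qev m (schur_num n (\<lambda>k. \<gamma> (Suc k))) s v * qcnj (\<gamma> 0)"
    and "qev m (schur_num (Suc n) \<gamma>) s v = qev m (schur_den n (\<lambda>k. \<gamma> (Suc k))) s v * \<gamma> 0
      + s * qev m (schur_num n (\<lambda>k. \<gamma> (Suc k))) s v"
  using assms
  by (simp_all add: schur_den_num_Suc qev_add qev_mult_const qev_X_mult schur_num_nth_ge)

text \<open>By \<open>norm_schur_step\<close> each step multiplies |a|^2 - |b|^2 by a positive
  factor, and the factor s of norm at most 1 can only shrink b. The truncation m stays fixed while n
  and \<gamma> vary in the induction.\<close>

lemma schur_contractive:
  assumes "n \<le> m" "norm s \<le> 1" "v \<noteq> 0" "\<And>k. k < n \<Longrightarrow> norm (\<gamma> k) < 1"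
  shows "norm (qev m (schur_num n \<gamma>) s v) < norm (qev m (schur_den n \<gamma>) s v)"
  using assms
proof (induction n arbitrary: \<gamma>)
  case 0
  then show ?case by (simp add: qev_1) (simp add: qev_def)
next
  case (Suc n)
  define d m' where "d = qev m (schur_den n (\<lambda>k. \<gamma> (Suc k))) s v"
    and "m' = qev m (schur_num n (\<lambda>k. \<gamma> (Suc k))) s v"
  have "norm (s * m') \<le> 1 * norm m'"
    unfolding norm_mult using Suc.prems by (intro mult_right_mono) auto
  also have "\<dots> < norm d" unfolding d_def m'_def using Suc.prems Suc.IH[of "\<lambda>k. \<gamma> (Suc k)"] by auto
  finally have "(norm (s * m'))\<^sup>2 < (norm d)\<^sup>2" by (intro power_strict_mono) auto
  moreover have "(norm (\<gamma> 0))\<^sup>2 < 1" using Suc.prems(4)[of 0] by (simp add: abs_square_less_1)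
  ultimately have "(1 - (norm (\<gamma> 0))\<^sup>2) * ((norm d)\<^sup>2 - (norm (s * m'))\<^sup>2) > 0" by simp
  then have "(norm (d * \<gamma> 0 + s * m'))\<^sup>2 < (norm (d + s * m' * qcnj (\<gamma> 0)))\<^sup>2"
    by (simp add: norm_schur_step[symmetric])
  then show ?case using Suc.prems(1)
    by (simp add: qev_schur_step d_def m'_def power2_less_imp_less)
qed

text \<open>For |s| = 1 the factor s preserves norms, and the argument of
  \<open>schur_contractive\<close> becomes an equality. With v running over all rows this is D D* -
  N N* = kappa_n on the circle.\<close>

lemma schur_norm_identity:
  assumes "n \<le> m" "norm s = 1"
  shows "(norm (qev m (schur_den n \<gamma>) s v))\<^sup>2 - (norm (qev m (schur_num n \<gamma>) s v))\<^sup>2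
    = schur_coeff_prod n \<gamma> * (norm v)\<^sup>2"
  using assms
proof (induction n arbitrary: \<gamma>)
  case 0
  then show ?case by (simp add: qev_1) (simp add: qev_def)
next
  case (Suc n)
  then show ?case
    by (simp add: qev_schur_step norm_schur_step norm_mult schur_coeff_prod_Suc)
qed

lemma qev_szego_poly:
  "qev n (szego_poly n \<gamma>) s v = qev n (schur_den n \<gamma>) s v - s * qev n (schur_num n \<gamma>) s v"
  "qev n (szego_poly2 n \<gamma>) s v = qev n (schur_den n \<gamma>) s v + s * qev n (schur_num n \<gamma>) s v"
  by (simp_all add: szego_poly_def szego_poly2_def qev_diff qev_add qev_X_mult schur_num_nth_ge)

definition qmat :: "nat \<Rightarrow> quat fps \<Rightarrow> complex \<Rightarrow> complex^2^2" where
  "qmat n a z = (\<chi> p q. \<Sum>l\<le>n. z ^ l * chi i j (fps_nth a l) $ p $ q)"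

lemma qmat_nth: "qmat n a z $ p $ q = (\<Sum>l\<le>n. z ^ l * chi i j (fps_nth a l) $ p $ q)"
  by (simp add: qmat_def)

lemma slice_of_power: "slice_of i (z ^ l) = slice_of i z ^ l"
  by (induction l) (simp_all add: slice_mult)

lemma qpair_sum: "qpair (sum f A) (sum g A) = (\<Sum>l\<in>A. qpair (f l) (g l))"
  by (induction A rule: infinite_finite_induct) (simp_all add: qpair_add[symmetric])

lemma qev_qpair:
  "qev n a (slice_of i z) (qpair x y) = qpair (x * qmat n a z $ 1 $ 1 + y * qmat n a z $ 2 $ 1)
     (x * qmat n a z $ 1 $ 2 + y * qmat n a z $ 2 $ 2)"
  unfolding qev_def qmat_nth sum_distrib_left sum.distrib[symmetric] qpair_sum
  by (intro sum.cong refl)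
    (simp add: slice_of_power[symmetric] mult.assoc qpair_slice qpair_chi distrib_left mult_ac)

text \<open>For a nonzero row v, the row v E is v D - z (v N). It is nonzero, since v N is strictly
  shorter than v D and |z| \<le> 1; thus E has trivial left kernel.\<close>

lemma det_szego_poly_nonzero:
  assumes "norm z \<le> 1" "\<And>k. k < n \<Longrightarrow> norm (\<gamma> k) < 1"
  shows "det (qmat n (szego_poly n \<gamma>) z) \<noteq> 0"
proof
  define E where "E = qmat n (szego_poly n \<gamma>) z"
  assume "det (qmat n (szego_poly n \<gamma>) z) = 0"
  then have det: "E $ 1 $ 1 * E $ 2 $ 2 = E $ 1 $ 2 * E $ 2 $ 1" by (simp add: E_def det_2)
  have nz: "x * E $ 1 $ 1 + y * E $ 2 $ 1 \<noteq> 0 \<or> x * E $ 1 $ 2 + y * E $ 2 $ 2 \<noteq> 0"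
    if "x \<noteq> 0 \<or> y \<noteq> 0" for x y
  proof -
    define s v where "s = slice_of i z" and "v = qpair x y"
    have s: "norm s \<le> 1" using assms(1) by (simp add: s_def slice_norm)
    have "v \<noteq> 0" using that by (simp add: v_def qpair_eq_0_iff)
    then have "norm (qev n (schur_num n \<gamma>) s v) < norm (qev n (schur_den n \<gamma>) s v)"
      using s assms(2) by (intro schur_contractive) auto
    moreover have "norm (s * qev n (schur_num n \<gamma>) s v) \<le> 1 * norm (qev n (schur_num n \<gamma>) s v)"
      unfolding norm_mult using s by (intro mult_right_mono) auto
    ultimately have "qev n (szego_poly n \<gamma>) s v \<noteq> 0"
      unfolding qev_szego_poly by auto
    then show ?thesis unfolding s_def v_def qev_qpair E_def by (simp add: qpair_eq_0_iff)
  qed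
  show False
    \<comment> \<open>Up to sign the first two test rows are the rows of the adjugate, which lie in
      the left kernel when the determinant is 0. Both must vanish, so E = 0, and the row (1, 0)
      gives the contradiction.\<close>
    using nz[of "E $ 2 $ 1" "- E $ 1 $ 1"] nz[of "E $ 2 $ 2" "- E $ 1 $ 2"] nz[of 1 0] det
    by (simp add: algebra_simps) (metis mult.commute)
qed

text \<open>The left side is the real inner product of the quaternions encoding the rows \<eta>^* E'
  and \<eta>^* E, which is why v is built from the conjugates of \<eta>. These are D + s N and D - s
  N applied to v, so the cross terms cancel and \<open>schur_norm_identity\<close> remains.\<close>

lemma herm_form_szego_poly:
  fixes n \<gamma>
  assumes "norm z = 1"
  defines "E \<equiv> qmat n (szego_poly n \<gamma>) z" and "E' \<equiv> qmat n (szego_poly2 n \<gamma>) z"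
  shows "Re (herm_form \<eta> (E' ** hadj E)) = schur_coeff_prod n \<gamma> * ((norm (\<eta> $ 1))\<^sup>2 + (norm (\<eta> $ 2))\<^sup>2)"
proof -
  define s v where "s = slice_of i z" and "v = qpair (cnj (\<eta> $ 1)) (cnj (\<eta> $ 2))"
  have inner: "inner (qpair a b) (qpair c d) = Re (a * cnj c + b * cnj d)" for a b c d
    unfolding dot_norm by (simp add: qpair_add norm_qpair cmod_power2)
      (simp add: power2_eq_square algebra_simps)
  have "Re (herm_form \<eta> (E' ** hadj E)) = inner (qev n (szego_poly2 n \<gamma>) s v) (qev n (szego_poly n \<gamma>) s v)"
    unfolding s_def v_def qev_qpair inner E_def[symmetric] E'_def[symmetric]
    by (intro arg_cong[of _ _ Re])
      (simp add: herm_form_def sum_2 matrix_vector_mult_def matrix_matrix_mult_def algebra_simps)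
  also have "\<dots> = (norm (qev n (schur_den n \<gamma>) s v))\<^sup>2 - (norm (qev n (schur_num n \<gamma>) s v))\<^sup>2"
    using assms(1) unfolding qev_szego_poly
    by (simp add: inner_simps inner_commute power2_norm_eq_inner[symmetric] norm_mult s_def slice_norm)
  also have "\<dots> = schur_coeff_prod n \<gamma> * (norm v)\<^sup>2"
    using assms(1) by (intro schur_norm_identity) (simp_all add: s_def slice_norm)
  also have "(norm v)\<^sup>2 = (norm (\<eta> $ 1))\<^sup>2 + (norm (\<eta> $ 2))\<^sup>2" by (simp add: v_def norm_qpair)
  finally show ?thesis .
qed


section \<open>The Bernstein--Szego density\<close>

definition bs_function :: "nat \<Rightarrow> (nat \<Rightarrow> quat) \<Rightarrow> complex \<Rightarrow> complex^2^2" where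
  "bs_function n \<gamma> z = (let E = qmat n (szego_poly n \<gamma>) z in
     (\<chi> a b. adj2 E $ a $ b / det E) ** qmat n (szego_poly2 n \<gamma>) z)"

definition bs_density :: "nat \<Rightarrow> (nat \<Rightarrow> quat) \<Rightarrow> complex \<Rightarrow> complex^2^2" where
  "bs_density n \<gamma> z = (1 / 2) *\<^sub>R (bs_function n \<gamma> z + hadj (bs_function n \<gamma> z))"

lemma szego_poly_mult_bs_function:
  assumes "norm z \<le> 1" "\<And>k. k < n \<Longrightarrow> norm (\<gamma> k) < 1"
  shows "qmat n (szego_poly n \<gamma>) z ** bs_function n \<gamma> z = qmat n (szego_poly2 n \<gamma>) z"
proof -
  define E where "E = qmat n (szego_poly n \<gamma>) z"
  have "det E \<noteq> 0" using det_szego_poly_nonzero[of z n \<gamma>] assms by (simp add: E_def)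
  then have "E ** (\<chi> a b. adj2 E $ a $ b / det E) = mat 1"
    using adj2_mult[of E]
    by (simp add: vec_eq_iff forall_2 matrix_matrix_mult_def sum_2 mat_def add_divide_distrib[symmetric])
  then show ?thesis
    by (simp add: bs_function_def Let_def E_def matrix_mul_assoc)
qed

text \<open>E F = E' turns the product into half the sum of \<open>E' ** hadj E\<close> and its
  adjoint, so only the real part of the form of \<open>E' ** hadj E\<close> is seen, and
  \<open>herm_form_szego_poly\<close> computes it. \<open>herm_form_eqI\<close> lifts the scalar
  identity to matrices.\<close>

lemma bs_density_congruence:
  assumes "norm z = 1" "\<And>k. k < n \<Longrightarrow> norm (\<gamma> k) < 1"
  defines "E \<equiv> qmat n (szego_poly n \<gamma>) z"
  shows "E ** bs_density n \<gamma> z ** hadj E = schur_coeff_prod n \<gamma> *\<^sub>R mat 1"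
proof (rule herm_form_eqI)
  fix \<eta> :: "complex^2"
  define F E' where "F = bs_function n \<gamma> z" and "E' = qmat n (szego_poly2 n \<gamma>) z"
  have EF: "E ** F = E'" unfolding E_def F_def E'_def
    using assms by (intro szego_poly_mult_bs_function) auto
  have hadj_hadj: "hadj (hadj A) = A" for A by (simp add: vec_eq_iff)
  have "E ** hadj F ** hadj E = hadj (E' ** hadj E)"
    by (simp add: hadj_mult hadj_hadj EF[symmetric] matrix_mul_assoc)
  then have "E ** bs_density n \<gamma> z ** hadj E = (1/2) *\<^sub>R (E' ** hadj E + hadj (E' ** hadj E))"
    by (simp add: bs_density_def F_def[symmetric] matrix_scaleR_assoc matrix_add_ldistrib
        matrix_mult_add_rdistrib EF)
  then have "herm_form \<eta> (E ** bs_density n \<gamma> z ** hadj E) = of_real (Re (herm_form \<eta> (E' ** hadj E)))"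
    by (simp add: herm_form_scaleR herm_form_add herm_form_hadj complex_add_cnj)
  also have "\<dots> = of_real (schur_coeff_prod n \<gamma> * ((norm (\<eta> $ 1))\<^sup>2 + (norm (\<eta> $ 2))\<^sup>2))"
    unfolding E'_def E_def by (subst herm_form_szego_poly[OF assms(1)]) (rule refl)
  also have "\<dots> = herm_form \<eta> (schur_coeff_prod n \<gamma> *\<^sub>R mat 1)"
    by (simp add: herm_form_scaleR) (simp add: herm_form_def sum_2 mult.commute flip: complex_norm_square)
  finally show "herm_form \<eta> (E ** bs_density n \<gamma> z ** hadj E)
    = herm_form \<eta> (schur_coeff_prod n \<gamma> *\<^sub>R mat 1)" .
qed

lemma qmat_holomorphic [holomorphic_intros]: "(\<lambda>z. qmat n a z $ p $ q) holomorphic_on A"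
  unfolding qmat_nth by (intro holomorphic_intros)

lemma det_qmat_holomorphic [holomorphic_intros]: "(\<lambda>z. det (qmat n a z)) holomorphic_on A"
  unfolding det_2 by (intro holomorphic_intros)

lemma bs_function_holomorphic:
  assumes "\<And>k. k < n \<Longrightarrow> norm (\<gamma> k) < 1"
  shows "(\<lambda>z. bs_function n \<gamma> z $ p $ q) holomorphic_on cball 0 1"
proof -
  have nz: "det (qmat n (szego_poly n \<gamma>) z) \<noteq> 0" if "norm z \<le> 1" for z
    using that assms by (intro det_szego_poly_nonzero) auto
  have "(\<lambda>z. bs_function n \<gamma> z $ p $ q) holomorphic_on cball 0 1" if "p = 1 \<or> p = 2" for p
    using that unfolding bs_function_def Let_def matrix_matrix_mult_def sum_2
    by (auto simp: adj2_def nz intro!: holomorphic_intros)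
  then show ?thesis using exhaust_2[of p] by blast
qed

lemma continuous_on_bs_function:
  assumes "\<And>k. k < n \<Longrightarrow> norm (\<gamma> k) < 1"
  shows "continuous_on (sphere 0 1) (\<lambda>z. bs_function n \<gamma> z $ p $ q)"
  using holomorphic_on_imp_continuous_on[OF bs_function_holomorphic[OF assms]]
  by (rule continuous_on_subset) auto

lemma continuous_on_bs_density:
  assumes "\<And>k. k < n \<Longrightarrow> norm (\<gamma> k) < 1"
  shows "continuous_on (sphere 0 1) (\<lambda>z. bs_density n \<gamma> z $ p $ q)"
proof -
  have "bs_density n \<gamma> z $ p $ q = (1 / 2) *\<^sub>R (bs_function n \<gamma> z $ p $ q + cnj (bs_function n \<gamma> z $ q $ p))" for z
    by (simp add: bs_density_def)
  then show ?thesis by (simp only:) (intro continuous_intros continuous_on_bs_function assms)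
qed

end

lemma continuous_on_powi_sphere [continuous_intros]:
  fixes z :: complex
  shows "continuous_on (sphere 0 1) (\<lambda>z::complex. z powi k)"
  by (intro continuous_intros) auto

lemma cnj_powi_circle: "norm z = 1 \<Longrightarrow> cnj z powi k = z powi (- k)"
proof -
  assume z: "norm z = 1"
  then have "cnj z = inverse z"
    by (metis complex_div_cnj complex_norm_square inverse_eq_divide mult_1 of_real_1 one_power2
        power_one nonzero_eq_divide_eq norm_zero zero_neq_one mult.commute)
  then show ?thesis by (simp add: power_int_minus power_int_inverse)
qed

lemma mean_powi: "(\<integral>t. cis t powi k \<partial>angle_measure) = (if k = 0 then 1 else 0)"
proof -
  have nat: "(\<integral>t. cis t powi int m \<partial>angle_measure) = (if m = 0 then 1 else 0)" for m
  proof -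
    have "(\<lambda>z::complex. z ^ m) holomorphic_on cball 0 1" by (intro holomorphic_intros)
    from mean_value_holomorphic[OF this] show ?thesis by (auto simp: power_0_left)
  qed
  show ?thesis
  proof (cases "k \<ge> 0")
    case True
    then show ?thesis using nat[of "nat k"] by simp
  next
    case False
    have "(\<integral>t. cis t powi k \<partial>angle_measure) = (\<integral>t. cnj (cis t powi (- k)) \<partial>angle_measure)"
      by (simp add: cnj_powi_circle)
    also have "\<dots> = cnj (\<integral>t. cis t powi (- k) \<partial>angle_measure)" by (rule Bochner_Integration.integral_cnj)
    also have "\<dots> = 0" using nat[of "nat (- k)"] False by simp
    finally show ?thesis using False by simp
  qed
qed

section \<open>Fourier coefficients and moments of the density\<close>

context slice_basis
begin

definition bs_coeff :: "nat \<Rightarrow> (nat \<Rightarrow> quat) \<Rightarrow> int \<Rightarrow> complex^2^2" where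
  "bs_coeff n \<gamma> k = (\<chi> p q. \<integral>t. cis t powi (- k) * bs_function n \<gamma> (cis t) $ p $ q \<partial>angle_measure)"

text \<open>For m > 0 the function z^m F is holomorphic on the closed disc and vanishes at 0, so its
  mean is 0.\<close>

lemma bs_coeff_neg:
  assumes "\<And>k. k < n \<Longrightarrow> norm (\<gamma> k) < 1" "k < 0"
  shows "bs_coeff n \<gamma> k = 0"
proof -
  obtain m where k: "k = - int m" "m > 0" using assms(2) by (metis neg_0_less_iff_less
    add.inverse_inverse zero_less_imp_eq_int)
  have "(\<integral>t. cis t ^ m * bs_function n \<gamma> (cis t) $ p $ q \<partial>angle_measure) = 0" for p q
    using k(2) by (subst mean_value_holomorphic[where f="\<lambda>z. z ^ m * bs_function n \<gamma> z $ p $ q"])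
      (auto intro!: holomorphic_intros bs_function_holomorphic assms)
  then show ?thesis by (simp add: bs_coeff_def vec_eq_iff k)
qed

text \<open>These are the k-th Fourier coefficients of E F = E' on the circle; the terms with l > k
  contain coefficients of F of negative index and drop out.\<close>

lemma bs_coeff_recursion:
  assumes "\<And>k. k < n \<Longrightarrow> norm (\<gamma> k) < 1" "k \<le> n"
  shows "(\<Sum>l\<le>k. chi i j (fps_nth (szego_poly n \<gamma>) l) ** bs_coeff n \<gamma> (int (k - l)))
    = chi i j (fps_nth (szego_poly2 n \<gamma>) k)"
proof -
  let ?e = "\<lambda>l. chi i j (fps_nth (szego_poly n \<gamma>) l)"
  let ?F = "bs_function n \<gamma>"
  have pw: "cis x powi (int l - int k) = cis x powi (- int k) * cis x ^ l" for x l
    by (simp add: power_int_diff power_int_minus divide_inverse)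
  have int: "integrable angle_measure (\<lambda>t. cis t powi m * ?F (cis t) $ r $ q)" for m r q
    by (rule integrable_angle_continuous[where f="\<lambda>z. z powi m * ?F z $ r $ q"])
      (intro continuous_intros continuous_on_bs_function assms, auto)
  have "(\<Sum>l\<le>n. ?e l ** bs_coeff n \<gamma> (int k - int l)) $ p $ q = chi i j (fps_nth (szego_poly2 n \<gamma>) k) $ p $ q"
    for p q
  proof -
    have "(\<Sum>l\<le>n. ?e l ** bs_coeff n \<gamma> (int k - int l)) $ p $ q
      = (\<Sum>l\<le>n. \<Sum>r\<in>UNIV. ?e l $ p $ r * (\<integral>t. cis t powi (int l - int k) * ?F (cis t) $ r $ q \<partial>angle_measure))"
      by (simp add: matrix_matrix_mult_def bs_coeff_def)
    also have "\<dots> = (\<integral>t. (\<Sum>l\<le>n. \<Sum>r\<in>UNIV. ?e l $ p $ r * (cis t powi (int l - int k) * ?F (cis t) $ r $ q)) \<partial>angle_measure)"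
      using int by (simp add: Bochner_Integration.integral_sum)
    also have "\<dots> = (\<integral>t. cis t powi (- int k) * (qmat n (szego_poly n \<gamma>) (cis t) ** ?F (cis t)) $ p $ q \<partial>angle_measure)"
      by (intro Bochner_Integration.integral_cong refl)
        (simp add: matrix_matrix_mult_def qmat_nth sum_2 sum_distrib_left sum_distrib_right sum.distrib
           pw distrib_left mult_ac)
    also have "\<dots> = (\<integral>t. cis t powi (- int k) * (qmat n (szego_poly2 n \<gamma>) (cis t)) $ p $ q \<partial>angle_measure)"
      using assms by (subst szego_poly_mult_bs_function) auto
    also have "\<dots> = (\<integral>t. (\<Sum>l\<le>n. chi i j (fps_nth (szego_poly2 n \<gamma>) l) $ p $ q * cis t powi (int l - int k)) \<partial>angle_measure)"
      by (intro Bochner_Integration.integral_cong refl)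
        (simp add: qmat_nth sum_distrib_left power_int_diff power_int_minus field_simps)
    also have "\<dots> = (\<Sum>l\<le>n. chi i j (fps_nth (szego_poly2 n \<gamma>) l) $ p $ q * (if int l - int k = 0 then 1 else 0))"
      by (subst Bochner_Integration.integral_sum)
        (auto simp del: right_minus_eq simp: mean_powi intro!: integrable_mult_right integrable_angle_continuous[where f="\<lambda>z. z powi m" for m] continuous_intros)
    also have "\<dots> = (\<Sum>l\<in>{k}. chi i j (fps_nth (szego_poly2 n \<gamma>) l) $ p $ q)"
      using assms(2) by (intro sum.mono_neutral_cong_right) auto
    finally show ?thesis by simp
  qed
  then have "(\<Sum>l\<le>n. ?e l ** bs_coeff n \<gamma> (int k - int l)) = chi i j (fps_nth (szego_poly2 n \<gamma>) k)"
    by (simp add: vec_eq_iff)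
  moreover have "(\<Sum>l\<le>n. ?e l ** bs_coeff n \<gamma> (int k - int l))
    = (\<Sum>l\<le>k. ?e l ** bs_coeff n \<gamma> (int (k - l)))"
    using assms by (intro sum.mono_neutral_cong_right) (auto simp: bs_coeff_neg of_nat_diff)
  ultimately show ?thesis by simp
qed

text \<open>The recursion is triangular with leading coefficient \<open>chi i j 1\<close>, the
  identity, so it has a unique solution up to order n. By \<open>szego_poly_caratheodory\<close> the
  images of the Caratheodory coefficients solve it as well.\<close>

lemma bs_coeff_eq:
  assumes "schur_algorithm f fs \<gamma>" "schur_fps_of c f" "\<And>k. k < n \<Longrightarrow> norm (\<gamma> k) < 1" "k \<le> n"
  shows "bs_coeff n \<gamma> (int k) = chi i j (fps_nth (caratheodory_fps c) k)"
  using assms(4)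
proof (induction k rule: less_induct)
  case (less k)
  let ?e = "\<lambda>l. chi i j (fps_nth (szego_poly n \<gamma>) l)"
  have "chi i j (fps_nth (szego_poly n \<gamma> * caratheodory_fps c) k)
    = (\<Sum>l\<le>k. ?e l ** chi i j (fps_nth (caratheodory_fps c) (k - l)))"
    by (simp add: fps_mult_nth chi_sum chi_mult atMost_atLeast0)
  moreover have "fps_nth (szego_poly n \<gamma> * caratheodory_fps c) k = fps_nth (szego_poly2 n \<gamma>) k"
    using assms(3) less.prems by (intro szego_poly_caratheodory[OF assms(1) _ assms(2)]) auto
  ultimately have "(\<Sum>l\<le>k. ?e l ** bs_coeff n \<gamma> (int (k - l)))
     = (\<Sum>l\<le>k. ?e l ** chi i j (fps_nth (caratheodory_fps c) (k - l)))"
    using bs_coeff_recursion[OF assms(3) less.prems] by simp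
  moreover have "(\<Sum>l\<in>{..k} - {0}. ?e l ** bs_coeff n \<gamma> (int (k - l)))
     = (\<Sum>l\<in>{..k} - {0}. ?e l ** chi i j (fps_nth (caratheodory_fps c) (k - l)))"
    using less.prems by (intro sum.cong refl arg_cong2[where f="(**)"] less.IH) auto
  ultimately show ?case
    by (simp add: sum.remove[of "{..k}" 0] chi_1)
qed

text \<open>The moment is half the sum of the coefficient of F at -k and the adjoint of the one at
  k. For k \<noteq> 0 one of the two has negative index and vanishes, and the other is twice the
  wanted matrix; for k = 0 both are the identity.\<close>

lemma bs_density_moment:
  assumes "schur_algorithm f fs \<gamma>" "schur_fps_of c f" "\<And>k. k < n \<Longrightarrow> norm (\<gamma> k) < 1"
    and c: "\<And>n. c (- n) = qcnj (c n)" "c 0 = 1" and k: "\<bar>k\<bar> \<le> int n"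
  shows "(\<integral>t. cis t powi k * bs_density n \<gamma> (cis t) $ p $ q \<partial>angle_measure) = chi i j (c k) $ p $ q"
proof -
  let ?F = "bs_function n \<gamma>"
  have int: "integrable angle_measure (\<lambda>t. cis t powi m * ?F (cis t) $ r $ q)" for m r q
    by (rule integrable_angle_continuous[where f="\<lambda>z. z powi m * ?F z $ r $ q"])
      (intro continuous_intros continuous_on_bs_function assms, auto)
  have int': "integrable angle_measure (\<lambda>t. cnj (cis t powi m * ?F (cis t) $ r $ q))" for m r q
    by (subst complex_integrable_cnj) (rule int)
  have "(\<integral>t. cis t powi k * bs_density n \<gamma> (cis t) $ p $ q \<partial>angle_measure)
    = (\<integral>t. (1/2) *\<^sub>R (cis t powi k * ?F (cis t) $ p $ q + cnj (cis t powi (- k) * ?F (cis t) $ q $ p)) \<partial>angle_measure)"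
    by (intro Bochner_Integration.integral_cong refl)
      (simp add: bs_density_def cnj_powi_circle algebra_simps scaleR_add_right)
  also have "\<dots> = (1/2) *\<^sub>R (bs_coeff n \<gamma> (- k) $ p $ q + cnj (bs_coeff n \<gamma> k $ q $ p))"
    using int[of k p q] int'[of "-k" q p] unfolding integral_scaleR_right
    by (subst Bochner_Integration.integral_add) (simp_all add: bs_coeff_def del: complex_cnj_mult)
  also have "\<dots> = chi i j (c k) $ p $ q"
  proof -
    have pos: "bs_coeff n \<gamma> m = chi i j (2 * c (- m))" if "m > 0" "m \<le> int n" for m
      using bs_coeff_eq[OF assms(1,2), where n=n and k="nat m"] assms(3) that by (simp add: caratheodory_fps_def)
    have zero: "bs_coeff n \<gamma> 0 = mat 1"
      using bs_coeff_eq[OF assms(1,2), where n=n and k=0] assms(3) by (simp add: caratheodory_fps_def chi_1)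
    have neg: "bs_coeff n \<gamma> m = 0" if "m < 0" for m
      by (rule bs_coeff_neg[OF assms(3) that])
    have half: "(1 / 2) *\<^sub>R (z + z) = z" for z :: complex by (simp add: scaleR_2[symmetric])
    consider "k = 0" | "k > 0" | "k < 0" by linarith
    then show ?thesis
    proof cases
      case 1
      have "(1 / 2) *\<^sub>R (x + cnj x) = x" if "x = 1 \<or> x = 0" for x :: complex
        using that by (auto simp: scaleR_2[symmetric])
      moreover have "mat 1 $ q $ p = (mat 1 $ p $ q :: complex)" "mat 1 $ p $ q = (1::complex) \<or> mat 1 $ p $ q = (0::complex)"
        unfolding mat_def by auto
      ultimately show ?thesis unfolding 1 by (simp only: minus_zero zero c(2) chi_1)
    next
      case 2
      have "bs_coeff n \<gamma> k = chi i j (c (- k)) + chi i j (c (- k))"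
        using pos[of k] 2 k by (simp only: mult_2 chi_add)
      moreover have "bs_coeff n \<gamma> (- k) = 0" using neg[of "- k"] 2 by simp
      moreover have "cnj (chi i j (c (- k)) $ q $ p) = chi i j (c k) $ p $ q"
        using c(1)[of "- k"] by (simp add: chi_qcnj_nth[symmetric])
      ultimately show ?thesis by (simp add: half)
    next
      case 3
      have "bs_coeff n \<gamma> (- k) = chi i j (c k) + chi i j (c k)"
        using pos[of "- k"] 3 k by (simp only: mult_2 chi_add minus_minus)
      moreover have "bs_coeff n \<gamma> k = 0" using neg[of k] 3 by simp
      ultimately show ?thesis by (simp add: half)
    qed
  qed
  finally show ?thesis .
qed

text \<open>E is the identity at 0 and its determinant has no zero in the closed disc, so the mean
  value property gives ln 1. This is what makes the mean of log det w_n explicit.\<close>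

lemma mean_ln_det_szego_poly:
  assumes "\<And>k. k < n \<Longrightarrow> norm (\<gamma> k) < 1"
  shows "(\<integral>t. ln (norm (det (qmat n (szego_poly n \<gamma>) (cis t)))) \<partial>angle_measure) = 0"
proof -
  have "qmat n (szego_poly n \<gamma>) 0 $ p $ q = mat 1 $ p $ q" for p q
  proof -
    have "qmat n (szego_poly n \<gamma>) 0 $ p $ q
      = (\<Sum>l\<in>{0}. 0 ^ l * chi i j (fps_nth (szego_poly n \<gamma>) l) $ p $ q)"
      unfolding qmat_nth by (rule sum.mono_neutral_right) auto
    then show ?thesis by (simp add: chi_1)
  qed
  then have "qmat n (szego_poly n \<gamma>) 0 = mat 1" by (simp add: vec_eq_iff)
  then show ?thesis
    using assms by (subst mean_value_ln_norm)
      (auto simp: det_szego_poly_nonzero intro!: holomorphic_intros)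
qed

end

section \<open>Density of trigonometric polynomials\<close>

text \<open>Only values on the circle are constrained, so conjugates and squared norms qualify. The
  order n is recorded because w_n shares with M only the moments up to order n.\<close>

definition trig_poly :: "nat \<Rightarrow> (complex \<Rightarrow> complex) \<Rightarrow> bool" where
  "trig_poly n f \<longleftrightarrow> (\<exists>a. \<forall>z. norm z = 1 \<longrightarrow> f z = (\<Sum>k=- int n..int n. a k * z powi k))"

lemma trig_poly_cmult: "trig_poly n f \<Longrightarrow> trig_poly n (\<lambda>z. b * f z)"
  unfolding trig_poly_def
  by (elim exE, rule_tac x="\<lambda>k. b * a k" in exI) (simp add: sum_distrib_left mult.assoc)

lemma trig_poly_add: "trig_poly n f \<Longrightarrow> trig_poly n g \<Longrightarrow> trig_poly n (\<lambda>z. f z + g z)"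
  unfolding trig_poly_def
  by (elim exE, rule_tac x="\<lambda>k. a k + aa k" in exI) (simp add: distrib_right sum.distrib)

lemma trig_poly_powi:
  assumes "\<bar>k\<bar> \<le> int n"
  shows "trig_poly n (\<lambda>z. z powi k)"
proof -
  have "(\<Sum>l=- int n..int n. (if l = k then 1 else 0) * z powi l) = z powi k" for z :: complex
  proof -
    have "(\<Sum>l=- int n..int n. (if l = k then 1 else 0) * z powi l) = (\<Sum>l\<in>{k}. z powi l)"
      using assms by (intro sum.mono_neutral_cong_right) auto
    then show ?thesis by simp
  qed
  then show ?thesis unfolding trig_poly_def by metis
qed

lemma trig_poly_const: "trig_poly n (\<lambda>z. b)"
  using trig_poly_cmult[OF trig_poly_powi[of 0 n], of b] by simp

lemma trig_poly_sum: "(\<And>x. x \<in> A \<Longrightarrow> trig_poly n (f x)) \<Longrightarrow> trig_poly n (\<lambda>z. \<Sum>x\<in>A. f x z)"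
  by (induction A rule: infinite_finite_induct) (auto intro: trig_poly_add trig_poly_const)

lemma trig_poly_congI: "trig_poly n g \<Longrightarrow> (\<And>z. norm z = 1 \<Longrightarrow> f z = g z) \<Longrightarrow> trig_poly n f"
  unfolding trig_poly_def by simp

lemma trig_poly_mono:
  assumes "trig_poly n f" "n \<le> m"
  shows "trig_poly m f"
proof -
  from assms(1) obtain a where a: "\<And>z. norm z = 1 \<Longrightarrow> f z = (\<Sum>k=- int n..int n. a k * z powi k)"
    unfolding trig_poly_def by blast
  have "trig_poly m (\<lambda>z. \<Sum>k=- int n..int n. a k * z powi k)"
    using assms(2) by (intro trig_poly_sum trig_poly_cmult trig_poly_powi) auto
  then show ?thesis by (rule trig_poly_congI) (rule a)
qed

lemma trig_poly_cnj:
  assumes "trig_poly n f"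
  shows "trig_poly n (\<lambda>z. cnj (f z))"
proof -
  from assms(1) obtain a where a: "\<And>z. norm z = 1 \<Longrightarrow> f z = (\<Sum>k=- int n..int n. a k * z powi k)"
    unfolding trig_poly_def by blast
  have "trig_poly n (\<lambda>z. \<Sum>k=- int n..int n. cnj (a k) * z powi (- k))"
    by (intro trig_poly_sum trig_poly_cmult trig_poly_powi) auto
  moreover have "cnj (f z) = (\<Sum>k=- int n..int n. cnj (a k) * z powi (- k))" if "norm z = 1" for z
    using that by (simp add: a cnj_powi_circle)
  ultimately show ?thesis by (rule trig_poly_congI)
qed

lemma trig_poly_mult:
  assumes "trig_poly n f" "trig_poly m g"
  shows "trig_poly (n + m) (\<lambda>z. f z * g z)"
proof -
  from assms(1) obtain a where a: "\<And>z. norm z = 1 \<Longrightarrow> f z = (\<Sum>k=- int n..int n. a k * z powi k)"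
    unfolding trig_poly_def by blast
  from assms(2) obtain b where b: "\<And>z. norm z = 1 \<Longrightarrow> g z = (\<Sum>k=- int m..int m. b k * z powi k)"
    unfolding trig_poly_def by blast
  have "trig_poly (n + m) (\<lambda>z. \<Sum>k=- int n..int n. \<Sum>l=- int m..int m. (a k * b l) * z powi (k + l))"
    by (intro trig_poly_sum trig_poly_cmult trig_poly_powi) auto
  moreover have "f z * g z = (\<Sum>k=- int n..int n. \<Sum>l=- int m..int m. (a k * b l) * z powi (k + l))"
    if "norm z = 1" for z
  proof -
    have "z \<noteq> 0" using that by auto
    then have *: "(a k * z powi k) * (b l * z powi l) = (a k * b l) * z powi (k + l)" for k l
      by (simp add: power_int_add)
    then show ?thesis unfolding a[OF that] b[OF that] sum_product by (simp only: *)
  qed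
  ultimately show ?thesis by (rule trig_poly_congI)
qed

lemma trig_poly_continuous: "trig_poly n f \<Longrightarrow> continuous_on (sphere 0 1) f"
proof -
  assume "trig_poly n f"
  then obtain a where a: "\<And>z. norm z = 1 \<Longrightarrow> f z = (\<Sum>k=- int n..int n. a k * z powi k)"
    unfolding trig_poly_def by blast
  have "continuous_on (sphere 0 1) (\<lambda>z. \<Sum>k=- int n..int n. a k * z powi k)"
    by (intro continuous_intros)
  then show ?thesis by (rule continuous_on_cong[THEN iffD1, rotated -1]) (auto simp: a)
qed

abbreviation real_trig_poly :: "nat \<Rightarrow> (complex \<Rightarrow> real) \<Rightarrow> bool" where
  "real_trig_poly n g \<equiv> trig_poly n (\<lambda>z. complex_of_real (g z))"

lemma real_trig_poly_Re: "trig_poly n f \<Longrightarrow> real_trig_poly n (\<lambda>z. Re (f z))"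
  and real_trig_poly_Im: "trig_poly n f \<Longrightarrow> real_trig_poly n (\<lambda>z. Im (f z))"
proof -
  assume f: "trig_poly n f"
  have "trig_poly n (\<lambda>z. (1/2) * (f z + cnj (f z)))"
    by (intro trig_poly_cmult trig_poly_add trig_poly_cnj f)
  then show "real_trig_poly n (\<lambda>z. Re (f z))" by (simp add: complex_add_cnj)
  have "trig_poly n (\<lambda>z. (- \<i>/2) * (f z + (-1) * cnj (f z)))"
    by (intro trig_poly_cmult trig_poly_add trig_poly_cnj f)
  then show "real_trig_poly n (\<lambda>z. Im (f z))"
    by (rule trig_poly_congI) (simp add: complex_eq_iff)
qed

lemma real_trig_poly_continuous: "real_trig_poly n g \<Longrightarrow> continuous_on (sphere 0 1) g"
  using trig_poly_continuous[of n "\<lambda>z. complex_of_real (g z)"] continuous_on_Re by fastforce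

text \<open>Stone--Weierstrass: points of the circle are separated by the real or the imaginary part
  of z.\<close>

lemma real_trig_poly_dense_continuous:
  fixes g :: "complex \<Rightarrow> real"
  assumes "continuous_on (sphere 0 1) g" "e > 0"
  shows "\<exists>n h. real_trig_poly n h \<and> (\<forall>z\<in>sphere 0 1. \<bar>g z - h z\<bar> < e)"
proof -
  let ?P = "\<lambda>h. \<exists>n. real_trig_poly n h"
  have "\<exists>h. ?P h \<and> (\<forall>z\<in>sphere 0 1. \<bar>g z - h z\<bar> < e)"
  proof (rule Stone_Weierstrass_HOL[where P="?P"])
    show "\<exists>n. real_trig_poly n (\<lambda>z. c)" for c by (intro exI trig_poly_const)
    show "continuous_on (sphere 0 1) f" if "?P f" for f
      using that real_trig_poly_continuous by blast
    show "\<exists>n. real_trig_poly n (\<lambda>z. f z + h z)" if fh: "?P f \<and> ?P h" for f h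
    proof -
      from fh obtain n m where "real_trig_poly n f" "real_trig_poly m h" by blast
      then have "trig_poly (max n m) (\<lambda>z. of_real (f z) + of_real (h z))"
        by (intro trig_poly_add) (auto elim: trig_poly_mono)
      then show ?thesis by (auto simp: of_real_add)
    qed
    show "\<exists>n. real_trig_poly n (\<lambda>z. f z * h z)" if fh: "?P f \<and> ?P h" for f h
    proof -
      from fh obtain n m where "real_trig_poly n f" "real_trig_poly m h" by blast
      from trig_poly_mult[OF this] show ?thesis by (auto simp: of_real_mult)
    qed
    show "\<exists>f. ?P f \<and> f x \<noteq> f y" if "x \<in> sphere 0 1 \<and> y \<in> sphere 0 1 \<and> x \<noteq> y" for x y
    proof -
      have z: "trig_poly 1 (\<lambda>z. z)" using trig_poly_powi[of 1 1] by simp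
      have "Re x \<noteq> Re y \<or> Im x \<noteq> Im y" using that complex_eq_iff by blast
      then show ?thesis using real_trig_poly_Re[OF z] real_trig_poly_Im[OF z] by blast
    qed
  qed (use assms in auto)
  then show ?thesis by blast
qed

section \<open>Almost everywhere approximation of bounded Borel functions\<close>

text \<open>Regularity encloses A between a compact K and an open U, each within e/4 of A in
  measure. A Urysohn function for K and the complement of U differs from the indicator only on U -
  K.\<close>

lemma indicator_approx_continuous:
  fixes \<nu> :: "complex measure"
  assumes sets[measurable_cong]: "sets \<nu> = sets borel" and fin: "finite_measure \<nu>"
    and A: "A \<in> sets borel" and e: "e > 0"
  shows "\<exists>g. continuous_on UNIV g \<and> (\<forall>x. \<bar>g x\<bar> \<le> 1) \<and> (\<integral>x. \<bar>indicator A x - g x\<bar> \<partial>\<nu>) < (e::real)"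
proof -
  interpret finite_measure \<nu> by fact
  have space: "space \<nu> = UNIV" using sets_eq_imp_space_eq[OF sets] by simp
  have sp: "emeasure \<nu> (space \<nu>) \<noteq> \<infinity>" and eA: "emeasure \<nu> A \<noteq> \<infinity>"
    using emeasure_finite by simp_all
  have e4: "0 < e / 4" using e by simp
  have ne: "{K. K \<subseteq> A \<and> compact K} \<noteq> {}" by auto
  obtain K where K: "K \<subseteq> A" "compact K" "emeasure \<nu> A < emeasure \<nu> K + ennreal (e / 4)"
    using SUP_approx_ennreal[OF e4 ne inner_regular[OF sets sp A] eA] by auto
  obtain U where U: "A \<subseteq> U" "open U" "emeasure \<nu> U < emeasure \<nu> A + ennreal (e / 4)"
    using INF_approx_ennreal[OF e4 outer_regular[OF sets sp A] eA] by auto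
  have [measurable]: "K \<in> sets borel" "U \<in> sets borel" "A \<in> sets borel"
    using K U A by (auto simp: compact_imp_closed)
  have mK: "measure \<nu> A < measure \<nu> K + e / 4"
    using K(3) e unfolding emeasure_eq_measure
    by (metis (no_types) ennreal_plus ennreal_less_iff measure_nonneg zero_le_divide_iff less_imp_le zero_le_numeral)
  have mU: "measure \<nu> U < measure \<nu> A + e / 4"
    using U(3) e unfolding emeasure_eq_measure
    by (metis (no_types) ennreal_plus ennreal_less_iff measure_nonneg zero_le_divide_iff less_imp_le zero_le_numeral)
  have KU: "K \<inter> - U = {}" using K U by auto
  obtain g :: "complex \<Rightarrow> real" where g: "continuous_on UNIV g" "\<And>x. g x \<in> closed_segment 1 0"
      "\<And>x. x \<in> K \<Longrightarrow> g x = 1" "\<And>x. x \<in> - U \<Longrightarrow> g x = 0"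
    using Urysohn[of K "- U" "1::real" 0] K U KU by (metis closed_Compl compact_imp_closed)
  have g01: "0 \<le> g x" "g x \<le> 1" for x using g(2)[of x] by (auto simp: closed_segment_eq_real_ivl)
  have [measurable]: "g \<in> borel_measurable borel" using g(1) by (rule borel_measurable_continuous_onI)
  have le: "\<bar>indicator A x - g x\<bar> \<le> indicator (U - K) x" for x
  proof -
    have "x \<in> K \<or> x \<in> U - K \<or> x \<in> - U" by blast
    then show ?thesis using K(1) U(1) g(3,4)[of x] g01[of x] by (auto simp: indicator_def)
  qed
  have "(\<integral>x. \<bar>indicator A x - g x\<bar> \<partial>\<nu>) \<le> (\<integral>x. indicator (U - K) x \<partial>\<nu>)"
  proof (rule Bochner_Integration.integral_mono)
    show "integrable \<nu> (\<lambda>x. \<bar>indicator A x - g x\<bar>)"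
    proof (rule integrable_const_bound[where B=1])
      have "\<bar>indicator A x - g x\<bar> \<le> 1" for x
        using g01[of x] by (simp add: indicator_def)
      then show "AE x in \<nu>. norm \<bar>indicator A x - g x\<bar> \<le> 1"
        by (intro AE_I2) (simp only: real_norm_def abs_abs)
    qed measurable
    show "integrable \<nu> (indicator (U - K) :: _ \<Rightarrow> real)"
      by (intro integrable_const_bound[where B=1]) (auto simp: indicator_def)
  qed (use le in auto)
  also have "\<dots> = measure \<nu> U - measure \<nu> K"
    using K U by (simp add: space finite_measure_Diff)
  also have "\<dots> < e" using mK mU e by linarith
  finally show ?thesis using g(1) g01 by (intro exI[of _ g]) auto
qed

lemma integrable_approx_continuous:
  fixes \<nu> :: "complex measure" and f :: "complex \<Rightarrow> real"
  assumes sets[measurable_cong]: "sets \<nu> = sets borel" and fin: "finite_measure \<nu>"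
    and f: "integrable \<nu> f" and e: "e > 0"
  shows "\<exists>g. continuous_on UNIV g \<and> integrable \<nu> g \<and> (\<integral>x. \<bar>f x - g x\<bar> \<partial>\<nu>) < e"
  using f e
proof (induction arbitrary: e rule: integrable_induct)
  case (base A c)
  interpret finite_measure \<nu> by fact
  have e': "e / (\<bar>c\<bar> + 1) > 0" using base by simp
  obtain g where g: "continuous_on UNIV g" "\<And>x. \<bar>g x\<bar> \<le> 1" "(\<integral>x. \<bar>indicator A x - g x\<bar> \<partial>\<nu>) < e / (\<bar>c\<bar> + 1)"
    using indicator_approx_continuous[OF sets fin _ e', of A] base sets by auto
  have [measurable]: "g \<in> borel_measurable borel" using g(1) by (rule borel_measurable_continuous_onI)
  have "(\<integral>x. \<bar>indicator A x *\<^sub>R c - g x * c\<bar> \<partial>\<nu>) = (\<integral>x. \<bar>c\<bar> * \<bar>indicator A x - g x\<bar> \<partial>\<nu>)"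
    by (intro Bochner_Integration.integral_cong refl) (simp add: abs_mult[symmetric] algebra_simps)
  also have "\<dots> = \<bar>c\<bar> * (\<integral>x. \<bar>indicator A x - g x\<bar> \<partial>\<nu>)" by simp
  also have "\<dots> \<le> \<bar>c\<bar> * (e / (\<bar>c\<bar> + 1))" using g(3) by (intro mult_left_mono) auto
  also have "\<dots> < e" using base by (simp add: field_simps)
  finally have "(\<integral>x. \<bar>indicator A x *\<^sub>R c - g x * c\<bar> \<partial>\<nu>) < e" .
  moreover have "integrable \<nu> (\<lambda>x. g x * c)"
    using g(2) by (intro integrable_mult_left integrable_const_bound[where B=1]) auto
  moreover have "continuous_on UNIV (\<lambda>x. g x * c)" by (intro continuous_intros g)
  ultimately show ?case by blast
next
  case (add f h)
  obtain g where g: "continuous_on UNIV g" "integrable \<nu> g" "(\<integral>x. \<bar>f x - g x\<bar> \<partial>\<nu>) < e/2"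
    using add.IH(1)[of "e/2"] add.prems by auto
  obtain k where k: "continuous_on UNIV k" "integrable \<nu> k" "(\<integral>x. \<bar>h x - k x\<bar> \<partial>\<nu>) < e/2"
    using add.IH(2)[of "e/2"] add.prems by auto
  have "(\<integral>x. \<bar>(f x + h x) - (g x + k x)\<bar> \<partial>\<nu>) \<le> (\<integral>x. \<bar>f x - g x\<bar> + \<bar>h x - k x\<bar> \<partial>\<nu>)"
    using add.hyps g k by (intro Bochner_Integration.integral_mono) auto
  also have "\<dots> = (\<integral>x. \<bar>f x - g x\<bar> \<partial>\<nu>) + (\<integral>x. \<bar>h x - k x\<bar> \<partial>\<nu>)"
    using add.hyps g k by (intro Bochner_Integration.integral_add) auto
  also have "\<dots> < e" using g k by linarith
  finally show ?case using g k by (intro exI[of _ "\<lambda>x. g x + k x"]) (auto intro!: continuous_intros)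
next
  case (lim f s)
  have fm[measurable]: "f \<in> borel_measurable \<nu>" "\<And>i. s i \<in> borel_measurable \<nu>" using lim by auto
  have "(\<lambda>i. \<integral>x. \<bar>f x - s i x\<bar> \<partial>\<nu>) \<longlonglongrightarrow> (\<integral>x. 0 \<partial>\<nu>)"
  proof (rule integral_dominated_convergence[where w="\<lambda>x. 3 * \<bar>f x\<bar>"])
    show "AE x in \<nu>. (\<lambda>i. \<bar>f x - s i x\<bar>) \<longlonglongrightarrow> 0"
      using lim.hyps(2) by (intro AE_I2) (auto intro!: tendsto_eq_intros)
    show "AE x in \<nu>. norm \<bar>f x - s i x\<bar> \<le> 3 * \<bar>f x\<bar>" for i
    proof (rule AE_I2)
      fix x assume "x \<in> space \<nu>"
      then show "norm \<bar>f x - s i x\<bar> \<le> 3 * \<bar>f x\<bar>" using lim.hyps(3)[of x i] by auto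
    qed
  qed (use lim in auto)
  then have "eventually (\<lambda>i. (\<integral>x. \<bar>f x - s i x\<bar> \<partial>\<nu>) < e/2) sequentially"
    using lim.prems by (intro order_tendstoD) auto
  then obtain i where i: "(\<integral>x. \<bar>f x - s i x\<bar> \<partial>\<nu>) < e/2" by (auto simp: eventually_sequentially)
  obtain g where g: "continuous_on UNIV g" "integrable \<nu> g" "(\<integral>x. \<bar>s i x - g x\<bar> \<partial>\<nu>) < e/2"
    using lim.IH[of "e/2" i] lim.prems by auto
  have "(\<integral>x. \<bar>f x - g x\<bar> \<partial>\<nu>) \<le> (\<integral>x. \<bar>f x - s i x\<bar> + \<bar>s i x - g x\<bar> \<partial>\<nu>)"
    using lim.hyps g by (intro Bochner_Integration.integral_mono) auto
  also have "\<dots> = (\<integral>x. \<bar>f x - s i x\<bar> \<partial>\<nu>) + (\<integral>x. \<bar>s i x - g x\<bar> \<partial>\<nu>)"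
    using lim.hyps g by (intro Bochner_Integration.integral_add) auto
  also have "\<dots> < e" using g i by linarith
  finally show ?case using g by blast
qed

text \<open>Continuous functions converge to f in L1, hence almost everywhere along a subsequence;
  replacing them by trigonometric polynomials with uniform error 1/(m+1) keeps the limit.\<close>

lemma real_trig_poly_approx_AE:
  fixes \<nu> :: "complex measure" and f :: "complex \<Rightarrow> real"
  assumes sets[measurable_cong]: "sets \<nu> = sets borel" and fin: "finite_measure \<nu>"
    and f[measurable]: "f \<in> borel_measurable borel" and C: "\<And>z. \<bar>f z\<bar> \<le> C"
  shows "\<exists>p. (\<forall>m. \<exists>n. real_trig_poly n (p m)) \<and> (\<forall>m. \<forall>z\<in>sphere 0 1. \<bar>p m z\<bar> \<le> C + 1) \<and>
    (AE z in \<nu>. z \<in> sphere 0 1 \<longrightarrow> (\<lambda>m. p m z) \<longlonglongrightarrow> f z)"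
proof -
  interpret finite_measure \<nu> by fact
  have intf: "integrable \<nu> f" using C by (intro integrable_const_bound[where B=C]) auto
  have "\<exists>g. continuous_on UNIV g \<and> integrable \<nu> g \<and> (\<integral>x. \<bar>f x - g x\<bar> \<partial>\<nu>) < 1 / real (Suc m)" for m
    by (rule integrable_approx_continuous[OF sets fin intf]) simp
  then obtain g where g: "\<And>m. continuous_on UNIV (g m)" "\<And>m. integrable \<nu> (g m)"
      "\<And>m. (\<integral>x. \<bar>f x - g m x\<bar> \<partial>\<nu>) < 1 / real (Suc m)" by metis
  have "(\<lambda>m. \<integral>x. norm (f x - g m x) \<partial>\<nu>) \<longlonglongrightarrow> 0"
  proof (rule tendsto_sandwich[OF _ _ tendsto_const LIMSEQ_inverse_real_of_nat])
    show "\<forall>\<^sub>F m in sequentially. (\<integral>x. norm (f x - g m x) \<partial>\<nu>) \<le> inverse (real (Suc m))"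
      using g(3) by (intro always_eventually allI) (simp add: inverse_eq_divide less_imp_le)
  qed simp
  from tendsto_L1_AE_subseq[OF _ this] obtain r where
    r: "AE x in \<nu>. (\<lambda>m. f x - g (r m) x) \<longlonglongrightarrow> 0" using g(2) intf by auto
  \<comment> \<open>Clipping to [-C, C] never increases the distance to f, and it supplies the
    uniform bound that dominated convergence will use.\<close>
  define h where "h m x = max (- C) (min C (g (r m) x))" for m x
  have "continuous_on (sphere 0 1) (h m)" for m
    unfolding h_def using continuous_on_subset[OF g(1)[of "r m"]] by (intro continuous_intros) auto
  then have "\<exists>n p. real_trig_poly n p \<and> (\<forall>z\<in>sphere 0 1. \<bar>h m z - p z\<bar> < inverse (real (Suc m)))" for m
    by (intro real_trig_poly_dense_continuous) simp_all
  then obtain p where p: "\<And>m. \<exists>n. real_trig_poly n (p m)"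
      "\<And>m z. z \<in> sphere 0 1 \<Longrightarrow> \<bar>h m z - p m z\<bar> < inverse (real (Suc m))" by metis
  have C0: "C \<ge> 0" using C[of 0] by linarith
  have "\<bar>p m z\<bar> \<le> C + 1" if "z \<in> sphere 0 1" for m z
  proof -
    have "\<bar>h m z\<bar> \<le> C" using C0 by (auto simp: h_def)
    moreover have "inverse (real (Suc m)) \<le> 1" by (simp add: field_simps)
    ultimately show ?thesis using p(2)[OF that, of m] by linarith
  qed
  moreover have "AE z in \<nu>. z \<in> sphere 0 1 \<longrightarrow> (\<lambda>m. p m z) \<longlonglongrightarrow> f z"
    using r
  proof eventually_elim
    case (elim z)
    show ?case
    proof
      assume z: "z \<in> sphere 0 1"
      have lim: "(\<lambda>m. inverse (real (Suc m)) + \<bar>f z - g (r m) z\<bar>) \<longlonglongrightarrow> 0 + \<bar>0\<bar>"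
        by (intro tendsto_add LIMSEQ_inverse_real_of_nat tendsto_rabs elim)
      have le: "norm (p m z - f z) \<le> inverse (real (Suc m)) + \<bar>f z - g (r m) z\<bar>" for m
      proof -
        have "\<bar>f z - h m z\<bar> \<le> \<bar>f z - g (r m) z\<bar>" using C[of z] by (auto simp: h_def)
        then show ?thesis using p(2)[OF z, of m] unfolding real_norm_def by linarith
      qed
      have "(\<lambda>m. p m z - f z) \<longlonglongrightarrow> 0"
        by (rule Lim_null_comparison[OF always_eventually]) (use le lim in \<open>simp_all only: abs_zero add_0_right simp_thms\<close>)
      then show "(\<lambda>m. p m z) \<longlonglongrightarrow> f z" by (simp add: LIM_zero_iff)
    qed
  qed
  ultimately show ?thesis using p(1) by blast
qed

section \<open>Integration against a matrix measure\<close>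

lemma bounded_linear_herm_form: "bounded_linear (herm_form \<xi>)"
proof -
  have "linear (herm_form \<xi>)"
    by (rule linearI) (simp_all only: herm_form_add herm_form_scaleR scaleR_conv_of_real[of _ "herm_form _ _"])
  then show ?thesis by (simp add: linear_conv_bounded_linear)
qed

lemma bounded_linear_Re_herm_form: "bounded_linear (\<lambda>B. Re (herm_form \<xi> B))"
  using bounded_linear_compose[OF bounded_linear_Re bounded_linear_herm_form] .

lemma space_circle: "\<Union>circle_sets = sphere 0 1" "circle_sets \<subseteq> Pow (sphere 0 1)"
  unfolding circle_sets_def
  by (auto simp: sets_restrict_space space_restrict_space)

lemma sigma_algebra_circle_sets: "sigma_algebra (sphere 0 1) circle_sets"
  unfolding circle_sets_def
  using sets.sigma_algebra_axioms[of "restrict_space borel (sphere 0 1 :: complex set)"]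
  by (simp add: space_restrict_space)

lemma circle_sets_iff: "A \<in> circle_sets \<longleftrightarrow> A \<subseteq> sphere 0 1 \<and> A \<in> sets borel"
proof -
  have "(sphere 0 1 :: complex set) \<in> sets borel" by (intro borel_closed) simp
  then show ?thesis unfolding circle_sets_def by (simp add: sets_restrict_space_iff)
qed

lemma sets_form_measure [simp]: "sets (form_measure M \<xi>) = circle_sets"
  unfolding form_measure_def using sigma_algebra.sets_measure_of_eq[OF sigma_algebra_circle_sets] by simp

lemma space_form_measure [simp]: "space (form_measure M \<xi>) = sphere 0 1"
  unfolding form_measure_def using space_circle by (simp add: space_measure_of)

lemma sets_form_measure_cong [measurable_cong]:
  "sets (form_measure M \<xi>) = sets (restrict_space borel (sphere 0 1))"
  by (simp add: circle_sets_def)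

lemma psd_matrix_measure_nonneg: "psd_matrix_measure M \<Longrightarrow> A \<in> circle_sets \<Longrightarrow> Re (herm_form \<xi> (M A)) \<ge> 0"
  unfolding psd_matrix_measure_def psd_matrix_def by (auto simp: complex_nonneg_Reals_iff)

text \<open>\<open>measure_of\<close> takes the intended values only once the set function is known
  to be positive and countably additive; the latter follows because the form is a bounded linear
  function of the matrix.\<close>

lemma emeasure_form_measure:
  assumes M: "psd_matrix_measure M" and A: "A \<in> circle_sets"
  shows "emeasure (form_measure M \<xi>) A = ennreal (Re (herm_form \<xi> (M A)))"
proof (rule emeasure_measure_of[OF form_measure_def])
  show "circle_sets \<subseteq> Pow (sphere 0 1)" by (rule space_circle)
  show "A \<in> sets (form_measure M \<xi>)" using A by simp
  have sums: "(\<lambda>n. M (S n)) sums M (\<Union>n. S n)" if "range S \<subseteq> circle_sets" "disjoint_family S" for S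
    using M that unfolding psd_matrix_measure_def by blast
  \<comment> \<open>M {} = 0 is extracted from additivity over copies of the empty set: a convergent
    series with constant terms has terms 0.\<close>
  have "{} \<in> circle_sets" by (simp add: circle_sets_iff)
  then have "(\<lambda>n::nat. M {}) sums M {}" using sums[of "\<lambda>_. {}"] by (simp add: disjoint_family_on_def)
  then have "(\<lambda>n::nat. M {}) \<longlonglongrightarrow> 0" by (intro summable_LIMSEQ_zero sums_summable)
  then have "M {} = 0" using LIMSEQ_unique tendsto_const by blast
  then show "positive (sets (form_measure M \<xi>)) (\<lambda>A. ennreal (Re (herm_form \<xi> (M A))))"
    by (simp add: positive_def linear_0[OF bounded_linear.linear[OF bounded_linear_herm_form]])
  show "countably_additive (sets (form_measure M \<xi>)) (\<lambda>A. ennreal (Re (herm_form \<xi> (M A))))"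
  proof (rule countably_additiveI)
    fix S :: "nat \<Rightarrow> complex set"
    assume S: "range S \<subseteq> sets (form_measure M \<xi>)" "disjoint_family S"
    have "(\<lambda>n. Re (herm_form \<xi> (M (S n)))) sums Re (herm_form \<xi> (M (\<Union>n. S n)))"
      using S by (intro bounded_linear.sums[OF bounded_linear_Re_herm_form] sums) auto
    then show "(\<Sum>n. ennreal (Re (herm_form \<xi> (M (S n))))) = ennreal (Re (herm_form \<xi> (M (\<Union>n. S n))))"
      using S by (intro suminf_ennreal_eq psd_matrix_measure_nonneg[OF M]) auto
  qed
qed

lemma finite_measure_form_measure:
  assumes "psd_matrix_measure M"
  shows "finite_measure (form_measure M \<xi>)"
proof (rule finite_measureI)
  have "sphere 0 1 \<in> circle_sets" by (simp add: circle_sets_iff borel_closed)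
  from emeasure_form_measure[OF assms this, of \<xi>]
  show "emeasure (form_measure M \<xi>) (space (form_measure M \<xi>)) \<noteq> \<infinity>" by simp
qed

lemma integrable_form_measure_bounded:
  fixes g :: "complex \<Rightarrow> 'a::{banach,second_countable_topology}"
  assumes M: "psd_matrix_measure M" and g: "g \<in> borel_measurable (restrict_space borel (sphere 0 1))"
    and B: "\<And>z. norm z = 1 \<Longrightarrow> norm (g z) \<le> B"
  shows "integrable (form_measure M \<xi>) g"
proof -
  interpret finite_measure "form_measure M \<xi>" by (rule finite_measure_form_measure[OF M])
  show ?thesis
  proof (rule integrable_const_bound[where B=B])
    show "AE z in form_measure M \<xi>. norm (g z) \<le> B" by (rule AE_I2) (use B in auto)
    show "g \<in> borel_measurable (form_measure M \<xi>)"
      using g by (simp cong: measurable_cong_sets)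
  qed
qed

text \<open>
  Polarization: \<open>polar I x y\<close> is \<open>\<integral> (x, y)\<^sup>* dM (x, y)\<close> when \<open>I \<xi> g\<close> is \<open>\<integral> g d(\<xi>\<^sup>* M \<xi>)\<close>.
\<close>

definition polar :: "(complex^2 \<Rightarrow> (complex \<Rightarrow> real) \<Rightarrow> real) \<Rightarrow> (complex \<Rightarrow> complex) \<Rightarrow> (complex \<Rightarrow> complex) \<Rightarrow> real" where
  "polar I x y = (let h = (\<lambda>z. Re (cnj (x z) * y z)); k = (\<lambda>z. Im (cnj (x z) * y z));
       e1 = vector [1, 0]; e2 = vector [0, 1]; e3 = vector [1, 1]; e4 = vector [1, \<i>] in
     I e1 (\<lambda>z. (norm (x z))\<^sup>2) + I e2 (\<lambda>z. (norm (y z))\<^sup>2)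
     + (I e3 h - I e1 h - I e2 h) + (I e4 k - I e1 k - I e2 k))"

text \<open>With integration replaced by evaluation at 0 of constant functions, \<open>polar\<close>
  becomes the pointwise polarization identity, which \<open>polar_angle\<close> then
  integrates.\<close>

lemma Re_herm_form_polar:
  "Re (herm_form (vector [x, y]) B) = polar (\<lambda>\<xi> g. g 0 * Re (herm_form \<xi> B)) (\<lambda>_. x) (\<lambda>_. y)"
  by (simp add: polar_def Let_def herm_form_vec cmod_power2) (simp add: power2_eq_square algebra_simps)

lemma polar_cong:
  assumes "\<And>\<xi>. I \<xi> (\<lambda>z. (norm (x z))\<^sup>2) = J \<xi> (\<lambda>z. (norm (x z))\<^sup>2)"
    and "\<And>\<xi>. I \<xi> (\<lambda>z. (norm (y z))\<^sup>2) = J \<xi> (\<lambda>z. (norm (y z))\<^sup>2)"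
    and "\<And>\<xi>. I \<xi> (\<lambda>z. Re (cnj (x z) * y z)) = J \<xi> (\<lambda>z. Re (cnj (x z) * y z))"
    and "\<And>\<xi>. I \<xi> (\<lambda>z. Im (cnj (x z) * y z)) = J \<xi> (\<lambda>z. Im (cnj (x z) * y z))"
  shows "polar I x y = polar J x y"
  unfolding polar_def Let_def assms ..

lemma integrable_angle_mult_bounded:
  fixes h :: "real \<Rightarrow> real"
  assumes "integrable angle_measure h" "g \<in> borel_measurable borel" "\<And>t. \<bar>g t\<bar> \<le> B"
  shows "integrable angle_measure (\<lambda>t. g t * h t)"
proof (rule Bochner_Integration.integrable_bound[where f="\<lambda>t. B * h t"])
  show "AE t in angle_measure. norm (g t * h t) \<le> norm (B * h t)"
  proof (rule AE_I2)
    fix t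
    have "\<bar>g t\<bar> \<le> \<bar>B\<bar>" using assms(3)[of t] by linarith
    then show "norm (g t * h t) \<le> norm (B * h t)"
      unfolding real_norm_def abs_mult by (rule mult_right_mono) simp
  qed
qed (use assms in auto)

lemma cnj_borel_measurable [measurable]: "cnj \<in> borel_measurable borel"
  by (intro borel_measurable_continuous_onI continuous_intros)

lemma polar_angle:
  assumes w: "integrable angle_measure w"
    and [measurable]: "(\<lambda>t. x (cis t)) \<in> borel_measurable borel" "(\<lambda>t. y (cis t)) \<in> borel_measurable borel"
    and C: "\<And>t. norm (x (cis t)) \<le> C" "\<And>t. norm (y (cis t)) \<le> C"
  shows "integrable angle_measure (\<lambda>t. Re (herm_form (vector [x (cis t), y (cis t)]) (w t)))"
    and "polar (\<lambda>\<xi> g. \<integral>t. g (cis t) * Re (herm_form \<xi> (w t)) \<partial>angle_measure) x y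
      = (\<integral>t. Re (herm_form (vector [x (cis t), y (cis t)]) (w t)) \<partial>angle_measure)"
proof -
  have ih: "integrable angle_measure (\<lambda>t. Re (herm_form \<xi> (w t)))" for \<xi>
    by (rule integrable_bounded_linear[OF bounded_linear_Re_herm_form w])
  have C0: "C \<ge> 0" using C(1)[of 0] norm_ge_zero order_trans by blast
  have b: "\<bar>(norm (x (cis t)))\<^sup>2\<bar> \<le> C\<^sup>2" "\<bar>(norm (y (cis t)))\<^sup>2\<bar> \<le> C\<^sup>2" for t
    using C by (auto intro!: power_mono)
  have n: "norm (cnj (x (cis t)) * y (cis t)) \<le> C\<^sup>2" for t
    unfolding norm_mult power2_eq_square using C C0 by (intro mult_mono) auto
  have b': "\<bar>Re (cnj (x (cis t)) * y (cis t))\<bar> \<le> C\<^sup>2" "\<bar>Im (cnj (x (cis t)) * y (cis t))\<bar> \<le> C\<^sup>2" for t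
    using n abs_Re_le_cmod abs_Im_le_cmod order_trans by blast+
  have int1: "integrable angle_measure (\<lambda>t. (norm (x (cis t)))\<^sup>2 * Re (herm_form \<xi> (w t)))" for \<xi>
    by (rule integrable_angle_mult_bounded[OF ih _ b(1)]) measurable
  have int2: "integrable angle_measure (\<lambda>t. (norm (y (cis t)))\<^sup>2 * Re (herm_form \<xi> (w t)))" for \<xi>
    by (rule integrable_angle_mult_bounded[OF ih _ b(2)]) measurable
  have int3: "integrable angle_measure (\<lambda>t. Re (cnj (x (cis t)) * y (cis t)) * Re (herm_form \<xi> (w t)))" for \<xi>
    by (rule integrable_angle_mult_bounded[OF ih _ b'(1)]) measurable
  have int4: "integrable angle_measure (\<lambda>t. Im (cnj (x (cis t)) * y (cis t)) * Re (herm_form \<xi> (w t)))" for \<xi>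
    by (rule integrable_angle_mult_bounded[OF ih _ b'(2)]) measurable
  note int = int1 int2 int3 int4
  note eq = Re_herm_form_polar[of "x (cis t)" "y (cis t)" "w t" for t, unfolded polar_def Let_def]
  show "integrable angle_measure (\<lambda>t. Re (herm_form (vector [x (cis t), y (cis t)]) (w t)))"
    unfolding eq
    by (intro Bochner_Integration.integrable_add Bochner_Integration.integrable_diff int)
  show "polar (\<lambda>\<xi> g. \<integral>t. g (cis t) * Re (herm_form \<xi> (w t)) \<partial>angle_measure) x y
      = (\<integral>t. Re (herm_form (vector [x (cis t), y (cis t)]) (w t)) \<partial>angle_measure)"
    unfolding polar_def Let_def eq
    by (simp only: Bochner_Integration.integral_add Bochner_Integration.integral_diff int
      Bochner_Integration.integrable_add Bochner_Integration.integrable_diff)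
qed

definition form_integral :: "(complex set \<Rightarrow> complex^2^2) \<Rightarrow> complex^2 \<Rightarrow> (complex \<Rightarrow> real) \<Rightarrow> real" where
  "form_integral M \<xi> g = (\<integral>z. g z \<partial>form_measure M \<xi>)"

text \<open>Both sides are linear in g and agree on \<open>z powi k\<close> for |k| \<le> n by
  equality of moments, once the form of w is expanded into its entries.\<close>

lemma form_integral_trig_eq:
  fixes B :: "int \<Rightarrow> complex^2^2"
  assumes M: "\<And>k. has_matrix_integral M (\<lambda>z. z powi k) (B k)"
    and w: "integrable angle_measure w"
    and B: "\<And>k p q. \<bar>k\<bar> \<le> int n \<Longrightarrow> (\<integral>t. cis t powi k * w t $ p $ q \<partial>angle_measure) = B k $ p $ q"
    and g: "real_trig_poly n g"
  shows "form_integral M \<xi> g = (\<integral>t. g (cis t) * Re (herm_form \<xi> (w t)) \<partial>angle_measure)"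
proof -
  obtain a where a: "\<And>z. norm z = 1 \<Longrightarrow> complex_of_real (g z) = (\<Sum>k=- int n..int n. a k * z powi k)"
    using g unfolding trig_poly_def by blast
  have iM: "integrable (form_measure M \<xi>) (\<lambda>z. z powi k)" "herm_form \<xi> (B k) = (\<integral>z. z powi k \<partial>form_measure M \<xi>)" for k
    using M[of k] unfolding has_matrix_integral_def by blast+
  have iw: "integrable angle_measure (\<lambda>t. w t $ p $ q)" for p q
    by (rule integrable_bounded_linear[OF bounded_linear_compose[OF bounded_linear_vec_nth[of q]
          bounded_linear_vec_nth[of p]] w])
  have ipw: "integrable angle_measure (\<lambda>t. cis t powi k * w t $ p $ q)" for k p q
  proof (rule Bochner_Integration.integrable_bound[OF iw[of p q]])
    have [measurable]: "(\<lambda>t. cis t powi k) \<in> borel_measurable borel"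
      by (intro borel_measurable_continuous_onI continuous_on_cis_compose continuous_on_powi_sphere)
    have [measurable]: "(\<lambda>t. w t $ p $ q) \<in> borel_measurable borel"
      using borel_measurable_integrable[OF iw[of p q]] by simp
    show "(\<lambda>t. cis t powi k * w t $ p $ q) \<in> borel_measurable angle_measure" by measurable
  qed (simp add: norm_mult norm_power_int)
  have herm: "herm_form \<xi> C = (\<Sum>p\<in>UNIV. \<Sum>q\<in>UNIV. (cnj (\<xi> $ p) * \<xi> $ q) * C $ p $ q)" for C
    by (simp add: herm_form_def matrix_vector_mult_def sum_distrib_left mult_ac)
  have expand: "cis t powi k * herm_form \<xi> (w t)
    = (\<Sum>p\<in>UNIV. \<Sum>q\<in>UNIV. (cnj (\<xi> $ p) * \<xi> $ q) * (cis t powi k * w t $ p $ q))" for k t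
    unfolding herm sum_distrib_left by (intro sum.cong refl) (rule mult.left_commute)
  have ik: "integrable angle_measure (\<lambda>t. cis t powi k * herm_form \<xi> (w t))" for k
    unfolding expand by (intro Bochner_Integration.integrable_sum integrable_mult_right ipw)
  have k: "(\<integral>t. cis t powi k * herm_form \<xi> (w t) \<partial>angle_measure) = herm_form \<xi> (B k)"
    if "\<bar>k\<bar> \<le> int n" for k
    unfolding expand unfolding herm using ipw by (simp add: Bochner_Integration.integral_sum B[OF that])
  have "complex_of_real (form_integral M \<xi> g) = (\<integral>z. complex_of_real (g z) \<partial>form_measure M \<xi>)"
    by (simp add: form_integral_def)
  also have "\<dots> = (\<integral>z. (\<Sum>k=- int n..int n. a k * z powi k) \<partial>form_measure M \<xi>)"
    by (intro Bochner_Integration.integral_cong refl a) simp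
  also have "\<dots> = (\<Sum>k=- int n..int n. a k * herm_form \<xi> (B k))"
    using iM by (simp add: Bochner_Integration.integral_sum)
  also have "\<dots> = (\<Sum>k=- int n..int n. a k * (\<integral>t. cis t powi k * herm_form \<xi> (w t) \<partial>angle_measure))"
    by (intro sum.cong refl) (auto simp: k)
  also have "\<dots> = (\<integral>t. (\<Sum>k=- int n..int n. a k * (cis t powi k * herm_form \<xi> (w t))) \<partial>angle_measure)"
    using ik by (simp add: Bochner_Integration.integral_sum)
  also have "\<dots> = (\<integral>t. complex_of_real (g (cis t)) * herm_form \<xi> (w t) \<partial>angle_measure)"
    by (intro Bochner_Integration.integral_cong refl) (simp add: a sum_distrib_right mult.assoc)
  finally have eq: "complex_of_real (form_integral M \<xi> g) = \<dots>" .
  have "(\<lambda>t. complex_of_real (g (cis t)) * herm_form \<xi> (w t))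
    = (\<lambda>t. \<Sum>k=- int n..int n. a k * (cis t powi k * herm_form \<xi> (w t)))"
    by (simp add: a sum_distrib_right mult.assoc)
  then have "integrable angle_measure (\<lambda>t. complex_of_real (g (cis t)) * herm_form \<xi> (w t))"
    using ik by simp
  from integral_Re[OF this] arg_cong[OF eq, of Re] show ?thesis by simp
qed

lemma trig_poly_quadratic:
  assumes "trig_poly n x" "trig_poly n y"
  shows "real_trig_poly (n + n) (\<lambda>z. (norm (x z))\<^sup>2)"
    "real_trig_poly (n + n) (\<lambda>z. Re (cnj (x z) * y z))" "real_trig_poly (n + n) (\<lambda>z. Im (cnj (x z) * y z))"
proof -
  have "trig_poly (n + n) (\<lambda>z. cnj (x z) * x z)" by (intro trig_poly_mult trig_poly_cnj assms)
  then show "real_trig_poly (n + n) (\<lambda>z. (norm (x z))\<^sup>2)"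
    by (rule trig_poly_congI) (simp only: complex_norm_square mult.commute)
  have xy: "trig_poly (n + n) (\<lambda>z. cnj (x z) * y z)" by (intro trig_poly_mult trig_poly_cnj assms)
  show "real_trig_poly (n + n) (\<lambda>z. Re (cnj (x z) * y z))" by (rule real_trig_poly_Re[OF xy])
  show "real_trig_poly (n + n) (\<lambda>z. Im (cnj (x z) * y z))" by (rule real_trig_poly_Im[OF xy])
qed

section \<open>Simultaneous approximation for several measures\<close>

text \<open>A null set of a sum of measures is null for each summand. One approximating sequence can
  then converge almost everywhere for all of them at once.\<close>

lemma ex_dominating_measure:
  fixes F :: "complex measure set"
  assumes "finite F" "\<And>\<mu>. \<mu> \<in> F \<Longrightarrow> sets \<mu> = sets borel" "\<And>\<mu>. \<mu> \<in> F \<Longrightarrow> finite_measure \<mu>"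
  shows "\<exists>\<nu>. sets \<nu> = sets borel \<and> finite_measure \<nu> \<and> (\<forall>\<mu>\<in>F. null_sets \<nu> \<subseteq> null_sets \<mu>)"
  using assms
proof (induction F rule: finite_induct)
  case empty
  have "finite_measure (null_measure (borel :: complex measure))" by (rule finite_measureI) simp
  then show ?case by (intro exI[of _ "null_measure borel"]) simp
next
  case (insert \<mu> F)
  then obtain \<nu> where \<nu>: "sets \<nu> = sets borel" "finite_measure \<nu>" "\<forall>\<mu>\<in>F. null_sets \<nu> \<subseteq> null_sets \<mu>"
    by blast
  have \<mu>: "sets \<mu> = sets borel" "finite_measure \<mu>" using insert.prems by auto
  define \<rho> where "\<rho> = measure_of (UNIV :: complex set) (sets borel) (\<lambda>A. emeasure \<mu> A + emeasure \<nu> A)"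
  have sets: "sets \<rho> = sets borel"
    unfolding \<rho>_def using sets.sets_measure_of_eq[of borel] by (simp add: space_borel)
  have em: "emeasure \<rho> A = emeasure \<mu> A + emeasure \<nu> A" if "A \<in> sets borel" for A
  proof (rule emeasure_measure_of[OF \<rho>_def])
    show "sets borel \<subseteq> Pow (UNIV :: complex set)" by simp
    show "A \<in> sets \<rho>" using that sets by simp
    show "positive (sets \<rho>) (\<lambda>A. emeasure \<mu> A + emeasure \<nu> A)" by (simp add: positive_def)
    show "countably_additive (sets \<rho>) (\<lambda>A. emeasure \<mu> A + emeasure \<nu> A)"
    proof (rule countably_additiveI)
      fix S :: "nat \<Rightarrow> complex set"
      assume S: "range S \<subseteq> sets \<rho>" "disjoint_family S"
      then have "range S \<subseteq> sets \<mu>" "range S \<subseteq> sets \<nu>" using sets \<mu> \<nu> by auto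
      with S(2) show "(\<Sum>i. emeasure \<mu> (S i) + emeasure \<nu> (S i)) = emeasure \<mu> (\<Union>i. S i) + emeasure \<nu> (\<Union>i. S i)"
        by (simp add: suminf_add[symmetric] suminf_emeasure)
    qed
  qed
  have "finite_measure \<rho>"
  proof (rule finite_measureI)
    have "emeasure \<mu> UNIV \<noteq> \<infinity>" "emeasure \<nu> UNIV \<noteq> \<infinity>"
      using finite_measure.emeasure_finite[OF \<mu>(2)] finite_measure.emeasure_finite[OF \<nu>(2)] by simp_all
    then show "emeasure \<rho> (space \<rho>) \<noteq> \<infinity>"
      using sets_eq_imp_space_eq[OF sets] em[of UNIV] by simp
  qed
  moreover have "null_sets \<rho> \<subseteq> null_sets \<mu>" "null_sets \<rho> \<subseteq> null_sets \<nu>"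
    using em sets \<mu>(1) \<nu>(1) by (auto simp: null_sets_def)
  ultimately have "null_sets \<rho> \<subseteq> null_sets \<mu>'" if "\<mu>' \<in> insert \<mu> F" for \<mu>'
    using that \<nu>(3) by blast
  then show ?case using sets \<open>finite_measure \<rho>\<close> by blast
qed

lemma AE_null_sets_mono: "null_sets \<nu> \<subseteq> null_sets \<mu> \<Longrightarrow> space \<nu> = space \<mu> \<Longrightarrow> AE x in \<nu>. P x \<Longrightarrow> AE x in \<mu>. P x"
  unfolding eventually_ae_filter by blast

lemma trig_poly_approx_AE:
  fixes F :: "complex measure set" and x :: "complex \<Rightarrow> complex"
  assumes "finite F" and F: "\<And>\<mu>. \<mu> \<in> F \<Longrightarrow> sets \<mu> = sets borel" "\<And>\<mu>. \<mu> \<in> F \<Longrightarrow> finite_measure \<mu>"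
    and [measurable]: "x \<in> borel_measurable borel" and C: "\<And>z. norm (x z) \<le> C"
  shows "\<exists>p. (\<forall>m. \<exists>n. trig_poly n (p m)) \<and> (\<forall>m. \<forall>z\<in>sphere 0 1. norm (p m z) \<le> 2 * C + 2) \<and>
    (\<forall>\<mu>\<in>F. AE z in \<mu>. z \<in> sphere 0 1 \<longrightarrow> (\<lambda>m. p m z) \<longlonglongrightarrow> x z)"
proof -
  obtain \<nu> where \<nu>: "sets \<nu> = sets borel" "finite_measure \<nu>" "\<And>\<mu>. \<mu> \<in> F \<Longrightarrow> null_sets \<nu> \<subseteq> null_sets \<mu>"
    using ex_dominating_measure[OF assms(1) F] by blast
  have b: "\<bar>Re (x z)\<bar> \<le> C" "\<bar>Im (x z)\<bar> \<le> C" for z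
    using C[of z] abs_Re_le_cmod[of "x z"] abs_Im_le_cmod[of "x z"] by linarith+
  have mr: "(\<lambda>z. Re (x z)) \<in> borel_measurable borel" "(\<lambda>z. Im (x z)) \<in> borel_measurable borel"
    by measurable
  obtain p where p: "\<forall>m. \<exists>n. real_trig_poly n (p m)" "\<forall>m. \<forall>z\<in>sphere 0 1. \<bar>p m z\<bar> \<le> C + 1"
      "AE z in \<nu>. z \<in> sphere 0 1 \<longrightarrow> (\<lambda>m. p m z) \<longlonglongrightarrow> Re (x z)"
    using real_trig_poly_approx_AE[OF \<nu>(1,2) mr(1) b(1)] by blast
  obtain q where q: "\<forall>m. \<exists>n. real_trig_poly n (q m)" "\<forall>m. \<forall>z\<in>sphere 0 1. \<bar>q m z\<bar> \<le> C + 1"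
      "AE z in \<nu>. z \<in> sphere 0 1 \<longrightarrow> (\<lambda>m. q m z) \<longlonglongrightarrow> Im (x z)"
    using real_trig_poly_approx_AE[OF \<nu>(1,2) mr(2) b(2)] by blast
  define r where "r m z = complex_of_real (p m z) + \<i> * complex_of_real (q m z)" for m z
  have "\<exists>n. trig_poly n (r m)" for m
  proof -
    obtain n1 n2 where n: "real_trig_poly n1 (p m)" "real_trig_poly n2 (q m)" using p(1) q(1) by blast
    have "trig_poly (max n1 n2) (r m)" unfolding r_def
      by (rule trig_poly_add[OF _ trig_poly_cmult]) (rule trig_poly_mono[OF n(1)] trig_poly_mono[OF n(2)], simp)+
    then show ?thesis by blast
  qed
  \<comment> \<open>The real and the imaginary part contribute at most C + 1 each.\<close>
  moreover have "norm (r m z) \<le> 2 * C + 2" if "z \<in> sphere 0 1" for m z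
  proof -
    have "norm (r m z) \<le> norm (complex_of_real (p m z)) + norm (\<i> * complex_of_real (q m z))"
      unfolding r_def by (rule norm_triangle_ineq)
    then show ?thesis using p(2)[rule_format, OF that, of m] q(2)[rule_format, OF that, of m] by (simp add: norm_mult)
  qed
  moreover have AEr: "AE z in \<nu>. z \<in> sphere 0 1 \<longrightarrow> (\<lambda>m. r m z) \<longlonglongrightarrow> x z"
    using p(3) q(3)
  proof eventually_elim
    case (elim z)
    show ?case
    proof
      assume "z \<in> sphere 0 1"
      then have "(\<lambda>m. r m z) \<longlonglongrightarrow> complex_of_real (Re (x z)) + \<i> * complex_of_real (Im (x z))"
        unfolding r_def using elim by (intro tendsto_intros) auto
      then show "(\<lambda>m. r m z) \<longlonglongrightarrow> x z" by (simp only: complex_eq[of "x z", symmetric])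
    qed
  qed
  moreover have "AE z in \<mu>. z \<in> sphere 0 1 \<longrightarrow> (\<lambda>m. r m z) \<longlonglongrightarrow> x z" if "\<mu> \<in> F" for \<mu>
  proof (rule AE_null_sets_mono[OF \<nu>(3)[OF that] _ AEr])
    show "space \<nu> = space \<mu>" using \<nu>(1) F(1)[OF that] by (intro sets_eq_imp_space_eq) simp
  qed
  ultimately show ?thesis by blast
qed

lemma id_measurable_form_measure [measurable]: "(\<lambda>z. z) \<in> borel_measurable (form_measure M \<xi>)"
  unfolding measurable_cong_sets[OF sets_form_measure_cong refl]
  by (rule measurable_restrict_space1) simp

text \<open>The same sequence has to converge for the angle, over which ln det G is integrated, and
  for the form measures inside \<open>polar\<close>. All are pushed forward to Borel measures on the
  plane and treated together.\<close>

lemma trig_poly_approx_circle: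
  assumes M: "psd_matrix_measure M" and x[measurable]: "x \<in> borel_measurable borel" and C: "\<And>z. norm (x z) \<le> C"
    and \<Xi>: "finite \<Xi>"
  shows "\<exists>p. (\<forall>m. \<exists>n. trig_poly n (p m)) \<and> (\<forall>m z. norm z = 1 \<longrightarrow> norm (p m z) \<le> 2 * C + 2) \<and>
    (AE t in angle_measure. (\<lambda>m. p m (cis t)) \<longlonglongrightarrow> x (cis t)) \<and>
    (\<forall>\<xi>\<in>\<Xi>. AE z in form_measure M \<xi>. (\<lambda>m. p m z) \<longlonglongrightarrow> x z)"
proof -
  let ?F = "insert (distr angle_measure borel cis) ((\<lambda>\<xi>. distr (form_measure M \<xi>) borel (\<lambda>z. z)) ` \<Xi>)"
  have fin: "finite_measure \<mu>" if "\<mu> \<in> ?F" for \<mu>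
    using that by (auto intro!: finite_measure.finite_measure_distr angle.finite_measure_axioms
        finite_measure_form_measure M)
  have sets: "sets \<mu> = sets borel" if "\<mu> \<in> ?F" for \<mu> using that by auto
  have "finite ?F" using \<Xi> by simp
  from trig_poly_approx_AE[OF this sets fin x C]
  obtain p where p: "\<And>m. \<exists>n. trig_poly n (p m)" "\<And>m z. z \<in> sphere 0 1 \<Longrightarrow> norm (p m z) \<le> 2 * C + 2"
    "\<And>\<mu>. \<mu> \<in> ?F \<Longrightarrow> AE z in \<mu>. z \<in> sphere 0 1 \<longrightarrow> (\<lambda>m. p m z) \<longlonglongrightarrow> x z"
    by blast
  have "AE t in angle_measure. cis t \<in> sphere 0 1 \<longrightarrow> (\<lambda>m. p m (cis t)) \<longlonglongrightarrow> x (cis t)"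
    by (rule AE_distrD[OF _ p(3)]) auto
  then have a1: "AE t in angle_measure. (\<lambda>m. p m (cis t)) \<longlonglongrightarrow> x (cis t)" by simp
  have a2: "AE z in form_measure M \<xi>. (\<lambda>m. p m z) \<longlonglongrightarrow> x z" if "\<xi> \<in> \<Xi>" for \<xi>
  proof -
    have "AE z in form_measure M \<xi>. z \<in> sphere 0 1 \<longrightarrow> (\<lambda>m. p m z) \<longlonglongrightarrow> x z"
      by (rule AE_distrD[OF _ p(3)]) (use that in auto)
    then show ?thesis by (rule AE_mp) (intro AE_I2, simp)
  qed
  have b: "norm (p m z) \<le> 2 * C + 2" if "norm z = 1" for m z using p(2)[of z m] that by simp
  show ?thesis
    by (intro exI[of _ p] conjI allI impI ballI p(1) b a1 a2)
qed

lemma form_integral_limit: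
  assumes M: "psd_matrix_measure M"
    and gm: "\<And>m. continuous_on (sphere 0 1) (g m)" and B: "\<And>m z. norm z = 1 \<Longrightarrow> \<bar>g m z\<bar> \<le> B"
    and g: "g' \<in> borel_measurable borel" and lim: "AE z in form_measure M \<xi>. (\<lambda>m. g m z) \<longlonglongrightarrow> g' z"
  shows "(\<lambda>m. form_integral M \<xi> (g m)) \<longlonglongrightarrow> form_integral M \<xi> g'"
  unfolding form_integral_def
proof (rule integral_dominated_convergence[where w="\<lambda>_. B"])
  interpret finite_measure "form_measure M \<xi>" by (rule finite_measure_form_measure[OF M])
  show "integrable (form_measure M \<xi>) (\<lambda>_. B)" by simp
  show "g' \<in> borel_measurable (form_measure M \<xi>)"
    using measurable_restrict_space1[OF g] by (simp cong: measurable_cong_sets)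
  show "g m \<in> borel_measurable (form_measure M \<xi>)" for m
    using borel_measurable_continuous_on_restrict[OF gm[of m]] by (simp cong: measurable_cong_sets)
  show "AE z in form_measure M \<xi>. norm (g m z) \<le> B" for m
    by (rule AE_I2) (use B in auto)
qed (rule lim)

abbreviation polar_vectors :: "(complex^2) set" where
  "polar_vectors \<equiv> {vector [1, 0], vector [0, 1], vector [1, 1], vector [1, \<i>]}"

lemma polar_form_integral_limit:
  assumes M: "psd_matrix_measure M"
    and p: "\<And>m. \<exists>n. trig_poly n (p m)" "\<And>m. \<exists>n. trig_poly n (q m)"
    and B: "\<And>m z. norm z = 1 \<Longrightarrow> norm (p m z) \<le> B" "\<And>m z. norm z = 1 \<Longrightarrow> norm (q m z) \<le> B"
    and [measurable]: "x \<in> borel_measurable borel" "y \<in> borel_measurable borel"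
    and lim: "\<And>\<xi>. \<xi> \<in> polar_vectors \<Longrightarrow> AE z in form_measure M \<xi>. (\<lambda>m. p m z) \<longlonglongrightarrow> x z"
      "\<And>\<xi>. \<xi> \<in> polar_vectors \<Longrightarrow> AE z in form_measure M \<xi>. (\<lambda>m. q m z) \<longlonglongrightarrow> y z"
  shows "(\<lambda>m. polar (form_integral M) (p m) (q m)) \<longlonglongrightarrow> polar (form_integral M) x y"
proof -
  have c: "continuous_on (sphere 0 1) (p m)" "continuous_on (sphere 0 1) (q m)" for m
    using p trig_poly_continuous by blast+
  have B0: "B \<ge> 0" using order_trans[OF norm_ge_zero B(1)[where z=1 and m=0]] by simp
  have n: "norm (cnj (p m z) * q m z) \<le> B\<^sup>2" if "norm z = 1" for m z
    unfolding norm_mult power2_eq_square using B[OF that] B0 by (intro mult_mono) auto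
  have 1: "(\<lambda>m. form_integral M \<xi> (\<lambda>z. (norm (p m z))\<^sup>2)) \<longlonglongrightarrow> form_integral M \<xi> (\<lambda>z. (norm (x z))\<^sup>2)"
    if "\<xi> \<in> polar_vectors" for \<xi>
  proof (rule form_integral_limit[OF M, where B="B\<^sup>2"])
    show "\<bar>(norm (p m z))\<^sup>2\<bar> \<le> B\<^sup>2" if "norm z = 1" for m z
      using power_mono[OF B(1)[OF that, of m] norm_ge_zero, of 2] by simp
    show "AE z in form_measure M \<xi>. (\<lambda>m. (norm (p m z))\<^sup>2) \<longlonglongrightarrow> (norm (x z))\<^sup>2"
      using lim(1)[OF that] by eventually_elim (intro tendsto_intros)
    show "continuous_on (sphere 0 1) (\<lambda>z. (norm (p m z))\<^sup>2)" for m by (intro continuous_intros c)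
  qed measurable
  have 2: "(\<lambda>m. form_integral M \<xi> (\<lambda>z. (norm (q m z))\<^sup>2)) \<longlonglongrightarrow> form_integral M \<xi> (\<lambda>z. (norm (y z))\<^sup>2)"
    if "\<xi> \<in> polar_vectors" for \<xi>
  proof (rule form_integral_limit[OF M, where B="B\<^sup>2"])
    show "\<bar>(norm (q m z))\<^sup>2\<bar> \<le> B\<^sup>2" if "norm z = 1" for m z
      using power_mono[OF B(2)[OF that, of m] norm_ge_zero, of 2] by simp
    show "AE z in form_measure M \<xi>. (\<lambda>m. (norm (q m z))\<^sup>2) \<longlonglongrightarrow> (norm (y z))\<^sup>2"
      using lim(2)[OF that] by eventually_elim (intro tendsto_intros)
    show "continuous_on (sphere 0 1) (\<lambda>z. (norm (q m z))\<^sup>2)" for m by (intro continuous_intros c)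
  qed measurable
  have AE: "AE z in form_measure M \<xi>. (\<lambda>m. cnj (p m z) * q m z) \<longlonglongrightarrow> cnj (x z) * y z"
    if "\<xi> \<in> polar_vectors" for \<xi>
    using lim(1)[OF that] lim(2)[OF that] by eventually_elim (intro tendsto_intros)
  have 3: "(\<lambda>m. form_integral M \<xi> (\<lambda>z. Re (cnj (p m z) * q m z))) \<longlonglongrightarrow> form_integral M \<xi> (\<lambda>z. Re (cnj (x z) * y z))"
    if "\<xi> \<in> polar_vectors" for \<xi>
  proof (rule form_integral_limit[OF M, where B="B\<^sup>2"])
    show "\<bar>Re (cnj (p m z) * q m z)\<bar> \<le> B\<^sup>2" if "norm z = 1" for m z
      using n[OF that] abs_Re_le_cmod order_trans by blast
    show "AE z in form_measure M \<xi>. (\<lambda>m. Re (cnj (p m z) * q m z)) \<longlonglongrightarrow> Re (cnj (x z) * y z)"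
      using AE[OF that] by eventually_elim (rule tendsto_Re)
    show "continuous_on (sphere 0 1) (\<lambda>z. Re (cnj (p m z) * q m z))" for m by (intro continuous_intros c)
  qed measurable
  have 4: "(\<lambda>m. form_integral M \<xi> (\<lambda>z. Im (cnj (p m z) * q m z))) \<longlonglongrightarrow> form_integral M \<xi> (\<lambda>z. Im (cnj (x z) * y z))"
    if "\<xi> \<in> polar_vectors" for \<xi>
  proof (rule form_integral_limit[OF M, where B="B\<^sup>2"])
    show "\<bar>Im (cnj (p m z) * q m z)\<bar> \<le> B\<^sup>2" if "norm z = 1" for m z
      using n[OF that] abs_Im_le_cmod order_trans by blast
    show "AE z in form_measure M \<xi>. (\<lambda>m. Im (cnj (p m z) * q m z)) \<longlonglongrightarrow> Im (cnj (x z) * y z)"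
      using AE[OF that] by eventually_elim (rule tendsto_Im)
    show "continuous_on (sphere 0 1) (\<lambda>z. Im (cnj (p m z) * q m z))" for m by (intro continuous_intros c)
  qed measurable
  show ?thesis unfolding polar_def Let_def
    by (intro tendsto_add tendsto_diff 1 2 3 4) auto
qed

text \<open>\<open>polar\<close> contains terms of both signs, so positivity of the individual form
  measures does not show the claim; it passes to the limit from trigonometric polynomials, for which
  \<open>polar_trig_nonneg\<close> will supply it.\<close>

lemma polar_form_integral_nonneg:
  assumes M: "psd_matrix_measure M"
    and trig: "\<And>n p q. trig_poly n p \<Longrightarrow> trig_poly n q \<Longrightarrow> polar (form_integral M) p q \<ge> 0"
    and x[measurable]: "x \<in> borel_measurable borel" and y[measurable]: "y \<in> borel_measurable borel"
    and C: "\<And>z. norm (x z) \<le> C" "\<And>z. norm (y z) \<le> C"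
  shows "polar (form_integral M) x y \<ge> 0"
proof -
  have fin: "finite polar_vectors" by simp
  obtain p where p: "\<And>m. \<exists>n. trig_poly n (p m)" "\<And>m z. norm z = 1 \<Longrightarrow> norm (p m z) \<le> 2 * C + 2"
    "\<And>\<xi>. \<xi> \<in> polar_vectors \<Longrightarrow> AE z in form_measure M \<xi>. (\<lambda>m. p m z) \<longlonglongrightarrow> x z"
    using trig_poly_approx_circle[OF M x C(1) fin] by blast
  obtain q where q: "\<And>m. \<exists>n. trig_poly n (q m)" "\<And>m z. norm z = 1 \<Longrightarrow> norm (q m z) \<le> 2 * C + 2"
    "\<And>\<xi>. \<xi> \<in> polar_vectors \<Longrightarrow> AE z in form_measure M \<xi>. (\<lambda>m. q m z) \<longlonglongrightarrow> y z"
    using trig_poly_approx_circle[OF M y C(2) fin] by blast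
  have "(\<lambda>m. polar (form_integral M) (p m) (q m)) \<longlonglongrightarrow> polar (form_integral M) x y"
    by (rule polar_form_integral_limit[OF M p(1) q(1) p(2) q(2) x y p(3) q(3)])
  moreover have "polar (form_integral M) (p m) (q m) \<ge> 0" for m
  proof -
    obtain n1 n2 where "trig_poly n1 (p m)" "trig_poly n2 (q m)" using p(1) q(1) by blast
    then have "trig_poly (max n1 n2) (p m)" "trig_poly (max n1 n2) (q m)"
      using trig_poly_mono[of n1 "p m" "max n1 n2"] trig_poly_mono[of n2 "q m" "max n1 n2"] by simp_all
    then show ?thesis by (rule trig)
  qed
  ultimately show ?thesis by (intro LIMSEQ_le_const) auto
qed

section \<open>Positive semidefinite matrices of size two\<close>

lemma psd_matrix_entries:
  fixes B :: "complex^2^2"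
  assumes "psd_matrix B"
  shows "B $ 1 $ 1 = of_real (Re (B $ 1 $ 1))" "B $ 2 $ 2 = of_real (Re (B $ 2 $ 2))"
    and "B $ 2 $ 1 = cnj (B $ 1 $ 2)" and "Re (B $ 1 $ 1) \<ge> 0" "Re (B $ 2 $ 2) \<ge> 0"
    and "(norm (B $ 1 $ 2))\<^sup>2 \<le> Re (B $ 1 $ 1) * Re (B $ 2 $ 2)"
    and "Re (det B) = Re (B $ 1 $ 1) * Re (B $ 2 $ 2) - (norm (B $ 1 $ 2))\<^sup>2"
proof -
  define p q r s where "p = B $ 1 $ 1" and "q = B $ 1 $ 2" and "r = B $ 2 $ 1" and "s = B $ 2 $ 2"
  note defs = p_def[symmetric] q_def[symmetric] r_def[symmetric] s_def[symmetric]
  have psd: "cnj x * (p * x + q * y) + cnj y * (r * x + s * y) \<in> \<real>\<^sub>\<ge>\<^sub>0" for x y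
    using assms herm_form_vec[of x y B] unfolding psd_matrix_def defs by metis
  have p: "Im p = 0" "Re p \<ge> 0" using psd[of 1 0] by (simp_all add: complex_nonneg_Reals_iff)
  have s: "Im s = 0" "Re s \<ge> 0" using psd[of 0 1] by (simp_all add: complex_nonneg_Reals_iff)
  have "Im q + Im r = 0" using psd[of 1 1] p s by (simp add: complex_nonneg_Reals_iff)
  moreover have "Re q - Re r = 0" using psd[of 1 \<i>] p s by (simp add: complex_nonneg_Reals_iff)
  ultimately have r: "r = cnj q" by (simp add: complex_eq_iff)
  have form: "Re p * (norm x)\<^sup>2 + 2 * Re (cnj x * y * q) + Re s * (norm y)\<^sup>2 \<ge> 0" for x y
  proof -
    have "Re (cnj x * (p * x + q * y) + cnj y * (r * x + s * y)) \<ge> 0"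
      using psd[of x y] by (simp add: complex_nonneg_Reals_iff)
    then show ?thesis unfolding r cmod_power2 using p s
      by (simp add: power2_eq_square algebra_simps)
  qed
  have qsq: "Re (cnj q * q) = (norm q)\<^sup>2" unfolding cmod_power2 by (simp add: power2_eq_square)
  have "(norm q)\<^sup>2 \<le> Re p * Re s"
  proof (cases "Re p = 0")
    case True
    have "q = 0"
    proof (rule ccontr)
      assume q: "q \<noteq> 0"
      \<comment> \<open>With this t the form at \<open>(- t q, 1)\<close> equals - Re s - 2, which
        is negative.\<close>
      define t where "t = (Re s + 1) / (norm q)\<^sup>2"
      have "2 * Re (cnj (- of_real t * q) * 1 * q) + Re s \<ge> 0"
        using form[of "- of_real t * q" 1] True by simp
      moreover have "Re (cnj (- of_real t * q) * 1 * q) = - t * (norm q)\<^sup>2"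
        unfolding cmod_power2 by (simp add: power2_eq_square algebra_simps)
      moreover have "t * (norm q)\<^sup>2 = Re s + 1" using q by (simp add: t_def)
      ultimately show False using s by linarith
    qed
    then show ?thesis using True by simp
  next
    case False
    \<comment> \<open>At \<open>(- q, Re p)\<close> the form is Re p times the determinant.\<close>
    have "Re (cnj (- q) * of_real (Re p) * q) = - Re p * (norm q)\<^sup>2"
      unfolding cmod_power2 by (simp add: power2_eq_square algebra_simps)
    then have "Re p * (norm q)\<^sup>2 + 2 * (- Re p * (norm q)\<^sup>2) + Re s * (Re p)\<^sup>2 \<ge> 0"
      using form[of "- q" "of_real (Re p)"] by simp
    then have "Re p * (Re p * Re s - (norm q)\<^sup>2) \<ge> 0" by (simp add: power2_eq_square algebra_simps)
    then show ?thesis using False p(2) by (simp add: zero_le_mult_iff)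
  qed
  moreover have "Re (det B) = Re p * Re s - (norm q)\<^sup>2"
    unfolding det_2 defs r using p s qsq by (simp add: mult.commute)
  ultimately show "B $ 1 $ 1 = of_real (Re (B $ 1 $ 1))" "B $ 2 $ 2 = of_real (Re (B $ 2 $ 2))"
    "B $ 2 $ 1 = cnj (B $ 1 $ 2)" "Re (B $ 1 $ 1) \<ge> 0" "Re (B $ 2 $ 2) \<ge> 0"
    "(norm (B $ 1 $ 2))\<^sup>2 \<le> Re (B $ 1 $ 1) * Re (B $ 2 $ 2)"
    "Re (det B) = Re (B $ 1 $ 1) * Re (B $ 2 $ 2) - (norm (B $ 1 $ 2))\<^sup>2"
    unfolding defs using p s r by (simp_all add: complex_eq_iff)
qed

lemma Re_herm_form_psd:
  fixes B :: "complex^2^2"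
  assumes "psd_matrix B"
  shows "Re (herm_form (vector [x, y]) B) = Re (B $ 1 $ 1) * (norm x)\<^sup>2 + 2 * Re (cnj x * y * B $ 1 $ 2)
    + Re (B $ 2 $ 2) * (norm y)\<^sup>2"
proof -
  define p q s where "p = Re (B $ 1 $ 1)" and "q = B $ 1 $ 2" and "s = Re (B $ 2 $ 2)"
  have "B $ 1 $ 1 = of_real p" "B $ 2 $ 2 = of_real s" "B $ 2 $ 1 = cnj q" "B $ 1 $ 2 = q"
    using psd_matrix_entries(1-3)[OF assms] by (simp_all add: p_def q_def s_def)
  then show ?thesis
    unfolding herm_form_vec p_def[symmetric] s_def[symmetric] cmod_power2
    by (simp add: power2_eq_square algebra_simps)
qed

text \<open>The determinant of \<xi>1 \<xi>1^* + \<xi>2 \<xi>2^* + \<epsilon> for \<xi>k = (xk, yk),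
  expanded by Cauchy--Binet so that all summands are nonnegative when \<epsilon> \<ge> 0.
  \<open>gram_det_eq\<close> is the form used in the trace inequality.\<close>

definition gram_det :: "real \<Rightarrow> complex \<Rightarrow> complex \<Rightarrow> complex \<Rightarrow> complex \<Rightarrow> real" where
  "gram_det \<epsilon> x1 y1 x2 y2 = (norm (x1 * y2 - x2 * y1))\<^sup>2
     + \<epsilon> * ((norm x1)\<^sup>2 + (norm x2)\<^sup>2 + (norm y1)\<^sup>2 + (norm y2)\<^sup>2) + \<epsilon>\<^sup>2"

lemma gram_det_eq:
  "gram_det \<epsilon> x1 y1 x2 y2 = ((norm x1)\<^sup>2 + (norm x2)\<^sup>2 + \<epsilon>) * ((norm y1)\<^sup>2 + (norm y2)\<^sup>2 + \<epsilon>)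
     - (norm (cnj x1 * y1 + cnj x2 * y2))\<^sup>2"
  unfolding gram_det_def cmod_power2 by (simp add: power2_eq_square algebra_simps)

text \<open>Cauchy--Schwarz for (u, \<alpha>) and (v, \<beta>), followed by the arithmetic-geometric
  mean inequality for a p and d s. In the application u, v are moduli of off-diagonal entries and
  \<alpha>, \<beta> are square roots of determinants.\<close>

lemma sqrt_mult_le:
  fixes u v \<alpha> \<beta> :: real
  assumes "a * d = u\<^sup>2 + \<alpha>\<^sup>2" "p * s = v\<^sup>2 + \<beta>\<^sup>2" "a \<ge> 0" "d \<ge> 0" "p \<ge> 0" "s \<ge> 0"
  shows "2 * (u * v + \<alpha> * \<beta>) \<le> a * p + d * s"
proof (rule power2_le_imp_le)
  have "(2 * (u * v + \<alpha> * \<beta>))\<^sup>2 = 4 * ((u\<^sup>2 + \<alpha>\<^sup>2) * (v\<^sup>2 + \<beta>\<^sup>2) - (u * \<beta> - \<alpha> * v)\<^sup>2)"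
    by (simp add: power2_eq_square algebra_simps)
  also have "\<dots> \<le> 4 * ((a * d) * (p * s))" unfolding assms(1,2) by simp
  also have "\<dots> = (a * p + d * s)\<^sup>2 - (a * p - d * s)\<^sup>2"
    by (simp add: power2_eq_square algebra_simps)
  also have "\<dots> \<le> (a * p + d * s)\<^sup>2" by simp
  finally show "(2 * (u * v + \<alpha> * \<beta>))\<^sup>2 \<le> (a * p + d * s)\<^sup>2" .
qed (use assms in simp)

text \<open>This is \<open>tr (G B) \<ge> 2 (det G det B)\<^sup>1\<^sup>/\<^sup>2\<close> for \<open>G = \<xi>\<^sub>1 \<xi>\<^sub>1\<^sup>* + \<xi>\<^sub>2 \<xi>\<^sub>2\<^sup>* + \<epsilon>\<close>.\<close>

lemma herm_form_sum_ge:
  fixes B :: "complex^2^2"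
  assumes B: "psd_matrix B" and \<epsilon>: "\<epsilon> \<ge> 0"
  shows "2 * (sqrt (gram_det \<epsilon> x1 y1 x2 y2) * sqrt (Re (det B)))
    \<le> Re (herm_form (vector [x1, y1]) B) + Re (herm_form (vector [x2, y2]) B)
      + \<epsilon> * (Re (B $ 1 $ 1) + Re (B $ 2 $ 2))"
proof -
  define a d b where "a = (norm x1)\<^sup>2 + (norm x2)\<^sup>2 + \<epsilon>" and "d = (norm y1)\<^sup>2 + (norm y2)\<^sup>2 + \<epsilon>"
    and "b = cnj x1 * y1 + cnj x2 * y2"
  define p q s where "p = Re (B $ 1 $ 1)" and "q = B $ 1 $ 2" and "s = Re (B $ 2 $ 2)"
  note e = psd_matrix_entries[OF B, folded p_def q_def s_def]
  have G: "gram_det \<epsilon> x1 y1 x2 y2 = a * d - (norm b)\<^sup>2" by (simp add: gram_det_eq a_def b_def d_def)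
  have G0: "gram_det \<epsilon> x1 y1 x2 y2 \<ge> 0" using \<epsilon> by (simp add: gram_det_def)
  have "2 * (norm b * norm q + sqrt (gram_det \<epsilon> x1 y1 x2 y2) * sqrt (Re (det B))) \<le> a * p + d * s"
    using G0 e \<epsilon> by (intro sqrt_mult_le) (auto simp: G a_def d_def)
  moreover have "- (norm b * norm q) \<le> Re (b * q)"
    using abs_Re_le_cmod[of "b * q"] by (simp add: norm_mult abs_le_iff)
  moreover have "Re (herm_form (vector [x1, y1]) B) + Re (herm_form (vector [x2, y2]) B) + \<epsilon> * (p + s)
    = a * p + 2 * Re (b * q) + d * s"
    unfolding Re_herm_form_psd[OF B] p_def[symmetric] q_def[symmetric] s_def[symmetric]
    by (simp add: a_def b_def d_def algebra_simps)
  ultimately show ?thesis unfolding p_def[symmetric] s_def[symmetric] distrib_left by linarith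
qed

section \<open>The Lebesgue decomposition\<close>

lemma cis_Im_Ln: "norm z = 1 \<Longrightarrow> cis (Im (Ln z)) = z"
proof -
  assume z: "norm z = 1"
  then have "z \<noteq> 0" by auto
  then have "z = exp (Ln z)" by simp
  also have "\<dots> = of_real (exp (Re (Ln z))) * cis (Im (Ln z))" by (simp add: exp_eq_polar)
  also have "Re (Ln z) = 0" using z \<open>z \<noteq> 0\<close> by (simp add: Re_Ln)
  finally show ?thesis by simp
qed

text \<open>The test set is where k is negative, with N removed so that \<open>pos\<close> applies;
  there the integral of k is both at most 0 and at least 0.\<close>

lemma AE_angle_nonneg:
  fixes k :: "real \<Rightarrow> real"
  assumes k: "integrable angle_measure k" "\<And>t t'. cis t = cis t' \<Longrightarrow> k t = k t'"
    and N: "N \<in> circle_sets" "AE t in angle_measure. cis t \<notin> N"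
    and pos: "\<And>A. A \<in> circle_sets \<Longrightarrow> A \<inter> N = {} \<Longrightarrow> (\<integral>t. indicator A (cis t) * k t \<partial>angle_measure) \<ge> 0"
  shows "AE t in angle_measure. k t \<ge> 0"
proof -
  have k_meas[measurable]: "k \<in> borel_measurable borel" using k(1) by (auto dest: borel_measurable_integrable)
  \<comment> \<open>\<open>Im (Ln z)\<close> is a Borel right inverse of \<open>cis\<close> on the
    circle. Through it k becomes a Borel function of z, and its negative set the preimage of a set
    in \<open>circle_sets\<close>.\<close>
  define k' where "k' z = k (Im (Ln z))" for z
  have k'_meas[measurable]: "k' \<in> borel_measurable borel" unfolding k'_def by measurable
  have k': "k' (cis t) = k t" for t unfolding k'_def by (intro k(2)) (simp add: cis_Im_Ln)
  define A where "A = (sphere 0 1 \<inter> {z. k' z < 0}) - N"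
  have N_borel[measurable]: "N \<in> sets borel" using N by (simp add: circle_sets_iff)
  have s[measurable]: "(sphere 0 1 :: complex set) \<in> sets borel" by (intro borel_closed) simp
  have "{z. k' z < 0} \<in> sets borel" by measurable
  then have A: "A \<in> circle_sets" unfolding circle_sets_iff A_def by auto
  have A_borel[measurable]: "A \<in> sets borel" using A by (simp add: circle_sets_iff)
  have ind[measurable]: "(\<lambda>t. indicator A (cis t) :: real) \<in> borel_measurable borel"
    by (rule measurable_compose[OF cis_borel_measurable]) measurable
  define f where "f t = - (indicator A (cis t) * k t)" for t
  have f0: "f t \<ge> 0" for t by (auto simp: f_def A_def k' indicator_def)
  have intf: "integrable angle_measure f" unfolding f_def
    by (intro Bochner_Integration.integrable_minus integrable_angle_mult_bounded[OF k(1) ind, where B=1])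
      (simp add: indicator_def)
  have "integral\<^sup>L angle_measure f \<le> 0"
  proof -
    have "A \<inter> N = {}" by (auto simp: A_def)
    from pos[OF A this] show ?thesis unfolding f_def by simp
  qed
  moreover have "0 \<le> integral\<^sup>L angle_measure f"
    by (intro integral_nonneg_AE AE_I2 f0)
  ultimately have "integral\<^sup>L angle_measure f = 0" by (rule antisym)
  then have "AE t in angle_measure. f t = 0"
    using integral_nonneg_eq_0_iff_AE[OF intf] f0 by simp
  with N(2) show ?thesis
  proof eventually_elim
    case (elim t)
    show ?case
    proof (rule ccontr)
      assume "\<not> k t \<ge> 0"
      then have "cis t \<in> A" using elim by (simp add: A_def k')
      then show False using elim \<open>\<not> k t \<ge> 0\<close> by (simp add: f_def)
    qed
  qed
qed

text \<open>The decomposition with a carrier N of the singular part fixed. No sign is imposed on W;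
  \<open>psd_W_AE\<close> derives it from the positivity of M off N.\<close>

locale matrix_lebesgue =
  fixes M Ms :: "complex set \<Rightarrow> complex^2^2" and W :: "complex \<Rightarrow> complex^2^2" and N :: "complex set"
  assumes M: "psd_matrix_measure M" and intW: "integrable angle_measure (\<lambda>t. W (cis t))"
    and N: "N \<in> circle_sets" and N_null: "AE t in angle_measure. cis t \<notin> N"
    and Ms_N: "\<And>A. A \<in> circle_sets \<Longrightarrow> A \<inter> N = {} \<Longrightarrow> Ms A = 0"
    and decomp: "\<And>A. A \<in> circle_sets \<Longrightarrow>
      M A = (\<integral>t. indicator A (cis t) *\<^sub>R W (cis t) \<partial>angle_measure) + Ms A"
begin

lemma N_borel [measurable]: "N \<in> sets borel"
  using N by (simp add: circle_sets_iff)

lemma integrable_herm_W: "integrable angle_measure (\<lambda>t. herm_form \<xi> (W (cis t)))"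
  by (rule integrable_bounded_linear[OF bounded_linear_herm_form intW])

lemma herm_form_M:
  assumes A: "A \<in> circle_sets" "A \<inter> N = {}"
  shows "herm_form \<xi> (M A) = (\<integral>t. indicator A (cis t) *\<^sub>R herm_form \<xi> (W (cis t)) \<partial>angle_measure)"
proof -
  have [measurable]: "A \<in> sets borel" using A by (simp add: circle_sets_iff)
  have "integrable angle_measure (\<lambda>t. indicator A (cis t) *\<^sub>R W (cis t))"
  proof (rule Bochner_Integration.integrable_bound[OF intW])
    have [measurable]: "(\<lambda>t. W (cis t)) \<in> borel_measurable borel"
      using borel_measurable_integrable[OF intW] by simp
    show "(\<lambda>t. indicator A (cis t) *\<^sub>R W (cis t)) \<in> borel_measurable angle_measure" by measurable
  qed (auto simp: indicator_def)
  from integral_bounded_linear[OF bounded_linear_herm_form this, of \<xi>]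
  have "(\<integral>t. herm_form \<xi> (indicator A (cis t) *\<^sub>R W (cis t)) \<partial>angle_measure) = herm_form \<xi> (M A)"
    using decomp[OF A(1)] Ms_N[OF A] by simp
  then show ?thesis by (simp only: herm_form_scaleR scaleR_conv_of_real[of _ "herm_form _ _"])
qed

text \<open>Off N the form of M is the integral of the form of W. Reality comes from testing both Im
  and - Im.\<close>

lemma herm_form_W_AE: "AE t in angle_measure. herm_form \<xi> (W (cis t)) \<in> \<real>\<^sub>\<ge>\<^sub>0"
proof -
  have int: "integrable angle_measure (\<lambda>t. indicator A (cis t) *\<^sub>R herm_form \<xi> (W (cis t)))"
    if "A \<in> circle_sets" for A
  proof (rule Bochner_Integration.integrable_bound[OF integrable_herm_W[of \<xi>]])
    have [measurable]: "(\<lambda>t. herm_form \<xi> (W (cis t))) \<in> borel_measurable borel" "A \<in> sets borel"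
      using borel_measurable_integrable[OF integrable_herm_W[of \<xi>]] that by (simp_all add: circle_sets_iff)
    show "(\<lambda>t. indicator A (cis t) *\<^sub>R herm_form \<xi> (W (cis t))) \<in> borel_measurable angle_measure" by measurable
  qed (auto simp: indicator_def)
  have psd: "herm_form \<xi> (M A) \<in> \<real>\<^sub>\<ge>\<^sub>0" if "A \<in> circle_sets" for A
    using M that unfolding psd_matrix_measure_def psd_matrix_def by blast
  have R: "(\<integral>t. indicator A (cis t) * Re (herm_form \<xi> (W (cis t))) \<partial>angle_measure) = Re (herm_form \<xi> (M A))"
    and I: "(\<integral>t. indicator A (cis t) * Im (herm_form \<xi> (W (cis t))) \<partial>angle_measure) = Im (herm_form \<xi> (M A))"
    if "A \<in> circle_sets" "A \<inter> N = {}" for A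
    using integral_Re[OF int[OF that(1)]] integral_Im[OF int[OF that(1)]] unfolding herm_form_M[OF that]
    by simp_all
  have "AE t in angle_measure. Re (herm_form \<xi> (W (cis t))) \<ge> 0"
    by (rule AE_angle_nonneg[OF integrable_Re[OF integrable_herm_W] _ N N_null])
      (use R psd in \<open>auto simp: complex_nonneg_Reals_iff\<close>)
  moreover have "AE t in angle_measure. Im (herm_form \<xi> (W (cis t))) \<ge> 0"
    by (rule AE_angle_nonneg[OF integrable_Im[OF integrable_herm_W] _ N N_null])
      (use I psd in \<open>auto simp: complex_nonneg_Reals_iff\<close>)
  moreover have "AE t in angle_measure. - Im (herm_form \<xi> (W (cis t))) \<ge> 0"
    by (rule AE_angle_nonneg[OF Bochner_Integration.integrable_minus[OF integrable_Im[OF integrable_herm_W]] _ N N_null])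
      (use I psd in \<open>auto simp: complex_nonneg_Reals_iff\<close>)
  ultimately show ?thesis
    by eventually_elim (simp add: complex_nonneg_Reals_iff)
qed

text \<open>The exceptional null set of \<open>herm_form_W_AE\<close> depends on \<xi>. It is taken
  over a countable dense set of vectors; continuity of the form and closedness of the nonnegative
  reals give all other vectors.\<close>

lemma psd_W_AE: "AE t in angle_measure. psd_matrix (W (cis t))"
proof -
  obtain D :: "(complex^2) set" where D: "countable D" "\<And>X. open X \<Longrightarrow> X \<noteq> {} \<Longrightarrow> \<exists>d\<in>D. d \<in> X"
    using countable_dense_exists by blast
  have "AE t in angle_measure. \<forall>\<xi>\<in>D. herm_form \<xi> (W (cis t)) \<in> \<real>\<^sub>\<ge>\<^sub>0"
    using D(1) herm_form_W_AE by (subst AE_ball_countable) auto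
  then show ?thesis
  proof eventually_elim
    case (elim t)
    define S where "S = (\<lambda>\<xi>. herm_form \<xi> (W (cis t))) -` \<real>\<^sub>\<ge>\<^sub>0"
    have "continuous_on UNIV (\<lambda>\<xi>. herm_form \<xi> (W (cis t)))"
      unfolding herm_form_def matrix_vector_mult_def vec_lambda_beta by (intro continuous_intros)
    then have "closed S" unfolding S_def
      by (intro continuous_closed_vimage closed_nonneg_Reals_complex) (simp add: continuous_on_eq_continuous_at)
    then have "open (- S)" by (rule open_Compl)
    moreover have "\<not> (\<exists>d\<in>D. d \<in> - S)" using elim by (auto simp: S_def)
    ultimately have "- S = {}" using D(2) by blast
    then have "\<xi> \<in> S" for \<xi> by blast
    then show ?case unfolding psd_matrix_def S_def by simp
  qed
qed


lemma polar_indicator: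
  "polar (form_integral M) (\<lambda>z. indicator A z * x z) (\<lambda>z. indicator A z * y z)
    = polar (\<lambda>\<xi> g. form_integral M \<xi> (\<lambda>z. indicator A z * g z)) x y"
proof -
    have "(norm (indicator A z * x z))\<^sup>2 = indicator A z * (norm (x z))\<^sup>2"
      "(norm (indicator A z * y z))\<^sup>2 = indicator A z * (norm (y z))\<^sup>2"
      "Re (cnj (indicator A z * x z) * (indicator A z * y z)) = indicator A z * Re (cnj (x z) * y z)"
      "Im (cnj (indicator A z * x z) * (indicator A z * y z)) = indicator A z * Im (cnj (x z) * y z)" for z
      by (simp_all add: indicator_def)
    then show ?thesis unfolding polar_def Let_def by simp
qed

text \<open>Restricted to the complement of N, the form measure is the image under
  \<open>cis\<close> of the angle measure with density h. The two are compared on sets A, where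
  passing from A to A - N is invisible to the angle measure.\<close>

lemma form_integral_off_N:
  assumes g: "g \<in> borel_measurable borel"
  shows "form_integral M \<xi> (\<lambda>z. indicator (- N) z * g z) = (\<integral>t. g (cis t) * Re (herm_form \<xi> (W (cis t))) \<partial>angle_measure)"
proof -
  define h where "h t = Re (herm_form \<xi> (W (cis t)))" for t
  have inth: "integrable angle_measure h" unfolding h_def by (rule integrable_Re[OF integrable_herm_W])
  have h_meas[measurable]: "h \<in> borel_measurable borel" using borel_measurable_integrable[OF inth] by simp
  have h0: "AE t in angle_measure. 0 \<le> h t"
    using herm_form_W_AE[of \<xi>] by eventually_elim (simp add: h_def complex_nonneg_Reals_iff)
  let ?R = "restrict_space borel (sphere 0 1 :: complex set)"
  have cis_R[measurable]: "cis \<in> measurable borel ?R"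
    by (rule measurable_restrict_space2) auto
  have cis_R'[measurable]: "cis \<in> measurable (density angle_measure (\<lambda>t. ennreal (h t))) ?R"
    using cis_R by (simp cong: measurable_cong_sets)
  have g_R[measurable]: "g \<in> borel_measurable ?R" using g by (rule measurable_restrict_space1)
  have g_F: "g \<in> borel_measurable (form_measure M \<xi>)"
    unfolding measurable_cong_sets[OF sets_form_measure_cong refl] by (rule g_R)
  have ind_R: "(\<lambda>z. indicator (- N) z :: real) \<in> borel_measurable ?R"
    by (rule measurable_restrict_space1) measurable
  have ind_F: "(\<lambda>z. indicator (- N) z :: real) \<in> borel_measurable (form_measure M \<xi>)"
    unfolding measurable_cong_sets[OF sets_form_measure_cong refl] by (rule ind_R)
  have eq: "density (form_measure M \<xi>) (\<lambda>z. ennreal (indicator (- N) z)) = distr (density angle_measure (\<lambda>t. ennreal (h t))) ?R cis"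
  proof (rule measure_eqI)
    show "sets (density (form_measure M \<xi>) (\<lambda>z. ennreal (indicator (- N) z))) = sets (distr (density angle_measure (\<lambda>t. ennreal (h t))) ?R cis)"
      by (simp add: circle_sets_def)
    fix A assume "A \<in> sets (density (form_measure M \<xi>) (\<lambda>z. ennreal (indicator (- N) z)))"
    then have A: "A \<in> circle_sets" by simp
    have AN: "A - N \<in> circle_sets" "(A - N) \<inter> N = {}" using A N by (auto simp: circle_sets_iff)
    have A_borel[measurable]: "A \<in> sets borel" using A by (simp add: circle_sets_iff)
    have indA[measurable]: "(\<lambda>t. indicator A (cis t) :: real) \<in> borel_measurable borel"
      by (rule measurable_compose[OF cis_borel_measurable]) measurable
    have intA: "integrable angle_measure (\<lambda>t. indicator A (cis t) * h t)"
      by (rule integrable_angle_mult_bounded[OF inth indA, where B=1]) (simp add: indicator_def)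
    have intAN: "integrable angle_measure (\<lambda>t. indicator (A - N) (cis t) *\<^sub>R herm_form \<xi> (W (cis t)))"
    proof (rule Bochner_Integration.integrable_bound[OF integrable_herm_W[of \<xi>]])
      have [measurable]: "(\<lambda>t. herm_form \<xi> (W (cis t))) \<in> borel_measurable borel"
        using borel_measurable_integrable[OF integrable_herm_W[of \<xi>]] by simp
      have [measurable]: "A - N \<in> sets borel" by measurable
      show "(\<lambda>t. indicator (A - N) (cis t) *\<^sub>R herm_form \<xi> (W (cis t))) \<in> borel_measurable angle_measure" by measurable
    qed (auto simp: indicator_def)
    have "emeasure (density (form_measure M \<xi>) (\<lambda>z. ennreal (indicator (- N) z))) A
      = (\<integral>\<^sup>+z. ennreal (indicator (- N) z) * indicator A z \<partial>form_measure M \<xi>)"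
      using A ind_F by (subst emeasure_density) auto
    also have "\<dots> = (\<integral>\<^sup>+z. indicator (A - N) z \<partial>form_measure M \<xi>)"
      by (intro nn_integral_cong) (auto simp: indicator_def)
    also have "\<dots> = emeasure (form_measure M \<xi>) (A - N)" using AN by simp
    also have "\<dots> = ennreal (Re (herm_form \<xi> (M (A - N))))" by (rule emeasure_form_measure[OF M AN(1)])
    also have "Re (herm_form \<xi> (M (A - N))) = (\<integral>t. indicator (A - N) (cis t) * h t \<partial>angle_measure)"
      unfolding herm_form_M[OF AN] using integral_Re[OF intAN] by (simp add: h_def)
    also have "\<dots> = (\<integral>t. indicator A (cis t) * h t \<partial>angle_measure)"
    proof (rule integral_cong_AE)
      have [measurable]: "A - N \<in> sets borel" by measurable
      show "(\<lambda>t. indicator (A - N) (cis t) * h t) \<in> borel_measurable angle_measure" by measurable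
      show "AE t in angle_measure. indicator (A - N) (cis t) * h t = indicator A (cis t) * h t"
        using N_null by eventually_elim (auto simp: indicator_def)
    qed (use intA in auto)
    also have "ennreal \<dots> = (\<integral>\<^sup>+t. ennreal (indicator A (cis t) * h t) \<partial>angle_measure)"
      by (rule nn_integral_eq_integral[symmetric, OF intA])
        (use h0 in eventually_elim, simp add: indicator_def)
    also have "\<dots> = (\<integral>\<^sup>+t. ennreal (h t) * indicator (cis -` A) t \<partial>angle_measure)"
      by (intro nn_integral_cong) (auto simp: indicator_def)
    also have "\<dots> = emeasure (density angle_measure (\<lambda>t. ennreal (h t))) (cis -` A)"
    proof (rule emeasure_density[symmetric])
      have "cis -` A \<inter> space borel \<in> sets borel" by (rule measurable_sets[OF cis_borel_measurable A_borel])
      then show "cis -` A \<in> sets angle_measure" by simp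
    qed measurable
    also have "\<dots> = emeasure (distr (density angle_measure (\<lambda>t. ennreal (h t))) ?R cis) A"
      using A by (subst emeasure_distr[OF cis_R']) (auto simp: circle_sets_def)
    finally show "emeasure (density (form_measure M \<xi>) (\<lambda>z. ennreal (indicator (- N) z))) A
      = emeasure (distr (density angle_measure (\<lambda>t. ennreal (h t))) ?R cis) A" .
  qed
  have "form_integral M \<xi> (\<lambda>z. indicator (- N) z * g z) = (\<integral>z. g z \<partial>density (form_measure M \<xi>) (\<lambda>z. ennreal (indicator (- N) z)))"
    unfolding form_integral_def by (subst integral_density[OF g_F ind_F]) auto
  also have "\<dots> = (\<integral>t. g (cis t) \<partial>density angle_measure (\<lambda>t. ennreal (h t)))"
    unfolding eq by (rule integral_distr[OF cis_R' g_R])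
  also have "\<dots> = (\<integral>t. h t *\<^sub>R g (cis t) \<partial>angle_measure)"
  proof (rule integral_density)
    have "(\<lambda>t. g (cis t)) \<in> borel_measurable borel" by (rule measurable_compose[OF cis_borel_measurable g])
    then show "(\<lambda>t. g (cis t)) \<in> borel_measurable angle_measure" by simp
  qed (use h0 in auto)
  finally show ?thesis by (simp add: h_def mult.commute)
qed

lemma polar_off_N:
  assumes [measurable]: "x \<in> borel_measurable borel" "y \<in> borel_measurable borel"
    and C: "\<And>t. norm (x (cis t)) \<le> C" "\<And>t. norm (y (cis t)) \<le> C"
  shows "polar (form_integral M) (\<lambda>z. indicator (- N) z * x z) (\<lambda>z. indicator (- N) z * y z)
    = (\<integral>t. Re (herm_form (vector [x (cis t), y (cis t)]) (W (cis t))) \<partial>angle_measure)"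
proof -
  have "polar (form_integral M) (\<lambda>z. indicator (- N) z * x z) (\<lambda>z. indicator (- N) z * y z)
    = polar (\<lambda>\<xi> g. form_integral M \<xi> (\<lambda>z. indicator (- N) z * g z)) x y"
    by (rule polar_indicator)
  also have "\<dots> = polar (\<lambda>\<xi> g. \<integral>t. g (cis t) * Re (herm_form \<xi> (W (cis t))) \<partial>angle_measure) x y"
    by (intro polar_cong form_integral_off_N) measurable
  also have "\<dots> = (\<integral>t. Re (herm_form (vector [x (cis t), y (cis t)]) (W (cis t))) \<partial>angle_measure)"
    by (rule polar_angle(2)[where x=x and y=y and C=C, OF intW _ _ C]) measurable
  finally show ?thesis .
qed

text \<open>\<open>polar\<close> is additive over N and its complement: off N it is the integral
  against W, and on N it is nonnegative by \<open>polar_form_integral_nonneg\<close>. So the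
  singular part can be discarded.\<close>

lemma polar_ge_off_N:
  assumes x[measurable]: "x \<in> borel_measurable borel" and y[measurable]: "y \<in> borel_measurable borel"
    and C: "\<And>z. norm z = 1 \<Longrightarrow> norm (x z) \<le> C" "\<And>z. norm z = 1 \<Longrightarrow> norm (y z) \<le> C"
    and trig: "\<And>n p q. trig_poly n p \<Longrightarrow> trig_poly n q \<Longrightarrow> polar (form_integral M) p q \<ge> 0"
  shows "(\<integral>t. Re (herm_form (vector [x (cis t), y (cis t)]) (W (cis t))) \<partial>angle_measure)
    \<le> polar (form_integral M) x y"
proof -
  have C0: "C \<ge> 0" using order_trans[OF norm_ge_zero C(1)[of 1]] by simp
  have N_sphere: "z \<in> N \<Longrightarrow> norm z = 1" for z using N by (auto simp: circle_sets_iff)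
  \<comment> \<open>x and y are bounded on the circle only; since N lies in the circle, its
    indicator makes the bound global.\<close>
  have 1: "polar (form_integral M) (\<lambda>z. indicator N z * x z) (\<lambda>z. indicator N z * y z) \<ge> 0"
    by (rule polar_form_integral_nonneg[OF M trig, where C=C])
      (measurable, auto simp: indicator_def C N_sphere C0)
  have split: "form_integral M \<xi> g = form_integral M \<xi> (\<lambda>z. indicator N z * g z) + form_integral M \<xi> (\<lambda>z. indicator (- N) z * g z)"
    if g[measurable]: "g \<in> borel_measurable borel" and B: "\<And>z. norm z = 1 \<Longrightarrow> \<bar>g z\<bar> \<le> B" for \<xi> g B
  proof -
    have "0 \<le> \<bar>g 1\<bar>" by simp
    also have "\<bar>g 1\<bar> \<le> B" by (rule B) simp
    finally have B0: "B \<ge> 0" .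
    have i: "integrable (form_measure M \<xi>) (\<lambda>z. indicator N z * g z)"
      by (rule integrable_form_measure_bounded[OF M measurable_restrict_space1, where B=B])
        (measurable, auto simp: indicator_def B B0)
    have j: "integrable (form_measure M \<xi>) (\<lambda>z. indicator (- N) z * g z)"
      by (rule integrable_form_measure_bounded[OF M measurable_restrict_space1, where B=B])
        (measurable, auto simp: indicator_def B B0)
    have "form_integral M \<xi> g = (\<integral>z. indicator N z * g z + indicator (- N) z * g z \<partial>form_measure M \<xi>)"
      unfolding form_integral_def by (intro Bochner_Integration.integral_cong refl) (auto simp: indicator_def)
    then show ?thesis unfolding form_integral_def Bochner_Integration.integral_add[OF i j] .
  qed
  have b: "\<bar>(norm (x z))\<^sup>2\<bar> \<le> C\<^sup>2" "\<bar>(norm (y z))\<^sup>2\<bar> \<le> C\<^sup>2" if "norm z = 1" for z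
    using power_mono[OF C(1)[OF that] norm_ge_zero, of 2] power_mono[OF C(2)[OF that] norm_ge_zero, of 2] by simp_all
  have n: "norm (cnj (x z) * y z) \<le> C\<^sup>2" if "norm z = 1" for z
    unfolding norm_mult power2_eq_square using C[OF that] C0 by (intro mult_mono) auto
  have b': "\<bar>Re (cnj (x z) * y z)\<bar> \<le> C\<^sup>2" "\<bar>Im (cnj (x z) * y z)\<bar> \<le> C\<^sup>2" if "norm z = 1" for z
    using n[OF that] abs_Re_le_cmod[of "cnj (x z) * y z"] abs_Im_le_cmod[of "cnj (x z) * y z"] by linarith+
  have s: "form_integral M \<xi> g = form_integral M \<xi> (\<lambda>z. indicator N z * g z) + form_integral M \<xi> (\<lambda>z. indicator (- N) z * g z)"
    if "g = (\<lambda>z. (norm (x z))\<^sup>2) \<or> g = (\<lambda>z. (norm (y z))\<^sup>2) \<or> g = (\<lambda>z. Re (cnj (x z) * y z)) \<or> g = (\<lambda>z. Im (cnj (x z) * y z))"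
    for \<xi> g
    using that
  proof (elim disjE)
    assume g: "g = (\<lambda>z. (norm (x z))\<^sup>2)"
    show ?thesis unfolding g by (rule split[OF _ b(1)]) measurable
  next
    assume g: "g = (\<lambda>z. (norm (y z))\<^sup>2)"
    show ?thesis unfolding g by (rule split[OF _ b(2)]) measurable
  next
    assume g: "g = (\<lambda>z. Re (cnj (x z) * y z))"
    show ?thesis unfolding g by (rule split[OF _ b'(1)]) measurable
  next
    assume g: "g = (\<lambda>z. Im (cnj (x z) * y z))"
    show ?thesis unfolding g by (rule split[OF _ b'(2)]) measurable
  qed
  have "polar (form_integral M) x y
    = polar (\<lambda>\<xi> g. form_integral M \<xi> (\<lambda>z. indicator N z * g z) + form_integral M \<xi> (\<lambda>z. indicator (- N) z * g z)) x y"
    by (rule polar_cong) (rule s, simp)+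
  also have "\<dots> = polar (\<lambda>\<xi> g. form_integral M \<xi> (\<lambda>z. indicator N z * g z)) x y
      + polar (\<lambda>\<xi> g. form_integral M \<xi> (\<lambda>z. indicator (- N) z * g z)) x y"
    unfolding polar_def Let_def by linarith
  also have "\<dots> = polar (form_integral M) (\<lambda>z. indicator N z * x z) (\<lambda>z. indicator N z * y z)
      + (\<integral>t. Re (herm_form (vector [x (cis t), y (cis t)]) (W (cis t))) \<partial>angle_measure)"
    unfolding polar_indicator[symmetric] using C by (subst polar_off_N[where C=C]) auto
  finally show ?thesis using 1 by simp
qed

end

section \<open>Szego's theorem\<close>

text \<open>A tail with sum below 1/2 has product at least 1/2 by the Weierstrass inequality, hence
  the witness is half the product before the tail. The converse is 1 - x \<le> exp (- x).\<close>

lemma summable_iff_schur_coeff_prod_bounded_below: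
  assumes "\<And>n. norm (\<gamma> n) < 1"
  shows "summable (\<lambda>n. (norm (\<gamma> n))\<^sup>2) \<longleftrightarrow> (\<exists>\<kappa>>0. \<forall>n. \<kappa> \<le> schur_coeff_prod n \<gamma>)"
proof
  have lt: "(norm (\<gamma> n))\<^sup>2 < 1" for n using assms[of n] by (simp add: abs_square_less_1)
  assume sum: "summable (\<lambda>n. (norm (\<gamma> n))\<^sup>2)"
  from summable_Cauchy[THEN iffD1, OF sum, rule_format, of "1/2"]
  obtain m where m: "\<And>k n. k \<ge> m \<Longrightarrow> norm (sum (\<lambda>n. (norm (\<gamma> n))\<^sup>2) {k..<n}) < 1/2" by auto
  define \<kappa> where "\<kappa> = schur_coeff_prod m \<gamma> / 2"
  have pos: "schur_coeff_prod n \<gamma> > 0" for n by (rule schur_coeff_prod_pos[OF assms])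
  have "\<kappa> \<le> schur_coeff_prod n \<gamma>" for n
  proof (cases "n \<ge> m")
    case True
    have "1/2 \<le> 1 - (\<Sum>k\<in>{m..<n}. (norm (\<gamma> k))\<^sup>2)" using m[of m n] by simp
    also have "\<dots> \<le> (\<Prod>k\<in>{m..<n}. 1 - (norm (\<gamma> k))\<^sup>2)"
      using lt by (intro Weierstrass_prod_ineq) (auto intro: less_imp_le)
    finally have "schur_coeff_prod m \<gamma> * (1/2) \<le> schur_coeff_prod m \<gamma> * (\<Prod>k\<in>{m..<n}. 1 - (norm (\<gamma> k))\<^sup>2)"
      using pos[of m] by (intro mult_left_mono) auto
    also have "\<dots> = schur_coeff_prod n \<gamma>"
      unfolding schur_coeff_prod_def lessThan_atLeast0 using True by (intro prod.atLeastLessThan_concat) auto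
    finally show ?thesis by (simp add: \<kappa>_def)
  next
    case False
    have "schur_coeff_prod m \<gamma> = schur_coeff_prod n \<gamma> * (\<Prod>k\<in>{n..<m}. 1 - (norm (\<gamma> k))\<^sup>2)"
      unfolding schur_coeff_prod_def lessThan_atLeast0 using False by (intro prod.atLeastLessThan_concat[symmetric]) auto
    also have "\<dots> \<le> schur_coeff_prod n \<gamma> * 1"
      using pos[of n] lt by (intro mult_left_mono prod_le_1) (auto intro: less_imp_le)
    finally show ?thesis using pos[of m] by (simp add: \<kappa>_def)
  qed
  then show "\<exists>\<kappa>>0. \<forall>n. \<kappa> \<le> schur_coeff_prod n \<gamma>" using pos[of m] by (intro exI[of _ \<kappa>]) (simp add: \<kappa>_def)
next
  assume "\<exists>\<kappa>>0. \<forall>n. \<kappa> \<le> schur_coeff_prod n \<gamma>"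
  then obtain \<kappa> where \<kappa>: "\<kappa> > 0" "\<And>n. \<kappa> \<le> schur_coeff_prod n \<gamma>" by blast
  show "summable (\<lambda>n. (norm (\<gamma> n))\<^sup>2)"
  proof (rule summableI_nonneg_bounded[where x="- ln \<kappa>"])
    fix n
    have "\<kappa> \<le> (\<Prod>k<n. exp (- (norm (\<gamma> k))\<^sup>2))"
    proof (rule order_trans[OF \<kappa>(2)[of n]], unfold schur_coeff_prod_def, rule prod_mono)
      fix k
      have "(norm (\<gamma> k))\<^sup>2 < 1" using assms[of k] by (simp add: abs_square_less_1)
      then show "0 \<le> 1 - (norm (\<gamma> k))\<^sup>2 \<and> 1 - (norm (\<gamma> k))\<^sup>2 \<le> exp (- (norm (\<gamma> k))\<^sup>2)"
        using exp_ge_add_one_self[of "- (norm (\<gamma> k))\<^sup>2"] by simp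
    qed
    also have "\<dots> = exp (- (\<Sum>k<n. (norm (\<gamma> k))\<^sup>2))" by (simp add: exp_sum sum_negf[symmetric])
    finally have "ln \<kappa> \<le> - (\<Sum>k<n. (norm (\<gamma> k))\<^sup>2)" using \<kappa>(1) by (metis exp_gt_zero ln_exp ln_le_cancel_iff)
    then show "(\<Sum>k<n. (norm (\<gamma> k))\<^sup>2) \<le> - ln \<kappa>" by simp
  qed simp
qed

text \<open>On the circle z^k cnj (z^l) has exponent k - l, so the order is n, whereas
  \<open>trig_poly_mult\<close> would give 2 n. This saving keeps products of entries of E within
  the moments that w_n shares with M.\<close>

lemma trig_poly_analytic_product:
  assumes "\<And>z. f z = (\<Sum>l\<le>n. z ^ l * a l)" "\<And>z. g z = (\<Sum>l\<le>n. z ^ l * b l)"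
  shows "trig_poly n (\<lambda>z. f z * cnj (g z))"
proof -
  have "trig_poly n (\<lambda>z. \<Sum>k\<le>n. \<Sum>l\<le>n. (a k * cnj (b l)) * z powi (int k - int l))"
    by (intro trig_poly_sum trig_poly_cmult trig_poly_powi) auto
  then show ?thesis
  proof (rule trig_poly_congI)
    fix z :: complex assume z: "norm z = 1"
    then have z0: "z \<noteq> 0" by auto
    have c: "cnj z ^ l = z powi (- int l)" for l using cnj_powi_circle[OF z, of "int l"] by simp
    have "(z ^ k * a k) * (cnj z ^ l * cnj (b l)) = (a k * cnj (b l)) * z powi (int k - int l)" for k l
      unfolding c using z0 by (simp add: power_int_diff power_int_minus field_simps)
    then show "f z * cnj (g z) = (\<Sum>k\<le>n. \<Sum>l\<le>n. (a k * cnj (b l)) * z powi (int k - int l))"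
      unfolding assms by (simp only: cnj_sum complex_cnj_mult complex_cnj_power sum_product)
  qed
qed

context slice_basis
begin

text \<open>Both parts come from the congruence of w with kappa times the identity: the determinant
  by multiplicativity, and positivity because every vector is \<open>hadj E *v \<eta>\<close> for
  some \<eta>.\<close>

lemma bs_density_psd:
  assumes "norm z = 1" "\<And>k. k < n \<Longrightarrow> norm (\<gamma> k) < 1"
  shows "psd_matrix (bs_density n \<gamma> z)"
    and "Re (det (bs_density n \<gamma> z)) = (schur_coeff_prod n \<gamma> / norm (det (qmat n (szego_poly n \<gamma>) z)))\<^sup>2"
proof -
  define E where "E = qmat n (szego_poly n \<gamma>) z"
  define w where "w = bs_density n \<gamma> z"
  define \<kappa> where "\<kappa> = schur_coeff_prod n \<gamma>"
  have \<kappa>: "\<kappa> > 0" unfolding \<kappa>_def by (rule schur_coeff_prod_pos[OF assms(2)])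
  have dE: "det E \<noteq> 0" using det_szego_poly_nonzero[of z n \<gamma>] assms by (simp add: E_def)
  have EwE: "E ** w ** hadj E = \<kappa> *\<^sub>R mat 1"
    unfolding E_def w_def \<kappa>_def by (rule bs_density_congruence[OF assms])
  have dh: "det (hadj E) = cnj (det E)" by (simp add: det_2)
  have "det E * det w * cnj (det E) = det (E ** w ** hadj E)"
    by (simp add: det_mul dh)
  also have "\<dots> = (of_real \<kappa>)\<^sup>2" unfolding EwE by (simp add: det_2 mat_def) (simp add: scaleR_conv_of_real power2_eq_square)
  finally have "det w * (of_real ((norm (det E))\<^sup>2)) = of_real (\<kappa>\<^sup>2)"
    unfolding complex_norm_square by (simp add: mult_ac)
  then have "det w = of_real ((\<kappa> / norm (det E))\<^sup>2)" using dE
    by (simp add: power_divide nonzero_eq_divide_eq)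
  then have "Re (det w) = (\<kappa> / norm (det E))\<^sup>2" by (simp only: Re_complex_of_real)
  then show "Re (det (bs_density n \<gamma> z)) = (schur_coeff_prod n \<gamma> / norm (det (qmat n (szego_poly n \<gamma>) z)))\<^sup>2"
    unfolding w_def E_def \<kappa>_def .
  show "psd_matrix (bs_density n \<gamma> z)" unfolding psd_matrix_def
  proof
    fix \<xi>
    define X where "X = (\<chi> a b. adj2 (hadj E) $ a $ b / det (hadj E))"
    have "det (hadj E) \<noteq> 0" using dE dh by simp
    then have HX: "hadj E ** X = mat 1"
      using adj2_mult[of "hadj E"] unfolding X_def
      by (simp add: vec_eq_iff forall_2 matrix_matrix_mult_def sum_2 mat_def add_divide_distrib[symmetric])
    define \<eta> where "\<eta> = X *v \<xi>"
    have "\<xi> = hadj E *v \<eta>" by (simp add: \<eta>_def matrix_vector_mul_assoc HX)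
    then have "herm_form \<xi> w = of_real \<kappa> * herm_form \<eta> (mat 1)"
      using herm_form_congruence[of E \<eta> w] EwE by (simp add: herm_form_scaleR)
    also have "\<dots> = of_real (\<kappa> * ((norm (\<eta> $ 1))\<^sup>2 + (norm (\<eta> $ 2))\<^sup>2))"
      by (simp add: herm_form_def sum_2 mult.commute flip: complex_norm_square)
    finally show "herm_form \<xi> (bs_density n \<gamma> z) \<in> \<real>\<^sub>\<ge>\<^sub>0"
      using \<kappa> unfolding w_def by (simp only: nonneg_Reals_of_real_iff) simp
  qed
qed

lemma integrable_bs_density:
  assumes "\<And>k. k < n \<Longrightarrow> norm (\<gamma> k) < 1"
  shows "integrable angle_measure (\<lambda>t. bs_density n \<gamma> (cis t))"
proof (rule integrable_angle_continuous)
  have "continuous_on (sphere 0 1) (\<lambda>z. \<chi> a. bs_density n \<gamma> z $ a)"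
  proof (rule continuous_on_vec_lambda)
    fix a
    have "continuous_on (sphere 0 1) (\<lambda>z. \<chi> b. bs_density n \<gamma> z $ a $ b)"
      by (intro continuous_on_vec_lambda continuous_on_bs_density assms)
    then show "continuous_on (sphere 0 1) (\<lambda>z. bs_density n \<gamma> z $ a)" by simp
  qed
  then show "continuous_on (sphere 0 1) (bs_density n \<gamma>)" by simp
qed

end

section \<open>Comparison of M with the density, and the upper entropy bound\<close>

locale szego_setting = slice_basis i j + matrix_lebesgue M Ms W N
  for i j M Ms W N +
  fixes c :: "int \<Rightarrow> quat" and f fs \<gamma>
  assumes c: "\<And>n. c (- n) = qcnj (c n)" "c 0 = 1"
    and f: "schur_algorithm f fs \<gamma>" "schur_fps_of c f"
    and \<gamma>: "\<And>n. norm (\<gamma> n) < 1"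
    and moments: "\<And>k. has_matrix_integral M (\<lambda>z. z powi k) (chi i j (c k))"
begin

lemma form_integral_bs_density:
  assumes "real_trig_poly n g"
  shows "form_integral M \<xi> g = (\<integral>t. g (cis t) * Re (herm_form \<xi> (bs_density n \<gamma> (cis t))) \<partial>angle_measure)"
  by (rule form_integral_trig_eq[OF moments integrable_bs_density[OF \<gamma>] bs_density_moment[OF f \<gamma> c] assms])

text \<open>The order is imposed on the products, since order n of x and y separately would bound
  them only by 2 n; the rows of E need the sharper form.\<close>

lemma polar_bs_density:
  assumes "real_trig_poly n (\<lambda>z. (norm (x z))\<^sup>2)" "real_trig_poly n (\<lambda>z. (norm (y z))\<^sup>2)"
    and "trig_poly n (\<lambda>z. cnj (x z) * y z)"
    and cont: "continuous_on (sphere 0 1) x" "continuous_on (sphere 0 1) y"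
  shows "integrable angle_measure (\<lambda>t. Re (herm_form (vector [x (cis t), y (cis t)]) (bs_density n \<gamma> (cis t))))"
    and "polar (form_integral M) x y
      = (\<integral>t. Re (herm_form (vector [x (cis t), y (cis t)]) (bs_density n \<gamma> (cis t))) \<partial>angle_measure)"
proof -
  have m: "(\<lambda>t. x (cis t)) \<in> borel_measurable borel" "(\<lambda>t. y (cis t)) \<in> borel_measurable borel"
    by (intro borel_measurable_continuous_onI continuous_on_cis_compose cont)+
  have "compact (x ` sphere 0 1)" "compact (y ` sphere 0 1)" by (intro compact_continuous_image cont, simp)+
  then obtain C1 C2 where C: "\<And>z. z \<in> sphere 0 1 \<Longrightarrow> norm (x z) \<le> C1" "\<And>z. z \<in> sphere 0 1 \<Longrightarrow> norm (y z) \<le> C2"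
    by (metis bounded_iff compact_imp_bounded imageI)
  have C': "norm (x (cis t)) \<le> max C1 C2" "norm (y (cis t)) \<le> max C1 C2" for t
    using C(1)[of "cis t"] C(2)[of "cis t"] by auto
  note p = polar_angle[where x=x and y=y and C="max C1 C2", OF integrable_bs_density[OF \<gamma>, of n] m C']
  show "integrable angle_measure (\<lambda>t. Re (herm_form (vector [x (cis t), y (cis t)]) (bs_density n \<gamma> (cis t))))"
    by (rule p(1))
  show "polar (form_integral M) x y
      = (\<integral>t. Re (herm_form (vector [x (cis t), y (cis t)]) (bs_density n \<gamma> (cis t))) \<partial>angle_measure)"
    unfolding p(2)[symmetric]
    by (intro polar_cong form_integral_bs_density assms real_trig_poly_Re real_trig_poly_Im)
qed

lemma polar_bs_density_trig:
  assumes "trig_poly m x" "trig_poly m y" "2 * m \<le> n"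
  shows "integrable angle_measure (\<lambda>t. Re (herm_form (vector [x (cis t), y (cis t)]) (bs_density n \<gamma> (cis t))))"
    and "polar (form_integral M) x y
      = (\<integral>t. Re (herm_form (vector [x (cis t), y (cis t)]) (bs_density n \<gamma> (cis t))) \<partial>angle_measure)"
proof -
  have *: "m + m \<le> n" using assms by simp
  have a: "real_trig_poly n (\<lambda>z. (norm (x z))\<^sup>2)" "real_trig_poly n (\<lambda>z. (norm (y z))\<^sup>2)"
    using trig_poly_mono[OF trig_poly_quadratic(1) *] assms by blast+
  have b: "trig_poly n (\<lambda>z. cnj (x z) * y z)"
    by (rule trig_poly_mono[OF trig_poly_mult[OF trig_poly_cnj] *]) (use assms in auto)
  note p = polar_bs_density[OF a b trig_poly_continuous[OF assms(1)] trig_poly_continuous[OF assms(2)]]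
  show "integrable angle_measure (\<lambda>t. Re (herm_form (vector [x (cis t), y (cis t)]) (bs_density n \<gamma> (cis t))))"
    by (rule p(1))
  show "polar (form_integral M) x y
      = (\<integral>t. Re (herm_form (vector [x (cis t), y (cis t)]) (bs_density n \<gamma> (cis t))) \<partial>angle_measure)"
    by (rule p(2))
qed

text \<open>On vectors of order n the measure may be replaced by the density w_(2n), which is
  positive semidefinite at every point.\<close>

lemma polar_trig_nonneg:
  assumes "trig_poly n p" "trig_poly n q"
  shows "polar (form_integral M) p q \<ge> 0"
proof -
  have "Re (herm_form \<xi> (bs_density (2 * n) \<gamma> (cis t))) \<ge> 0" for \<xi> t
    using bs_density_psd(1)[of "cis t" "2 * n" \<gamma>] \<gamma>
    by (simp add: psd_matrix_def complex_nonneg_Reals_iff)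
  then show ?thesis unfolding polar_bs_density_trig(2)[OF assms order_refl]
    by (intro integral_nonneg_AE) auto
qed

text \<open>
  \<open>M\<close> is tested on the rows of the Szego polynomial \<open>E\<close>, for which the Bernstein--Szego
  density gives the exact value \<open>\<kappa>\<close>.
\<close>

lemma entropy_upper_bound:
  assumes L: "integrable angle_measure (\<lambda>t. ln (Re (det (W (cis t)))))"
    and pos: "AE t in angle_measure. Re (det (W (cis t))) > 0"
  shows "(\<integral>t. ln (Re (det (W (cis t)))) \<partial>angle_measure) / 2 \<le> ln (schur_coeff_prod n \<gamma>)"
proof -
  define E where "E = qmat n (szego_poly n \<gamma>)"
  define \<kappa> where "\<kappa> = schur_coeff_prod n \<gamma>"
  define x where "x a z = cnj (E z $ a $ 1)" for a z
  define y where "y a z = cnj (E z $ a $ 2)" for a z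
  have \<kappa>: "\<kappa> > 0" unfolding \<kappa>_def by (rule schur_coeff_prod_pos[OF \<gamma>])
  have E_cont: "continuous_on A (\<lambda>z. E z $ p $ q)" for A p q
    unfolding E_def by (intro holomorphic_on_imp_continuous_on qmat_holomorphic)
  have cont: "continuous_on A (x a)" "continuous_on A (y a)" for A a
    unfolding x_def y_def by (intro continuous_intros E_cont)+
  have trig: "trig_poly n (\<lambda>z. E z $ p $ q * cnj (E z $ p' $ q'))" for p q p' q'
    unfolding E_def by (rule trig_poly_analytic_product) (rule qmat_nth)+
  have xx: "real_trig_poly n (\<lambda>z. (norm (x a z))\<^sup>2)" "real_trig_poly n (\<lambda>z. (norm (y a z))\<^sup>2)" for a
    unfolding x_def y_def complex_norm_square using trig by (simp_all add: mult.commute)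
  have xy: "trig_poly n (\<lambda>z. cnj (x a z) * y a z)" for a
    unfolding x_def y_def using trig by simp
  have herm: "Re (herm_form (vector [x a (cis t), y a (cis t)]) (bs_density n \<gamma> (cis t))) = \<kappa>"
    if "a = 1 \<or> a = 2" for a t
  proof -
    \<comment> \<open>The test vector is the adjoint of row a of E, so E w hadj E = \<kappa>
      evaluates its form to a diagonal entry.\<close>
    define e :: "complex^2" where "e = axis a 1"
    have "vector [x a (cis t), y a (cis t)] = hadj (E (cis t)) *v e"
      using that by (auto simp: vec_eq_iff forall_2 matrix_vector_mult_def sum_2 e_def axis_def x_def y_def)
    then have "herm_form (vector [x a (cis t), y a (cis t)]) (bs_density n \<gamma> (cis t))
      = herm_form e (\<kappa> *\<^sub>R mat 1)"
      using bs_density_congruence[of "cis t" n \<gamma>] \<gamma> by (simp add: herm_form_congruence E_def \<kappa>_def)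
    also have "\<dots> = of_real \<kappa>" using that
      by (auto simp: herm_form_scaleR) (auto simp: herm_form_def sum_2 e_def axis_def)
    finally show ?thesis by simp
  qed
  have le: "(\<integral>t. Re (herm_form (vector [x a (cis t), y a (cis t)]) (W (cis t))) \<partial>angle_measure) \<le> \<kappa>"
    and int: "integrable angle_measure (\<lambda>t. Re (herm_form (vector [x a (cis t), y a (cis t)]) (W (cis t))))"
    if a: "a = 1 \<or> a = 2" for a
  proof -
    have m: "x a \<in> borel_measurable borel" "y a \<in> borel_measurable borel"
      by (intro borel_measurable_continuous_onI cont)+
    have "compact (x a ` sphere 0 1)" "compact (y a ` sphere 0 1)" by (intro compact_continuous_image cont, simp)+
    then obtain C1 C2 where C: "\<And>z. z \<in> sphere 0 1 \<Longrightarrow> norm (x a z) \<le> C1" "\<And>z. z \<in> sphere 0 1 \<Longrightarrow> norm (y a z) \<le> C2"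
      by (metis bounded_iff compact_imp_bounded imageI)
    have C': "norm (x a z) \<le> max C1 C2" "norm (y a z) \<le> max C1 C2" if "norm z = 1" for z
      using C(1)[of z] C(2)[of z] that by auto
    have "(\<integral>t. Re (herm_form (vector [x a (cis t), y a (cis t)]) (W (cis t))) \<partial>angle_measure)
      \<le> polar (form_integral M) (x a) (y a)"
      by (rule polar_ge_off_N[OF m C' polar_trig_nonneg])
    also have "\<dots> = \<kappa>"
      unfolding polar_bs_density(2)[OF xx xy cont] herm[OF a] by simp
    finally show "(\<integral>t. Re (herm_form (vector [x a (cis t), y a (cis t)]) (W (cis t))) \<partial>angle_measure) \<le> \<kappa>" .
    show "integrable angle_measure (\<lambda>t. Re (herm_form (vector [x a (cis t), y a (cis t)]) (W (cis t))))"
      by (rule polar_angle(1)[where x="x a" and y="y a" and C="max C1 C2", OF intW])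
        (use m measurable_compose[OF cis_borel_measurable] C' in auto)
  qed
  define dE where "dE t = norm (det (E (cis t)))" for t
  have dE: "dE t > 0" for t unfolding dE_def E_def using det_szego_poly_nonzero[of "cis t" n \<gamma>] \<gamma> by simp
  have ldE: "(\<integral>t. ln (dE t) \<partial>angle_measure) = 0"
    unfolding dE_def E_def by (rule mean_ln_det_szego_poly[OF \<gamma>])
  have det_cont: "continuous_on A (\<lambda>z. det (E z))" for A
    unfolding det_2 by (intro continuous_intros E_cont)
  have idE: "integrable angle_measure (\<lambda>t. ln (dE t))" unfolding dE_def
    using dE unfolding dE_def
    by (intro integrable_angle_continuous[where f="\<lambda>z. ln (norm (det (E z)))"] continuous_intros det_cont)
      (metis E_def \<gamma> det_szego_poly_nonzero less_eq_real_def mem_sphere_0 norm_eq_zero)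
  define S where "S t = Re (herm_form (vector [x 1 (cis t), y 1 (cis t)]) (W (cis t)))
     + Re (herm_form (vector [x 2 (cis t), y 2 (cis t)]) (W (cis t)))" for t
  have intS: "integrable angle_measure S" unfolding S_def using int by simp
  have "(\<integral>t. S t \<partial>angle_measure) \<le> 2 * \<kappa>"
    unfolding S_def using int[of 1] int[of 2] le[of 1] le[of 2] by simp
  \<comment> \<open>This integrates ln r \<le> r - 1 for
    \<open>r = dE t * sqrt D / \<kappa>\<close>; here \<open>dE t * sqrt D\<close> is the square
    root of det G det W and is at most half of the trace S.\<close>
  have "(\<integral>t. 1 + ln (dE t) + ln (Re (det (W (cis t)))) / 2 - ln \<kappa> \<partial>angle_measure)
    \<le> (\<integral>t. S t / (2 * \<kappa>) \<partial>angle_measure)"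
  proof (rule integral_mono_AE)
    show "AE t in angle_measure. 1 + ln (dE t) + ln (Re (det (W (cis t)))) / 2 - ln \<kappa> \<le> S t / (2 * \<kappa>)"
      using psd_W_AE pos
    proof eventually_elim
      case (elim t)
      define D where "D = Re (det (W (cis t)))"
      have "gram_det 0 (x 1 (cis t)) (y 1 (cis t)) (x 2 (cis t)) (y 2 (cis t)) = (dE t)\<^sup>2"
      proof -
        have "x 1 (cis t) * y 2 (cis t) - x 2 (cis t) * y 1 (cis t) = cnj (det (E (cis t)))"
          by (simp add: x_def y_def det_2 mult.commute)
        then show ?thesis by (simp add: gram_det_def dE_def)
      qed
      then have "2 * (dE t * sqrt D) \<le> S t"
        using herm_form_sum_ge[OF elim(1), of 0 "x 1 (cis t)" "y 1 (cis t)" "x 2 (cis t)" "y 2 (cis t)"] dE[of t]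
        by (simp add: S_def D_def)
      then have "dE t * sqrt D / \<kappa> \<le> S t / (2 * \<kappa>)" using \<kappa> by (simp add: field_simps)
      moreover have "ln (dE t * sqrt D / \<kappa>) \<le> dE t * sqrt D / \<kappa> - 1"
        using dE[of t] \<kappa> elim(2) by (intro ln_le_minus_one) (simp add: D_def)
      moreover have "ln (dE t * sqrt D / \<kappa>) = ln (dE t) + ln D / 2 - ln \<kappa>"
        using dE[of t] \<kappa> elim(2) by (simp add: D_def ln_div ln_mult ln_sqrt)
      ultimately show ?case unfolding D_def by linarith
    qed
  qed (use intS L idE in auto)
  also have "(\<integral>t. S t / (2 * \<kappa>) \<partial>angle_measure) \<le> 1"
    using \<open>(\<integral>t. S t \<partial>angle_measure) \<le> 2 * \<kappa>\<close> \<kappa> by simp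
  also have "(\<integral>t. 1 + ln (dE t) + ln (Re (det (W (cis t)))) / 2 - ln \<kappa> \<partial>angle_measure)
    = 1 + (\<integral>t. ln (Re (det (W (cis t)))) \<partial>angle_measure) / 2 - ln \<kappa>"
    using idE L ldE by simp
  finally show ?thesis unfolding \<kappa>_def by simp
qed

end

section \<open>The lower entropy bound\<close>

lemma gram_det_ge: "\<epsilon> \<ge> 0 \<Longrightarrow> \<epsilon>\<^sup>2 \<le> gram_det \<epsilon> x1 y1 x2 y2"
  by (simp add: gram_det_def)

lemma gram_det_one_le:
  assumes "norm x1 \<le> K" "norm y1 \<le> K" "norm x2 \<le> K" "norm y2 \<le> K"
  shows "gram_det 1 x1 y1 x2 y2 \<le> (2 * K\<^sup>2)\<^sup>2 + 4 * K\<^sup>2 + 1"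
proof -
  have K: "K \<ge> 0" using assms(1) norm_ge_zero order_trans by blast
  have "norm (x1 * y2 - x2 * y1) \<le> norm (x1 * y2) + norm (x2 * y1)" by (rule norm_triangle_ineq4)
  also have "\<dots> \<le> K * K + K * K" unfolding norm_mult using assms K by (intro add_mono mult_mono) auto
  finally have "norm (x1 * y2 - x2 * y1) \<le> 2 * K\<^sup>2" by (simp add: power2_eq_square)
  then have "(norm (x1 * y2 - x2 * y1))\<^sup>2 \<le> (2 * K\<^sup>2)\<^sup>2" by (intro power_mono) auto
  moreover have "(norm x1)\<^sup>2 \<le> K\<^sup>2" "(norm y1)\<^sup>2 \<le> K\<^sup>2" "(norm x2)\<^sup>2 \<le> K\<^sup>2" "(norm y2)\<^sup>2 \<le> K\<^sup>2"
    using assms by (auto intro: power_mono)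
  ultimately show ?thesis by (simp add: gram_det_def)
qed

lemma gram_det_measurable [measurable]:
  assumes [measurable]: "x1 \<in> borel_measurable M" "y1 \<in> borel_measurable M" "x2 \<in> borel_measurable M" "y2 \<in> borel_measurable M"
  shows "(\<lambda>z. gram_det \<epsilon> (x1 z) (y1 z) (x2 z) (y2 z)) \<in> borel_measurable M"
  unfolding gram_det_def by measurable

context szego_setting
begin

text \<open>Products of test components of order m have order 2 m, so M may be replaced by w_n with
  n = 2 m. The trace inequality with \<epsilon> = 1 then brings in det w_n, whose logarithm has mean
  2 ln kappa_n because ln |det E| has mean 0.\<close>

lemma entropy_lower_bound_trig:
  assumes t: "trig_poly m x1" "trig_poly m y1" "trig_poly m x2" "trig_poly m y2"
    and \<kappa>: "\<kappa> > 0" "\<And>n. \<kappa> \<le> schur_coeff_prod n \<gamma>"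
  shows "(\<integral>t. ln (gram_det 1 (x1 (cis t)) (y1 (cis t)) (x2 (cis t)) (y2 (cis t))) \<partial>angle_measure) + 2 * ln \<kappa>
    \<le> polar (form_integral M) x1 y1 + polar (form_integral M) x2 y2"
proof -
  define n where "n = 2 * m"
  define w where "w t = bs_density n \<gamma> (cis t)" for t
  define dE where "dE t = norm (det (qmat n (szego_poly n \<gamma>) (cis t)))" for t
  define G where "G t = gram_det 1 (x1 (cis t)) (y1 (cis t)) (x2 (cis t)) (y2 (cis t))" for t
  define h1 where "h1 t = Re (herm_form (vector [x1 (cis t), y1 (cis t)]) (w t))" for t
  define h2 where "h2 t = Re (herm_form (vector [x2 (cis t), y2 (cis t)]) (w t))" for t
  have h: "integrable angle_measure h1" "integrable angle_measure h2"
    "integral\<^sup>L angle_measure h1 = polar (form_integral M) x1 y1"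
    "integral\<^sup>L angle_measure h2 = polar (form_integral M) x2 y2"
    using polar_bs_density_trig[OF t(1,2), of n] polar_bs_density_trig[OF t(3,4), of n]
    by (simp_all add: h1_def[abs_def] h2_def[abs_def] w_def n_def)
  have w_entry: "integrable angle_measure (\<lambda>t. w t $ p $ p)" "(\<integral>t. w t $ p $ p \<partial>angle_measure) = 1" for p
    using integrable_bounded_linear[OF bounded_linear_compose[OF bounded_linear_vec_nth[of p]
          bounded_linear_vec_nth[of p]] integrable_bs_density[OF \<gamma>, of n]]
      bs_density_moment[OF f \<gamma> c, of 0 n p p]
    by (simp_all add: w_def c(2) chi_1) (simp_all add: mat_def)
  have w_tr: "integrable angle_measure (\<lambda>t. Re (w t $ p $ p))" "(\<integral>t. Re (w t $ p $ p) \<partial>angle_measure) = 1" for p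
    using integrable_Re[OF w_entry(1)] integral_Re[OF w_entry(1), of p] w_entry(2)[of p] by simp_all
  have dE: "dE t > 0" for t unfolding dE_def using det_szego_poly_nonzero[of "cis t" n \<gamma>] \<gamma> by simp
  have ldE: "(\<integral>t. ln (dE t) \<partial>angle_measure) = 0"
    unfolding dE_def by (rule mean_ln_det_szego_poly[OF \<gamma>])
  have idE: "integrable angle_measure (\<lambda>t. ln (dE t))"
  proof -
    have "continuous_on (sphere 0 1) (\<lambda>z. ln (norm (det (qmat n (szego_poly n \<gamma>) z))))"
      using det_szego_poly_nonzero[of _ n \<gamma>] \<gamma>
      by (intro continuous_intros holomorphic_on_imp_continuous_on det_qmat_holomorphic) auto
    then show ?thesis unfolding dE_def by (rule integrable_angle_continuous)
  qed
  have G1: "G t \<ge> 1" for t using gram_det_ge[of 1] by (simp add: G_def)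
  have iG: "integrable angle_measure (\<lambda>t. ln (G t))"
  proof -
    have pos: "gram_det 1 (x1 z) (y1 z) (x2 z) (y2 z) \<noteq> 0" for z
      using gram_det_ge[of 1 "x1 z" "y1 z" "x2 z" "y2 z"] by simp
    have "continuous_on (sphere 0 1) (\<lambda>z. gram_det 1 (x1 z) (y1 z) (x2 z) (y2 z))"
      unfolding gram_det_def by (intro continuous_intros t[THEN trig_poly_continuous])
    then have "continuous_on (sphere 0 1) (\<lambda>z. ln (gram_det 1 (x1 z) (y1 z) (x2 z) (y2 z)))"
      using pos by (intro continuous_on_ln) auto
    then show ?thesis unfolding G_def by (rule integrable_angle_continuous)
  qed
  \<comment> \<open>The 2 on the left comes from doubling ln r \<le> r - 1; on the right the trace
    of w has mean 2, and the two cancel.\<close>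
  have "(\<integral>t. 2 + ln (G t) + 2 * ln \<kappa> - 2 * ln (dE t) \<partial>angle_measure)
    \<le> (\<integral>t. h1 t + h2 t + (Re (w t $ 1 $ 1) + Re (w t $ 2 $ 2)) \<partial>angle_measure)"
  proof (rule integral_mono_AE)
    show "AE t in angle_measure. 2 + ln (G t) + 2 * ln \<kappa> - 2 * ln (dE t)
        \<le> h1 t + h2 t + (Re (w t $ 1 $ 1) + Re (w t $ 2 $ 2))"
    proof (rule AE_I2)
      fix t
      have psd: "psd_matrix (w t)" "Re (det (w t)) = (schur_coeff_prod n \<gamma> / dE t)\<^sup>2"
        unfolding w_def dE_def using \<gamma> by (intro bs_density_psd; simp)+
      have \<kappa>n: "schur_coeff_prod n \<gamma> > 0" using \<kappa>(1) \<kappa>(2)[of n] by linarith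
      have "sqrt (Re (det (w t))) = schur_coeff_prod n \<gamma> / dE t"
        using \<kappa>n dE[of t] unfolding psd(2) by simp
      then have ge: "2 * (sqrt (G t) * (schur_coeff_prod n \<gamma> / dE t))
        \<le> h1 t + h2 t + (Re (w t $ 1 $ 1) + Re (w t $ 2 $ 2))"
        using herm_form_sum_ge[OF psd(1), of 1 "x1 (cis t)" "y1 (cis t)" "x2 (cis t)" "y2 (cis t)"]
        by (simp add: G_def h1_def h2_def)
      have "ln (sqrt (G t) * (schur_coeff_prod n \<gamma> / dE t)) \<le> sqrt (G t) * (schur_coeff_prod n \<gamma> / dE t) - 1"
        using G1[of t] \<kappa>n dE[of t] by (intro ln_le_minus_one) simp
      moreover have "ln (sqrt (G t) * (schur_coeff_prod n \<gamma> / dE t)) = ln (G t) / 2 + ln (schur_coeff_prod n \<gamma>) - ln (dE t)"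
        using G1[of t] \<kappa>n dE[of t] by (simp add: ln_div ln_mult ln_sqrt)
      moreover have "ln \<kappa> \<le> ln (schur_coeff_prod n \<gamma>)" using \<kappa>(1) \<kappa>(2)[of n] by simp
      ultimately show "2 + ln (G t) + 2 * ln \<kappa> - 2 * ln (dE t)
        \<le> h1 t + h2 t + (Re (w t $ 1 $ 1) + Re (w t $ 2 $ 2))"
        using ge by linarith
    qed
  qed (use iG idE h w_tr in auto)
  also have "(\<integral>t. 2 + ln (G t) + 2 * ln \<kappa> - 2 * ln (dE t) \<partial>angle_measure)
    = 2 + (\<integral>t. ln (G t) \<partial>angle_measure) + 2 * ln \<kappa>"
    using iG idE ldE by simp
  also have "(\<integral>t. h1 t + h2 t + (Re (w t $ 1 $ 1) + Re (w t $ 2 $ 2)) \<partial>angle_measure)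
    = polar (form_integral M) x1 y1 + polar (form_integral M) x2 y2 + 2"
    using h w_tr by simp
  finally show ?thesis unfolding G_def by simp
qed

text \<open>The components are approximated one by one. The uniform bound K and the summand 1
  confine the Gram determinants to [1, B], so both the logarithms and the \<open>polar\<close> terms
  pass to the limit by dominated convergence.\<close>

lemma entropy_lower_bound_bounded:
  assumes m[measurable]: "x1 \<in> borel_measurable borel" "y1 \<in> borel_measurable borel"
      "x2 \<in> borel_measurable borel" "y2 \<in> borel_measurable borel"
    and C: "\<And>z. norm (x1 z) \<le> C" "\<And>z. norm (y1 z) \<le> C" "\<And>z. norm (x2 z) \<le> C" "\<And>z. norm (y2 z) \<le> C"
    and \<kappa>: "\<kappa> > 0" "\<And>n. \<kappa> \<le> schur_coeff_prod n \<gamma>"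
  shows "(\<integral>t. ln (gram_det 1 (x1 (cis t)) (y1 (cis t)) (x2 (cis t)) (y2 (cis t))) \<partial>angle_measure) + 2 * ln \<kappa>
    \<le> polar (form_integral M) x1 y1 + polar (form_integral M) x2 y2"
proof -
  define K where "K = 2 * C + 2"
  have fin: "finite polar_vectors" by simp
  have ex: "\<exists>p. (\<forall>m. \<exists>n. trig_poly n (p m)) \<and> (\<forall>m z. norm z = 1 \<longrightarrow> norm (p m z) \<le> K) \<and>
    (AE t in angle_measure. (\<lambda>m. p m (cis t)) \<longlonglongrightarrow> x (cis t)) \<and>
    (\<forall>\<xi>\<in>polar_vectors. AE z in form_measure M \<xi>. (\<lambda>m. p m z) \<longlonglongrightarrow> x z)"
    if "x \<in> borel_measurable borel" "\<And>z. norm (x z) \<le> C" for x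
    unfolding K_def by (rule trig_poly_approx_circle[OF M that fin])
  obtain p1 where p1: "\<And>m. \<exists>n. trig_poly n (p1 m)" "\<And>m z. norm z = 1 \<Longrightarrow> norm (p1 m z) \<le> K"
    "AE t in angle_measure. (\<lambda>m. p1 m (cis t)) \<longlonglongrightarrow> x1 (cis t)"
    "\<And>\<xi>. \<xi> \<in> polar_vectors \<Longrightarrow> AE z in form_measure M \<xi>. (\<lambda>m. p1 m z) \<longlonglongrightarrow> x1 z"
    using ex[OF m(1) C(1)] by blast
  obtain q1 where q1: "\<And>m. \<exists>n. trig_poly n (q1 m)" "\<And>m z. norm z = 1 \<Longrightarrow> norm (q1 m z) \<le> K"
    "AE t in angle_measure. (\<lambda>m. q1 m (cis t)) \<longlonglongrightarrow> y1 (cis t)"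
    "\<And>\<xi>. \<xi> \<in> polar_vectors \<Longrightarrow> AE z in form_measure M \<xi>. (\<lambda>m. q1 m z) \<longlonglongrightarrow> y1 z"
    using ex[OF m(2) C(2)] by blast
  obtain p2 where p2: "\<And>m. \<exists>n. trig_poly n (p2 m)" "\<And>m z. norm z = 1 \<Longrightarrow> norm (p2 m z) \<le> K"
    "AE t in angle_measure. (\<lambda>m. p2 m (cis t)) \<longlonglongrightarrow> x2 (cis t)"
    "\<And>\<xi>. \<xi> \<in> polar_vectors \<Longrightarrow> AE z in form_measure M \<xi>. (\<lambda>m. p2 m z) \<longlonglongrightarrow> x2 z"
    using ex[OF m(3) C(3)] by blast
  obtain q2 where q2: "\<And>m. \<exists>n. trig_poly n (q2 m)" "\<And>m z. norm z = 1 \<Longrightarrow> norm (q2 m z) \<le> K"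
    "AE t in angle_measure. (\<lambda>m. q2 m (cis t)) \<longlonglongrightarrow> y2 (cis t)"
    "\<And>\<xi>. \<xi> \<in> polar_vectors \<Longrightarrow> AE z in form_measure M \<xi>. (\<lambda>m. q2 m z) \<longlonglongrightarrow> y2 z"
    using ex[OF m(4) C(4)] by blast
  define G where "G m z = gram_det 1 (p1 m z) (q1 m z) (p2 m z) (q2 m z)" for m z
  define B where "B = (2 * K\<^sup>2)\<^sup>2 + 4 * K\<^sup>2 + 1"
  have G: "1 \<le> G m (cis t)" "G m (cis t) \<le> B" for m t
    using gram_det_ge[of 1] gram_det_one_le[OF p1(2)[where m=m and z="cis t"] q1(2)[where m=m and z="cis t"]
        p2(2)[where m=m and z="cis t"] q2(2)[where m=m and z="cis t"]]
    by (simp_all add: G_def B_def)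
  have meas: "(\<lambda>t. r m (cis t)) \<in> borel_measurable borel" if "\<exists>n. trig_poly n (r m)" for r :: "nat \<Rightarrow> complex \<Rightarrow> complex" and m
    using that by (intro borel_measurable_continuous_onI continuous_on_cis_compose) (auto intro: trig_poly_continuous)
  have "(\<lambda>m. \<integral>t. ln (G m (cis t)) \<partial>angle_measure)
    \<longlonglongrightarrow> (\<integral>t. ln (gram_det 1 (x1 (cis t)) (y1 (cis t)) (x2 (cis t)) (y2 (cis t))) \<partial>angle_measure)"
  proof (rule integral_dominated_convergence[where w="\<lambda>_. ln B"])
    show "AE t in angle_measure. (\<lambda>m. ln (G m (cis t))) \<longlonglongrightarrow> ln (gram_det 1 (x1 (cis t)) (y1 (cis t)) (x2 (cis t)) (y2 (cis t)))"
      using p1(3) q1(3) p2(3) q2(3)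
    proof eventually_elim
      case (elim t)
      have nz: "gram_det 1 (x1 (cis t)) (y1 (cis t)) (x2 (cis t)) (y2 (cis t)) \<noteq> 0"
        using gram_det_ge[of 1 "x1 (cis t)" "y1 (cis t)" "x2 (cis t)" "y2 (cis t)"] by simp
      have "(\<lambda>m. G m (cis t)) \<longlonglongrightarrow> gram_det 1 (x1 (cis t)) (y1 (cis t)) (x2 (cis t)) (y2 (cis t))"
        unfolding G_def gram_det_def by (intro tendsto_intros elim)
      then show ?case by (rule tendsto_ln) (rule nz)
    qed
    show "AE t in angle_measure. norm (ln (G m (cis t))) \<le> ln B" for m
    proof (rule AE_I2)
      fix t
      have "0 < G m (cis t)" "0 < B" using G[of m t] by linarith+
      then show "norm (ln (G m (cis t))) \<le> ln B" using G[of m t] by simp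
    qed
    have mG: "(\<lambda>t. G m (cis t)) \<in> borel_measurable borel" for m
      unfolding G_def by (rule gram_det_measurable) (rule meas, rule p1 q1 p2 q2)+
    show "(\<lambda>t. ln (G m (cis t))) \<in> borel_measurable angle_measure" for m
      using borel_measurable_ln[OF mG[of m]] by simp
    show "(\<lambda>t. ln (gram_det 1 (x1 (cis t)) (y1 (cis t)) (x2 (cis t)) (y2 (cis t)))) \<in> borel_measurable angle_measure"
      by measurable
  qed simp
  then have "(\<lambda>m. (\<integral>t. ln (G m (cis t)) \<partial>angle_measure) + 2 * ln \<kappa>)
    \<longlonglongrightarrow> (\<integral>t. ln (gram_det 1 (x1 (cis t)) (y1 (cis t)) (x2 (cis t)) (y2 (cis t))) \<partial>angle_measure) + 2 * ln \<kappa>"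
    by (intro tendsto_add tendsto_const)
  moreover have "(\<lambda>m. polar (form_integral M) (p1 m) (q1 m) + polar (form_integral M) (p2 m) (q2 m))
    \<longlonglongrightarrow> polar (form_integral M) x1 y1 + polar (form_integral M) x2 y2"
    by (intro tendsto_add polar_form_integral_limit[OF M p1(1) q1(1) p1(2) q1(2) m(1,2) p1(4) q1(4)]
        polar_form_integral_limit[OF M p2(1) q2(1) p2(2) q2(2) m(3,4) p2(4) q2(4)])
  moreover have "(\<integral>t. ln (G m (cis t)) \<partial>angle_measure) + 2 * ln \<kappa>
    \<le> polar (form_integral M) (p1 m) (q1 m) + polar (form_integral M) (p2 m) (q2 m)" for m
  proof -
    obtain n1 n2 n3 n4 where n: "trig_poly n1 (p1 m)" "trig_poly n2 (q1 m)" "trig_poly n3 (p2 m)" "trig_poly n4 (q2 m)"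
      using p1(1) q1(1) p2(1) q2(1) by blast
    define k where "k = max (max n1 n2) (max n3 n4)"
    have "n1 \<le> k" "n2 \<le> k" "n3 \<le> k" "n4 \<le> k" by (simp_all add: k_def)
    then show ?thesis unfolding G_def
      by (intro entropy_lower_bound_trig[where m=k] \<kappa> trig_poly_mono[OF n(1)] trig_poly_mono[OF n(2)]
          trig_poly_mono[OF n(3)] trig_poly_mono[OF n(4)])
  qed
  ultimately show ?thesis by (intro LIMSEQ_le) auto
qed

end

text \<open>
  With \<open>V = ((p + \<delta>, q), (cnj q, s + \<delta>))\<close> the vectors \<open>(x, y)\<close> and \<open>(0, y')\<close> are the columns of
  \<open>R\<^sup>*\<close> for the Cholesky factorization \<open>V\<^sup>-\<^sup>1 = R\<^sup>* R\<close>.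
\<close>

lemma cholesky_bounds:
  fixes p s \<delta> :: real and q :: complex
  assumes "\<delta> > 0" "p \<ge> 0" "s \<ge> 0" "(norm q)\<^sup>2 \<le> p * s"
  defines "a \<equiv> p + \<delta>" and "d \<equiv> s + \<delta>"
  defines "\<Delta> \<equiv> a * d - (norm q)\<^sup>2"
  defines "x \<equiv> complex_of_real (sqrt (d / \<Delta>))" and "y \<equiv> - cnj q / complex_of_real (sqrt (d * \<Delta>))"
    and "y' \<equiv> complex_of_real (1 / sqrt d)"
  shows "\<delta>\<^sup>2 \<le> \<Delta>" "ln \<Delta> \<le> p + s + 2 * \<delta>"
    and "norm x \<le> sqrt (1 / \<delta>)" "norm y \<le> sqrt (1 / \<delta>)" "norm y' \<le> sqrt (1 / \<delta>)"
    and "p * (norm x)\<^sup>2 + 2 * Re (cnj x * y * q) + s * (norm y)\<^sup>2 \<le> 1" "s * (norm y')\<^sup>2 \<le> 1"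
    and "1 / \<Delta> \<le> gram_det 1 x y 0 y'"
proof -
  \<comment> \<open>det V splits into the determinant without regularization, \<delta> times the
    trace, and \<delta>^2. All are nonnegative, and each lower bound on \<Delta> keeps some of the
    terms.\<close>
  have \<Delta>: "\<Delta> = (p * s - (norm q)\<^sup>2) + \<delta> * (p + s) + \<delta>\<^sup>2"
    by (simp add: \<Delta>_def a_def d_def power2_eq_square algebra_simps)
  show "\<delta>\<^sup>2 \<le> \<Delta>" unfolding \<Delta> using assms(1-4) by simp
  then have \<Delta>0: "\<Delta> > 0" using assms(1) zero_less_power[of \<delta> 2] by linarith
  have d0: "d > 0" and a0: "a > 0" using assms(1-3) by (simp_all add: a_def d_def)
  have nn: "\<delta> * p \<ge> 0" "\<delta> * s \<ge> 0" "\<delta>\<^sup>2 \<ge> 0" using assms(1-3) by simp_all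
  have \<Delta>d: "\<delta> * d \<le> \<Delta>" and \<Delta>p: "\<delta> * p \<le> \<Delta>"
  proof -
    have "\<Delta> - \<delta> * d = (p * s - (norm q)\<^sup>2) + \<delta> * p" "\<Delta> - \<delta> * p = (p * s - (norm q)\<^sup>2) + \<delta> * s + \<delta>\<^sup>2"
      unfolding \<Delta> by (simp_all add: d_def power2_eq_square algebra_simps)
    then show "\<delta> * d \<le> \<Delta>" "\<delta> * p \<le> \<Delta>" using nn assms(4) by linarith+
  qed
  have x2: "(norm x)\<^sup>2 = d / \<Delta>" using d0 \<Delta>0 by (simp add: x_def)
  have y2: "(norm y)\<^sup>2 = (norm q)\<^sup>2 / (d * \<Delta>)" using d0 \<Delta>0 by (simp add: y_def norm_divide power_divide)
  have y'2: "(norm y')\<^sup>2 = 1 / d" using d0 by (simp add: y'_def norm_divide power_divide)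
  have "ln \<Delta> \<le> ln (a * d)" using \<Delta>0 by (intro ln_mono) (simp_all add: \<Delta>_def)
  also have "\<dots> = ln a + ln d" using a0 d0 by (simp add: ln_mult)
  also have "\<dots> \<le> (a - 1) + (d - 1)" using a0 d0 by (intro add_mono ln_le_minus_one)
  finally show "ln \<Delta> \<le> p + s + 2 * \<delta>" by (simp add: a_def d_def)
  have "d / \<Delta> \<le> 1 / \<delta>" using \<Delta>d \<Delta>0 assms(1) by (simp add: field_simps)
  then show "norm x \<le> sqrt (1 / \<delta>)" using x2 by (intro real_le_rsqrt) simp
  have "p * d = p * s + \<delta> * p" by (simp add: d_def algebra_simps)
  then have "(norm q)\<^sup>2 \<le> p * d" using nn(1) assms(4) by linarith
  then have "(norm q)\<^sup>2 / (d * \<Delta>) \<le> p * d / (d * \<Delta>)" using d0 \<Delta>0 by (intro divide_right_mono) auto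
  also have "\<dots> = p / \<Delta>" using d0 by simp
  also have "\<dots> \<le> 1 / \<delta>" using \<Delta>p \<Delta>0 assms(1) by (simp add: field_simps)
  finally show "norm y \<le> sqrt (1 / \<delta>)" using y2 by (intro real_le_rsqrt) simp
  have "1 / d \<le> 1 / \<delta>" using assms by (simp add: d_def frac_le)
  then show "norm y' \<le> sqrt (1 / \<delta>)" using y'2 by (intro real_le_rsqrt) simp
  have sq: "sqrt (d / \<Delta>) / sqrt (d * \<Delta>) = 1 / \<Delta>"
    using d0 \<Delta>0 by (simp add: real_sqrt_divide real_sqrt_mult field_simps)
  have "cnj x * y * q = - of_real (sqrt (d / \<Delta>) / sqrt (d * \<Delta>)) * (q * cnj q)"
    by (simp add: x_def y_def)
  also have "\<dots> = of_real (- (norm q)\<^sup>2 / \<Delta>)"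
    unfolding sq complex_norm_square[symmetric] by simp
  finally have xyq: "Re (cnj x * y * q) = - (norm q)\<^sup>2 / \<Delta>" by (simp only: Re_complex_of_real)
  \<comment> \<open>For V itself the form of the column (x, y) is exactly 1; lowering a to p and d
    to s can only decrease it.\<close>
  have "p * (d / \<Delta>) \<le> a * (d / \<Delta>)" using assms(1) d0 \<Delta>0 by (intro mult_right_mono) (auto simp: a_def)
  moreover have "s * ((norm q)\<^sup>2 / (d * \<Delta>)) \<le> d * ((norm q)\<^sup>2 / (d * \<Delta>))"
    using assms(1) d0 \<Delta>0 by (intro mult_right_mono) (auto simp: d_def)
  moreover have "d * ((norm q)\<^sup>2 / (d * \<Delta>)) = (norm q)\<^sup>2 / \<Delta>" using d0 by simp
  moreover have "a * (d / \<Delta>) - (norm q)\<^sup>2 / \<Delta> = 1"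
    using \<Delta>0 by (simp add: diff_divide_distrib[symmetric]) (simp add: \<Delta>_def)
  ultimately show "p * (norm x)\<^sup>2 + 2 * Re (cnj x * y * q) + s * (norm y)\<^sup>2 \<le> 1"
    unfolding x2 y2 xyq by linarith
  show "s * (norm y')\<^sup>2 \<le> 1" unfolding y'2 using d0 assms(1) by (simp add: d_def)
  \<comment> \<open>The triangular factor has determinant of modulus |x y'|, so this is det V^-1;
    the other summands of \<open>gram_det\<close> are nonnegative.\<close>
  have "(norm (x * y'))\<^sup>2 = 1 / \<Delta>" using d0 by (simp add: norm_mult power_mult_distrib x2 y'2)
  then show "1 / \<Delta> \<le> gram_det 1 x y 0 y'" by (simp add: gram_det_def)
qed

context szego_setting
begin

text \<open>Measurability is known only for \<open>\<lambda>t. W (cis t)\<close>. Composition with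
  the Borel section \<open>Im (Ln z)\<close> gives a Borel function on the plane that agrees with W
  on the circle.\<close>

definition W_meas :: "complex \<Rightarrow> complex^2^2" where
  "W_meas z = W (cis (Im (Ln z)))"

lemma W_meas_cis [simp]: "W_meas (cis t) = W (cis t)"
  by (simp add: W_meas_def cis_Im_Ln)

lemma W_entry_measurable [measurable]: "(\<lambda>z. W_meas z $ a $ b) \<in> borel_measurable borel"
proof -
  have "(\<lambda>t. W (cis t)) \<in> borel_measurable borel" using borel_measurable_integrable[OF intW] by simp
  then have "(\<lambda>z. W (cis (Im (Ln z)))) \<in> borel_measurable borel"
    by (rule measurable_compose[rotated]) measurable
  moreover have "(\<lambda>A::complex^2^2. A $ a $ b) \<in> borel_measurable borel"
    by (intro borel_measurable_continuous_onI continuous_intros)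
  ultimately show ?thesis unfolding W_meas_def by (rule measurable_compose)
qed

lemma integrable_W_entry: "integrable angle_measure (\<lambda>t. W (cis t) $ a $ b)"
  by (rule integrable_bounded_linear[OF bounded_linear_compose[OF bounded_linear_vec_nth[of b]
          bounded_linear_vec_nth[of a]] intW])

text \<open>For positive semidefinite W this is det (W + \<delta>), the \<Delta> of
  \<open>cholesky_bounds\<close>; written in the entries it stays real and measurable
  everywhere.\<close>

definition reg_det :: "real \<Rightarrow> complex \<Rightarrow> real" where
  "reg_det \<delta> z = (Re (W_meas z $ 1 $ 1) + \<delta>) * (Re (W_meas z $ 2 $ 2) + \<delta>) - (norm (W_meas z $ 1 $ 2))\<^sup>2"

lemma reg_det_measurable [measurable]: "reg_det \<delta> \<in> borel_measurable borel"
  unfolding reg_det_def by measurable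

definition tr_W :: "real \<Rightarrow> real" where
  "tr_W t = Re (W (cis t) $ 1 $ 1) + Re (W (cis t) $ 2 $ 2)"

lemma integrable_tr_W: "integrable angle_measure tr_W"
  unfolding tr_W_def by (intro Bochner_Integration.integrable_add integrable_Re integrable_W_entry)

lemma reg_det_bounds:
  assumes "\<delta> > 0" "psd_matrix (W (cis t))"
  shows "\<delta>\<^sup>2 \<le> reg_det \<delta> (cis t)" "ln (reg_det \<delta> (cis t)) \<le> tr_W t + 2 * \<delta>"
  using cholesky_bounds(1,2)[OF assms(1) psd_matrix_entries(4-6)[OF assms(2)]]
  by (simp_all add: reg_det_def tr_W_def)

lemma integrable_ln_reg_det:
  assumes "\<delta> > 0"
  shows "integrable angle_measure (\<lambda>t. ln (reg_det \<delta> (cis t)))"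
proof (rule Bochner_Integration.integrable_bound[where f="\<lambda>t. tr_W t + (2 * \<delta> + 2 * \<bar>ln \<delta>\<bar>)"])
  show "integrable angle_measure (\<lambda>t. tr_W t + (2 * \<delta> + 2 * \<bar>ln \<delta>\<bar>))"
    by (intro Bochner_Integration.integrable_add integrable_tr_W angle.integrable_const)
  show "AE t in angle_measure. norm (ln (reg_det \<delta> (cis t))) \<le> norm (tr_W t + (2 * \<delta> + 2 * \<bar>ln \<delta>\<bar>))"
    using psd_W_AE
  proof eventually_elim
    case (elim t)
    have tr: "tr_W t \<ge> 0" using psd_matrix_entries(4,5)[OF elim] by (simp add: tr_W_def)
    have "ln (\<delta>\<^sup>2) \<le> ln (reg_det \<delta> (cis t))"
      using reg_det_bounds(1)[OF assms elim] assms zero_less_power[OF assms, of 2]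
      by (intro ln_mono) linarith+
    then have "2 * ln \<delta> \<le> ln (reg_det \<delta> (cis t))" using assms by (simp add: ln_realpow)
    then show ?case using reg_det_bounds(2)[OF assms elim] tr assms unfolding real_norm_def by linarith
  qed
qed measurable

text \<open>The test vectors are the columns of the Cholesky factor of (W + \<delta>)^-1, set to 0
  on N. Each contributes at most 1 to the trace, which is the origin of the constant 2, and the Gram
  determinant is at least 1 / det (W + \<delta>). No constant depends on \<delta>.\<close>

lemma entropy_lower_bound:
  assumes \<delta>: "\<delta> > 0" and \<kappa>: "\<kappa> > 0" "\<And>n. \<kappa> \<le> schur_coeff_prod n \<gamma>"
  shows "2 * ln \<kappa> - 2 \<le> (\<integral>t. ln (reg_det \<delta> (cis t)) \<partial>angle_measure)"
proof -
  define p where "p z = Re (W_meas z $ 1 $ 1)" for z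
  define s where "s z = Re (W_meas z $ 2 $ 2)" for z
  define q where "q z = W_meas z $ 1 $ 2" for z
  \<comment> \<open>The Cholesky bounds hold only where the entries are those of a positive
    semidefinite matrix. Cutting off to this set makes the test functions bounded everywhere and
    changes them only on a null set of angles.\<close>
  define good where "good = {z. 0 \<le> p z \<and> 0 \<le> s z \<and> (norm (q z))\<^sup>2 \<le> p z * s z}"
  have [measurable]: "p \<in> borel_measurable borel" "s \<in> borel_measurable borel" "q \<in> borel_measurable borel"
    unfolding p_def s_def q_def by measurable
  have good_meas[measurable]: "good \<in> sets borel" unfolding good_def by measurable
  define x where "x z = indicator good z * complex_of_real (sqrt ((s z + \<delta>) / reg_det \<delta> z))" for z
  define y where "y z = indicator good z * (- cnj (q z) / complex_of_real (sqrt ((s z + \<delta>) * reg_det \<delta> z)))" for z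
  define y' where "y' z = indicator good z * complex_of_real (1 / sqrt (s z + \<delta>))" for z
  have xm[measurable]: "x \<in> borel_measurable borel" and ym[measurable]: "y \<in> borel_measurable borel"
    and y'm[measurable]: "y' \<in> borel_measurable borel"
    unfolding x_def y_def y'_def by measurable
  have reg: "reg_det \<delta> z = (p z + \<delta>) * (s z + \<delta>) - (norm (q z))\<^sup>2" for z
    by (simp add: reg_det_def p_def q_def s_def)
  define C where "C = sqrt (1 / \<delta>)"
  have C0: "C \<ge> 0" using \<delta> by (simp add: C_def)
  note ch = cholesky_bounds[OF \<delta>, of "p z" "s z" "q z" for z, folded reg]
  have C: "norm (x z) \<le> C" "norm (y z) \<le> C" "norm (y' z) \<le> C" for z
    using ch(3-5)[of z] C0 unfolding x_def y_def y'_def C_def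
    by (auto simp: good_def indicator_def)
  have good_AE: "AE t in angle_measure. cis t \<in> good"
    using psd_W_AE
  proof eventually_elim
    case (elim t)
    then show ?case using psd_matrix_entries(4-6)[OF elim] by (simp add: good_def p_def q_def s_def)
  qed
  \<comment> \<open>Vanishing on N removes the singular part from \<open>polar\<close>, while the
    integral over the angle does not notice N.\<close>
  define X where "X z = indicator (- N) z * x z" for z
  define Y where "Y z = indicator (- N) z * y z" for z
  define Y' where "Y' z = indicator (- N) z * y' z" for z
  have XYm[measurable]: "X \<in> borel_measurable borel" "Y \<in> borel_measurable borel" "Y' \<in> borel_measurable borel"
    unfolding X_def Y_def Y'_def by measurable
  have XC: "norm (X z) \<le> C" "norm (Y z) \<le> C" "norm (Y' z) \<le> C" for z
    using C[of z] C0 by (auto simp: X_def Y_def Y'_def indicator_def)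
  let ?G = "\<lambda>t. gram_det 1 (X (cis t)) (Y (cis t)) 0 (Y' (cis t))"
  have "(\<integral>t. ln (?G t) \<partial>angle_measure) + 2 * ln \<kappa>
    \<le> polar (form_integral M) X Y + polar (form_integral M) (\<lambda>_. 0) Y'"
    by (rule entropy_lower_bound_bounded[OF _ _ _ _ XC(1,2) _ XC(3) \<kappa>]) (measurable, simp add: C0)
  also have "polar (form_integral M) X Y = (\<integral>t. Re (herm_form (vector [x (cis t), y (cis t)]) (W (cis t))) \<partial>angle_measure)"
    unfolding X_def[abs_def] Y_def[abs_def] by (rule polar_off_N[OF xm ym C(1,2)])
  also have "\<dots> \<le> (\<integral>t. 1 \<partial>angle_measure)"
  proof (rule integral_mono_AE)
    show "integrable angle_measure (\<lambda>t. Re (herm_form (vector [x (cis t), y (cis t)]) (W (cis t))))"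
      by (rule polar_angle(1)[where x=x and y=y and C=C, OF intW _ _ C(1,2)]) measurable
    show "AE t in angle_measure. Re (herm_form (vector [x (cis t), y (cis t)]) (W (cis t))) \<le> 1"
      using good_AE psd_W_AE
    proof eventually_elim
      case (elim t)
      then show ?case using ch(6)[of "cis t"]
        by (simp add: Re_herm_form_psd good_def p_def q_def s_def x_def y_def)
    qed
  qed simp
  also have "polar (form_integral M) (\<lambda>_. 0) Y' = (\<integral>t. Re (herm_form (vector [0, y' (cis t)]) (W (cis t))) \<partial>angle_measure)"
    using polar_off_N[where x="\<lambda>_. 0" and y=y' and C=C] C(3) C0 unfolding Y'_def[abs_def] by simp
  also have "\<dots> \<le> (\<integral>t. 1 \<partial>angle_measure)"
  proof (rule integral_mono_AE)
    show "integrable angle_measure (\<lambda>t. Re (herm_form (vector [0, y' (cis t)]) (W (cis t))))"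
      using polar_angle(1)[where x="\<lambda>_. 0" and y=y' and C=C, OF intW] C(3) C0 by simp
    show "AE t in angle_measure. Re (herm_form (vector [0, y' (cis t)]) (W (cis t))) \<le> 1"
      using good_AE psd_W_AE
    proof eventually_elim
      case (elim t)
      then show ?case using ch(7)[of "cis t"]
        by (simp add: Re_herm_form_psd good_def p_def q_def s_def y'_def)
    qed
  qed simp
  finally have upper: "(\<integral>t. ln (?G t) \<partial>angle_measure) + 2 * ln \<kappa> \<le> 2" by simp
  have "(\<integral>t. - ln (reg_det \<delta> (cis t)) \<partial>angle_measure) \<le> (\<integral>t. ln (?G t) \<partial>angle_measure)"
  proof (rule integral_mono_AE)
    show "integrable angle_measure (\<lambda>t. - ln (reg_det \<delta> (cis t)))"
      by (intro Bochner_Integration.integrable_minus integrable_ln_reg_det \<delta>)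
    have G: "1 \<le> ?G t" "?G t \<le> (2 * C\<^sup>2)\<^sup>2 + 4 * C\<^sup>2 + 1" for t
      using gram_det_ge[of 1 "X (cis t)" "Y (cis t)" 0 "Y' (cis t)"]
        gram_det_one_le[OF XC(1) XC(2) _ XC(3), of 0 "cis t" "cis t" "cis t"] C0 by simp_all
    show "integrable angle_measure (\<lambda>t. ln (?G t))"
    proof (rule integrable_angle_bounded[where B="ln ((2 * C\<^sup>2)\<^sup>2 + 4 * C\<^sup>2 + 1)"])
      show "(\<lambda>t. ln (?G t)) \<in> borel_measurable borel" by measurable
      fix t
      have "0 < ?G t" "0 < (2 * C\<^sup>2)\<^sup>2 + 4 * C\<^sup>2 + 1" using G[of t] by linarith+
      then show "norm (ln (?G t)) \<le> ln ((2 * C\<^sup>2)\<^sup>2 + 4 * C\<^sup>2 + 1)" using G[of t] by simp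
    qed
    show "AE t in angle_measure. - ln (reg_det \<delta> (cis t)) \<le> ln (?G t)"
      using good_AE N_null
    proof eventually_elim
      case (elim t)
      have g: "0 \<le> p (cis t)" "0 \<le> s (cis t)" "(norm (q (cis t)))\<^sup>2 \<le> p (cis t) * s (cis t)"
        using elim(1) by (simp_all add: good_def)
      have pos: "reg_det \<delta> (cis t) > 0" using ch(1)[OF g] zero_less_power[OF \<delta>, of 2] by linarith
      have "1 / reg_det \<delta> (cis t) \<le> ?G t"
        using ch(8)[OF g] elim by (simp add: X_def Y_def Y'_def x_def y_def y'_def)
      then have "ln (1 / reg_det \<delta> (cis t)) \<le> ln (?G t)" using pos by (intro ln_mono) auto
      then show ?case using pos by (simp add: ln_div)
    qed
  qed
  then show ?thesis using upper by simp
qed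

section \<open>From the entropy bounds to the equivalence\<close>

text \<open>Where det W > 0 it is at most p s, and ln p + ln s \<le> p + s - 2; so the integrable
  trace dominates the positive part.\<close>

lemma nn_integral_pos_part:
  "(\<integral>\<^sup>+t. e2ennreal (elog (Re (det (W (cis t))))) \<partial>angle_measure) < \<infinity>"
proof -
  have "(\<integral>\<^sup>+t. e2ennreal (elog (Re (det (W (cis t))))) \<partial>angle_measure) \<le> (\<integral>\<^sup>+t. ennreal (tr_W t) \<partial>angle_measure)"
  proof (rule nn_integral_mono_AE)
    show "AE t in angle_measure. e2ennreal (elog (Re (det (W (cis t))))) \<le> ennreal (tr_W t)"
      using psd_W_AE
    proof eventually_elim
      case (elim t)
      define p s where "p = Re (W (cis t) $ 1 $ 1)" and "s = Re (W (cis t) $ 2 $ 2)"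
      note e = psd_matrix_entries(4-7)[OF elim, folded p_def s_def]
      show ?case
      proof (cases "Re (det (W (cis t))) \<le> 0")
        case True
        then show ?thesis by (simp add: elog_def e2ennreal_neg)
      next
        case False
        then have "p * s > 0" using e(3,4) by (smt (verit) zero_le_power2)
        then have "p > 0" "s > 0" using e by (auto simp: zero_less_mult_iff)
        have "ln (Re (det (W (cis t)))) \<le> ln (p * s)" using False e \<open>p * s > 0\<close> by simp
        also have "\<dots> = ln p + ln s" using \<open>p > 0\<close> \<open>s > 0\<close> by (simp add: ln_mult)
        also have "\<dots> \<le> tr_W t"
          using ln_le_minus_one[OF \<open>p > 0\<close>] ln_le_minus_one[OF \<open>s > 0\<close>] by (simp add: tr_W_def p_def s_def)
        finally show ?thesis using False by (simp add: elog_def e2ennreal_ereal ennreal_leI)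
      qed
    qed
  qed
  also have "\<dots> < \<infinity>"
    using integrable_tr_W by (simp add: real_integrable_def top.not_eq_extremum)
  finally show ?thesis .
qed

text \<open>Fatou along \<delta> = 1/(m+1). \<open>ennreal\<close> keeps only the positive part of
  u; adding the integrable \<open>tr_W t + 2\<close> makes the function nonnegative because \<delta>
  \<le> 1, and its integral is bounded uniformly in m by \<open>entropy_lower_bound\<close>.\<close>

lemma nn_integral_neg_part:
  assumes \<kappa>: "\<kappa> > 0" "\<And>n. \<kappa> \<le> schur_coeff_prod n \<gamma>"
  shows "(\<integral>\<^sup>+t. e2ennreal (- elog (Re (det (W (cis t))))) \<partial>angle_measure) < \<infinity>"
proof -
  define \<delta> where "\<delta> m = inverse (real (Suc m))" for m
  have \<delta>: "\<delta> m > 0" "\<delta> m \<le> 1" for m by (simp_all add: \<delta>_def field_simps)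
  define u where "u m t = - ln (reg_det (\<delta> m) (cis t))" for m t
  define K where "K = (\<integral>t. tr_W t + 2 \<partial>angle_measure) + (2 - 2 * ln \<kappa>)"
  have iT: "integrable angle_measure (\<lambda>t. tr_W t + 2)" using integrable_tr_W by simp
  have iu: "integrable angle_measure (u m)" for m
    unfolding u_def by (intro Bochner_Integration.integrable_minus integrable_ln_reg_det \<delta>)
  have bound: "(\<integral>\<^sup>+t. ennreal (u m t) \<partial>angle_measure) \<le> ennreal K" for m
  proof -
    have AE: "AE t in angle_measure. 0 \<le> tr_W t \<and> 0 \<le> u m t + (tr_W t + 2)"
      using psd_W_AE
    proof eventually_elim
      case (elim t)
      then show ?case using psd_matrix_entries(4,5)[OF elim] reg_det_bounds(2)[OF \<delta>(1)[of m] elim] \<delta>(2)[of m]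
        by (simp add: tr_W_def u_def)
    qed
    have "(\<integral>\<^sup>+t. ennreal (u m t) \<partial>angle_measure) \<le> (\<integral>\<^sup>+t. ennreal (u m t + (tr_W t + 2)) \<partial>angle_measure)"
      using AE by (intro nn_integral_mono_AE) (elim eventually_mono, auto intro: ennreal_leI)
    also have "\<dots> = ennreal (\<integral>t. u m t + (tr_W t + 2) \<partial>angle_measure)"
      using AE by (intro nn_integral_eq_integral Bochner_Integration.integrable_add iu iT) (elim eventually_mono, auto)
    also have "(\<integral>t. u m t + (tr_W t + 2) \<partial>angle_measure) = (\<integral>t. u m t \<partial>angle_measure) + (\<integral>t. tr_W t + 2 \<partial>angle_measure)"
      by (rule Bochner_Integration.integral_add[OF iu iT])
    also have "\<dots> \<le> K" using entropy_lower_bound[OF \<delta>(1) \<kappa>, of m] by (simp add: K_def u_def)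
    finally show ?thesis by (simp add: ennreal_leI)
  qed
  have um: "(\<lambda>t. ennreal (u m t)) \<in> borel_measurable angle_measure" for m
    using borel_measurable_integrable[OF iu[of m]] by measurable
  have "(\<integral>\<^sup>+t. e2ennreal (- elog (Re (det (W (cis t))))) \<partial>angle_measure)
    \<le> (\<integral>\<^sup>+t. liminf (\<lambda>m. ennreal (u m t)) \<partial>angle_measure)"
  proof (rule nn_integral_mono_AE)
    show "AE t in angle_measure. e2ennreal (- elog (Re (det (W (cis t))))) \<le> liminf (\<lambda>m. ennreal (u m t))"
      using psd_W_AE
    proof eventually_elim
      case (elim t)
      define D where "D = Re (det (W (cis t)))"
      note e = psd_matrix_entries(4-7)[OF elim]
      have D0: "D \<ge> 0" using e by (simp add: D_def)
      have "\<delta> \<longlonglongrightarrow> 0" unfolding \<delta>_def by (rule LIMSEQ_inverse_real_of_nat)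
      then have "(\<lambda>m. reg_det (\<delta> m) (cis t)) \<longlonglongrightarrow> (Re (W (cis t) $ 1 $ 1) + 0) * (Re (W (cis t) $ 2 $ 2) + 0) - (norm (W (cis t) $ 1 $ 2))\<^sup>2"
        unfolding reg_det_def W_meas_cis by (intro tendsto_intros)
      then have lim: "(\<lambda>m. reg_det (\<delta> m) (cis t)) \<longlonglongrightarrow> D" using e(4) by (simp add: D_def)
      have pos: "reg_det (\<delta> m) (cis t) > 0" for m
        using reg_det_bounds(1)[OF \<delta>(1)[of m] elim] zero_less_power[OF \<delta>(1)[of m], of 2] by linarith
      show ?case
      proof (cases "D = 0")
        case False
        then have "(\<lambda>m. ennreal (u m t)) \<longlonglongrightarrow> ennreal (- ln D)"
          unfolding u_def by (intro tendsto_ennrealI tendsto_minus tendsto_ln lim)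
        from lim_imp_Liminf[OF _ this] show ?thesis using False D0
          by (simp add: D_def[symmetric] elog_def e2ennreal_ereal)
      next
        case True
        \<comment> \<open>Where det W = 0 the regularized determinants decrease to 0 through
          positive values, so u tends to infinity, in accordance with
          \<open>elog 0 = -\<infinity>\<close>.\<close>
        have "reg_det (\<delta> m) (cis t) \<noteq> 0" for m using pos[of m] by simp
        then have "filterlim (\<lambda>m. reg_det (\<delta> m) (cis t)) (at_right 0) sequentially"
          using lim pos True by (simp add: filterlim_at)
        then have "filterlim (\<lambda>m. ln (reg_det (\<delta> m) (cis t))) at_bot sequentially"
          by (rule filterlim_compose[OF ln_at_0])
        then have "filterlim (\<lambda>m. u m t) at_top sequentially"
          unfolding u_def by (simp add: filterlim_uminus_at_top)
        then have "(\<lambda>m. ennreal (u m t)) \<longlonglongrightarrow> top" by (simp only: ennreal_tendsto_top_eq_at_top)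
        from lim_imp_Liminf[OF _ this] show ?thesis by simp
      qed
    qed
  qed
  also have "\<dots> \<le> liminf (\<lambda>m. \<integral>\<^sup>+t. ennreal (u m t) \<partial>angle_measure)"
    by (rule nn_integral_liminf[OF um])
  also have "\<dots> \<le> ennreal K"
    using bound by (intro Liminf_le) (auto intro: always_eventually)
  also have "\<dots> < \<infinity>" by simp
  finally show ?thesis .
qed

text \<open>A finite negative part forces det W > 0 almost everywhere and, with the finite positive
  part, makes ln det W integrable. \<open>entropy_upper_bound\<close> then bounds all products below
  by the exponential of half the mean.\<close>

lemma schur_coeff_prod_bounded_below:
  assumes "(\<integral>\<^sup>+t. e2ennreal (- elog (Re (det (W (cis t))))) \<partial>angle_measure) < \<infinity>"
  shows "\<exists>\<kappa>>0. \<forall>n. \<kappa> \<le> schur_coeff_prod n \<gamma>"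
proof -
  define D where "D t = Re (det (W (cis t)))" for t
  have Dm[measurable]: "D \<in> borel_measurable borel"
  proof -
    have "(\<lambda>t. W (cis t) $ a $ b) \<in> borel_measurable borel" for a b
      using borel_measurable_integrable[OF integrable_W_entry[of a b]] by simp
    then show ?thesis unfolding D_def det_2 by measurable
  qed
  have [measurable]: "elog \<in> borel_measurable borel" unfolding elog_def by measurable
  have neg: "(\<integral>\<^sup>+t. e2ennreal (- elog (D t)) \<partial>angle_measure) < \<infinity>" using assms by (simp add: D_def)
  have posi: "(\<integral>\<^sup>+t. e2ennreal (elog (D t)) \<partial>angle_measure) < \<infinity>" using nn_integral_pos_part by (simp add: D_def)
  have "AE t in angle_measure. e2ennreal (- elog (D t)) \<noteq> \<infinity>"
    by (rule nn_integral_PInf_AE) (use neg in auto)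
  then have D_pos: "AE t in angle_measure. D t > 0"
    by eventually_elim (auto simp: elog_def split: if_splits)
  have int: "integrable angle_measure (\<lambda>t. ln (D t))"
  proof (rule integrableI_bounded)
    have "(\<integral>\<^sup>+t. ennreal (norm (ln (D t))) \<partial>angle_measure)
      \<le> (\<integral>\<^sup>+t. e2ennreal (elog (D t)) + e2ennreal (- elog (D t)) \<partial>angle_measure)"
    proof (rule nn_integral_mono_AE)
      show "AE t in angle_measure. ennreal (norm (ln (D t))) \<le> e2ennreal (elog (D t)) + e2ennreal (- elog (D t))"
        using D_pos
      proof eventually_elim
        case (elim t)
        then show ?case
          by (cases "ln (D t) \<ge> 0") (simp_all add: elog_def e2ennreal_ereal)
      qed
    qed
    also have "\<dots> = (\<integral>\<^sup>+t. e2ennreal (elog (D t)) \<partial>angle_measure) + (\<integral>\<^sup>+t. e2ennreal (- elog (D t)) \<partial>angle_measure)"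
      by (rule nn_integral_add) measurable
    also have "\<dots> < \<infinity>" using neg posi by simp
    finally show "(\<integral>\<^sup>+t. ennreal (norm (ln (D t))) \<partial>angle_measure) < \<infinity>" .
  qed measurable
  define L where "L = (\<integral>t. ln (D t) \<partial>angle_measure) / 2"
  have "exp L \<le> schur_coeff_prod n \<gamma>" for n
  proof -
    have "L \<le> ln (schur_coeff_prod n \<gamma>)"
      unfolding L_def D_def by (rule entropy_upper_bound) (use int D_pos in \<open>simp_all add: D_def\<close>)
    then show ?thesis using schur_coeff_prod_pos[OF \<gamma>, of n] by (simp add: ln_ge_iff)
  qed
  then show ?thesis by (intro exI[of _ "exp L"]) simp
qed

text \<open>The positive part has finite integral, so the difference exceeds -\<infinity> exactly
  when the integral of the negative part is finite.\<close>

lemma szego_iff: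
  "summable (\<lambda>n. (norm (\<gamma> n))\<^sup>2) \<longleftrightarrow>
    extended_integral angle_measure (\<lambda>t. elog (Re (det (W (cis t))))) > -\<infinity>"
proof -
  let ?neg = "\<integral>\<^sup>+t. e2ennreal (- elog (Re (det (W (cis t))))) \<partial>angle_measure"
  let ?pos = "\<integral>\<^sup>+t. e2ennreal (elog (Re (det (W (cis t))))) \<partial>angle_measure"
  obtain r where r: "?pos = ennreal r" "0 \<le> r"
    using nn_integral_pos_part by (cases ?pos) auto
  have "summable (\<lambda>n. (norm (\<gamma> n))\<^sup>2) \<longleftrightarrow> ?neg < \<infinity>"
    unfolding summable_iff_schur_coeff_prod_bounded_below[OF \<gamma>]
    using nn_integral_neg_part schur_coeff_prod_bounded_below by blast
  also have "\<dots> \<longleftrightarrow> extended_integral angle_measure (\<lambda>t. elog (Re (det (W (cis t))))) > -\<infinity>"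
    unfolding extended_integral_def r(1) using r(2) by (cases ?neg) (simp_all add: enn2ereal_ennreal)
  finally show ?thesis .
qed

end

theorem corollary8p3:
  fixes c :: "int \<Rightarrow> quat" and \<gamma> :: "nat \<Rightarrow> quat" and i j :: quat
    and M :: "complex set \<Rightarrow> complex^2^2" and W :: "complex \<Rightarrow> complex^2^2"
  assumes "nontrivial_positive_definite_seq c"
    and "c 0 = 1"
    and "verblunsky_coefficients c \<gamma>"
    and "i \<in> \<S>" and "j \<in> \<S>" and "inner i j = 0"
    and "psd_matrix_measure M"
    and "\<forall>n::int. has_matrix_integral M (\<lambda>z. z powi n) (chi i j (c n))"
    and "radon_nikodym_derivative M W"
  shows "summable (\<lambda>n. (norm (\<gamma> n))\<^sup>2) \<longleftrightarrow>
    extended_integral angle_measure (\<lambda>\<theta>. elog (Re (det (W (cis \<theta>))))) > -\<infinity>"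
proof -
  obtain f fs where f: "schur_fps_of c f" "schur_algorithm f fs \<gamma>"
    using assms(3) unfolding verblunsky_coefficients_def by blast
  obtain Ms where W: "integrable angle_measure (\<lambda>t. W (cis t))" and Ms: "singular_matrix_measure Ms"
    and decomp: "\<And>A. A \<in> circle_sets \<Longrightarrow>
      M A = (\<integral>t. indicator A (cis t) *\<^sub>R W (cis t) \<partial>angle_measure) + Ms A"
    using assms(9) unfolding radon_nikodym_derivative_def by blast
  obtain N where N: "N \<in> circle_sets" "AE t in angle_measure. cis t \<notin> N"
    "\<And>A. A \<in> circle_sets \<Longrightarrow> A \<inter> N = {} \<Longrightarrow> Ms A = 0"
    using Ms unfolding singular_matrix_measure_def by blast
  have "positive_definite_seq c" using assms(1) by (simp add: nontrivial_positive_definite_seq_def)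
  note c = positive_definite_seq_hermitian[OF this assms(2)]
  note \<gamma> = verblunsky_norm_less_1[OF assms(1,2) f(2,1)]
  interpret szego_setting i j M Ms W N c f fs \<gamma>
    by unfold_locales (use assms f W N decomp c \<gamma> in auto)
  show ?thesis by (rule szego_iff)
qed

end
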